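(* Let $\mathscr G_j=\{G_j: D_{\mathrm{KL}}(G_j,F_j)\le\epsilon_j\}$, $j\in\{0,1\}$, and let $l=f_1/f_0$. The least favorable densities $$\hat g_0=\exp\left[\frac{-\lambda_0-\mu_0}{\lambda_0}\right]\exp\left[\frac{(1-u)(\hat g_1/\hat g_0)^{u}}{\lambda_0}\right]f_0,$$ $$\hat g_1=\exp\left[\frac{-\lambda_1-\mu_1}{\lambda_1}\right]\exp\left[\frac{u(\hat g_1/\hat g_0)^{-1+u}}{\lambda_1}\right]f_1,$$ with the robust likelihood ratio function $$\frac{\hat g_1}{\hat g_0}=\exp\left[\frac{-\mu_1}{\lambda_1}+\frac{\mu_0}{\lambda_0}\right]\exp\left[\frac{u(\hat g_1/\hat g_0)^{-1+u}}{\lambda_1}+\frac{(-1+u)(\hat g_1/\hat g_0)^{u}}{\lambda_0}\right]l,$$ provide a unique solution to the max-min problem (P) stated in the context. Moreover, given $u$, the Lagrangian parameters $\lambda_0$ and $\lambda_1$, hence $\mu_0$ and $\mu_1$, can be obtained by solving $$\int_\Omega r_0\log(r_0/s_0)\,f_0\,d\mu/s_0=\epsilon_0,\qquad \int_\Omega r_1\log(r_1/s_1)\,f_1\,d\mu/s_1=\epsilon_1,\qquad \frac{\hat g_1}{\hat g_0}=\frac{r_1s_0}{r_0s_1}\,l,$$ where $$r_0=r_0(\lambda_0,\hat g_1/\hat g_0)=\exp\left[\frac{(1-u)(\hat g_1/\hat g_0)^{u}}{\lambda_0}\right],\qquad r_1=r_1(\lambda_1,\hat g_1/\hat g_0)=\exp\left[\frac{u(\hat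 g_1/\hat g_0)^{-1+u}}{\lambda_1}\right],$$ $$s_0(\lambda_0)=\int_\Omega r_0f_0\,d\mu=\exp\left[\frac{\lambda_0+\mu_0}{\lambda_0}\right],\qquad s_1(\lambda_1)=\int_\Omega r_1f_1\,d\mu=\exp\left[\frac{\lambda_1+\mu_1}{\lambda_1}\right].$$
   Context: $F_0,F_1$ are the nominal probability distributions on $\Omega$ under the hypotheses $\mathcal H_0,\mathcal H_1$, with densities $f_0,f_1$ with respect to a dominating measure $\mu$; $g_j$ is the density of $G_j$. $D_{\mathrm{KL}}(G_j,F_j)=\int_\Omega\log(g_j/f_j)\,g_j\,d\mu$, and $\epsilon_0,\epsilon_1$ are the robustness parameters. The $u$-affinity is $D_u(G_0,G_1)=\int_\Omega g_1^{\,u}g_0^{\,1-u}\,d\mu$. Write $\Upsilon(G)=\int_\Omega g\,d\mu$. Problem (P): find $\hat g_0,\hat g_1$ and $\hat u$ such that $$\hat g_0=\arg\sup_{G_0\in\mathscr G_0}D_u(G_0,G_1)\ \text{ s.t. } g_0>0,\ \Upsilon(G_0)=1,\qquad \hat g_1=\arg\sup_{G_1\in\mathscr G_1}D_u(G_0,G_1)\ \text{ s.t. } g_1>0,\ \Upsilon(G_1)=1,$$ $$\hat u=\arg\min_{u\in(0,1)}D_u(\hat G_0,\hat G_1).$$ The two maximizations are coupled (in each of them the other argument is the other least favorable distribution) and are performed for the given $u$, i.e. $\hat g_0,\hat g_1$ are obtained as functions of $u$; the minimization over $u$ is then performed. The scalars $\lambda_j,\mu_j$ are the Lagrangian (KKT)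 multipliers in $$L_j=D_u(G_0,G_1)+\lambda_j\bigl(\epsilon_j-D_{\mathrm{KL}}(G_j,F_j)\bigr)+\mu_j\bigl(1-\Upsilon(G_j)\bigr),\quad j\in\{0,1\}.$$
   Formalization: Added: f_0, f_1 > 0 a.e., ε_0, ε_1 > 0, and no density g > 0 of mass 1 lies in both 𝒢_0 and 𝒢_1. If they overlap (e.g. f_0 = f_1), any common g gives D_u = 1 for all u, so uniqueness and the closed forms fail. *)

theory Defs
  imports "HOL-Probability.Information"
begin

text \<open>Distributions on \<open>\<Omega> = space M\<close> are represented by their densities with respect to the
  dominating measure \<open>M\<close>, so everything pointwise is meant almost everywhere.\<close>

definition total_mass :: "'a measure \<Rightarrow> ('a \<Rightarrow> real) \<Rightarrow> real" where
  "total_mass M g = (\<integral>x. g x \<partial>M)"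

definition pos_density :: "'a measure \<Rightarrow> ('a \<Rightarrow> real) \<Rightarrow> bool" where
  "pos_density M g \<longleftrightarrow> g \<in> borel_measurable M \<and> (AE x in M. 0 < g x) \<and> total_mass M g = 1"

definition affinity :: "'a measure \<Rightarrow> real \<Rightarrow> ('a \<Rightarrow> real) \<Rightarrow> ('a \<Rightarrow> real) \<Rightarrow> real" where
  "affinity M u g0 g1 = (\<integral>x. g1 x powr u * g0 x powr (1 - u) \<partial>M)"

text \<open>For densities the negative part of \<open>ln (g / f) * g\<close> is always integrable, as
  \<open>ln (g / f) * g \<ge> g - f\<close>. Hence non-integrability means that the divergence is infinite; the
  Bochner integral would return 0 instead.\<close>

definition KL_div :: "'a measure \<Rightarrow> ('a \<Rightarrow> real) \<Rightarrow> ('a \<Rightarrow> real) \<Rightarrow> ereal" where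
  "KL_div M g f =
     (if integrable M (\<lambda>x. ln (g x / f x) * g x)
      then ereal (\<integral>x. ln (g x / f x) * g x \<partial>M) else \<infinity>)"

lemma (in sigma_finite_measure) KL_div_eq_KL_divergence:
  assumes "pos_density M f" "pos_density M g"
    and "integrable M (\<lambda>x. ln (g x / f x) * g x)"
  shows "KL_div M g f = ereal (KL_divergence (exp 1) (density M f) (density M g))"
proof -
  have f: "f \<in> borel_measurable M" "AE x in M. 0 < f x"
    and g: "g \<in> borel_measurable M" "AE x in M. 0 < g x"
    using assms(1,2) by (auto simp: pos_density_def)
  have "KL_divergence (exp 1) (density M f) (density M g)
      = (\<integral>x. g x * log (exp 1) (g x / f x) \<partial>M)"
    by (rule KL_density_density) (use f g in \<open>auto elim: eventually_mono\<close>)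
  then show ?thesis
    using assms(3) by (simp add: KL_div_def log_def mult.commute)
qed

definition KL_ball :: "'a measure \<Rightarrow> ('a \<Rightarrow> real) \<Rightarrow> real \<Rightarrow> ('a \<Rightarrow> real) set" where
  "KL_ball M f eps = {g \<in> borel_measurable M. KL_div M g f \<le> ereal eps}"

definition feasible :: "'a measure \<Rightarrow> ('a \<Rightarrow> real) \<Rightarrow> real \<Rightarrow> ('a \<Rightarrow> real) set" where
  "feasible M f eps = {g \<in> KL_ball M f eps. (AE x in M. 0 < g x) \<and> total_mass M g = 1}"

text \<open>The coupled maximizations for a given \<open>u\<close>: each density is optimal against the other one.\<close>

definition least_favorable ::
  "'a measure \<Rightarrow> ('a \<Rightarrow> real) \<Rightarrow> ('a \<Rightarrow> real) \<Rightarrow> real \<Rightarrow> real \<Rightarrow> real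
    \<Rightarrow> ('a \<Rightarrow> real) \<Rightarrow> ('a \<Rightarrow> real) \<Rightarrow> bool" where
  "least_favorable M f0 f1 eps0 eps1 u g0 g1 \<longleftrightarrow>
     is_arg_max (\<lambda>g. affinity M u g g1) (\<lambda>g. g \<in> feasible M f0 eps0) g0 \<and>
     is_arg_max (\<lambda>g. affinity M u g0 g) (\<lambda>g. g \<in> feasible M f1 eps1) g1"

text \<open>Problem (P): the least favorable densities are functions of \<open>u\<close>, and the minimization
  over \<open>u\<close> is carried out along them.\<close>

definition solves_maxmin ::
  "'a measure \<Rightarrow> ('a \<Rightarrow> real) \<Rightarrow> ('a \<Rightarrow> real) \<Rightarrow> real \<Rightarrow> real
    \<Rightarrow> (real \<Rightarrow> 'a \<Rightarrow> real) \<Rightarrow> (real \<Rightarrow> 'a \<Rightarrow> real) \<Rightarrow> real \<Rightarrow> bool" where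
  "solves_maxmin M f0 f1 eps0 eps1 g0 g1 u \<longleftrightarrow>
     (\<forall>v\<in>{0<..<1}. least_favorable M f0 f1 eps0 eps1 v (g0 v) (g1 v)) \<and>
     is_arg_min (\<lambda>v. affinity M v (g0 v) (g1 v)) (\<lambda>v. v \<in> {0<..<1}) u"

text \<open>\<open>D\<close> is the \<open>u\<close>-affinity as a function of one argument, the other one being held fixed.\<close>

definition lagrangian ::
  "'a measure \<Rightarrow> (('a \<Rightarrow> real) \<Rightarrow> real) \<Rightarrow> ('a \<Rightarrow> real) \<Rightarrow> real \<Rightarrow> real \<Rightarrow> real
    \<Rightarrow> ('a \<Rightarrow> real) \<Rightarrow> real" where
  "lagrangian M D f eps lam mu g =
     D g + lam * (eps - real_of_ereal (KL_div M g f)) + mu * (1 - total_mass M g)"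

text \<open>Primal feasibility, dual feasibility, complementary slackness, and stationarity in the sense
  of Gateaux. A direction \<open>\<psi>\<close> can be followed both ways under the constraint \<open>g > 0\<close> iff
  \<open>\<bar>\<psi>\<bar> \<le> g / \<delta>\<close> for some \<open>\<delta> > 0\<close>.\<close>

definition KKT_multipliers ::
  "'a measure \<Rightarrow> (('a \<Rightarrow> real) \<Rightarrow> real) \<Rightarrow> ('a \<Rightarrow> real) \<Rightarrow> real \<Rightarrow> ('a \<Rightarrow> real)
    \<Rightarrow> real \<Rightarrow> real \<Rightarrow> bool" where
  "KKT_multipliers M D f eps g lam mu \<longleftrightarrow>
     g \<in> feasible M f eps \<and> 0 \<le> lam \<and> lam * (eps - real_of_ereal (KL_div M g f)) = 0 \<and>
     (\<forall>\<psi>\<in>borel_measurable M. (\<exists>\<delta>>0. AE x in M. \<delta> * \<bar>\<psi> x\<bar> \<le> g x) \<longrightarrow>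
        ((\<lambda>t. lagrangian M D f eps lam mu (\<lambda>x. g x + t * \<psi> x)) has_real_derivative 0) (at 0))"

definition least_favorable_KKT ::
  "'a measure \<Rightarrow> ('a \<Rightarrow> real) \<Rightarrow> ('a \<Rightarrow> real) \<Rightarrow> real \<Rightarrow> real \<Rightarrow> real
    \<Rightarrow> ('a \<Rightarrow> real) \<Rightarrow> ('a \<Rightarrow> real) \<Rightarrow> real \<Rightarrow> real \<Rightarrow> real \<Rightarrow> real \<Rightarrow> bool" where
  "least_favorable_KKT M f0 f1 eps0 eps1 u g0 g1 lam0 lam1 mu0 mu1 \<longleftrightarrow>
     least_favorable M f0 f1 eps0 eps1 u g0 g1 \<and>
     KKT_multipliers M (\<lambda>g. affinity M u g g1) f0 eps0 g0 lam0 mu0 \<and>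
     KKT_multipliers M (\<lambda>g. affinity M u g0 g) f1 eps1 g1 lam1 mu1"

definition r0 :: "real \<Rightarrow> real \<Rightarrow> real \<Rightarrow> real" where
  "r0 u lam0 L = exp ((1 - u) * L powr u / lam0)"

definition r1 :: "real \<Rightarrow> real \<Rightarrow> real \<Rightarrow> real" where
  "r1 u lam1 L = exp (u * L powr (-1 + u) / lam1)"

definition s0 :: "'a measure \<Rightarrow> ('a \<Rightarrow> real) \<Rightarrow> real \<Rightarrow> real \<Rightarrow> ('a \<Rightarrow> real) \<Rightarrow> real" where
  "s0 M f0 u lam0 L = (\<integral>x. r0 u lam0 (L x) * f0 x \<partial>M)"

definition s1 :: "'a measure \<Rightarrow> ('a \<Rightarrow> real) \<Rightarrow> real \<Rightarrow> real \<Rightarrow> ('a \<Rightarrow> real) \<Rightarrow> real" where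
  "s1 M f1 u lam1 L = (\<integral>x. r1 u lam1 (L x) * f1 x \<partial>M)"

text \<open>The unknowns are \<open>lam0\<close>, \<open>lam1\<close> and the robust likelihood ratio \<open>L\<close>. No integrability
  conditions are needed: a divergent integral would evaluate to 0, which is incompatible
  with \<open>eps0, eps1 > 0\<close> and, through the third equation, with \<open>L > 0\<close>.\<close>

definition parameter_system ::
  "'a measure \<Rightarrow> ('a \<Rightarrow> real) \<Rightarrow> ('a \<Rightarrow> real) \<Rightarrow> real \<Rightarrow> real \<Rightarrow> real
    \<Rightarrow> real \<Rightarrow> real \<Rightarrow> ('a \<Rightarrow> real) \<Rightarrow> bool" where
  "parameter_system M f0 f1 eps0 eps1 u lam0 lam1 L \<longleftrightarrow>
     (let S0 = s0 M f0 u lam0 L; S1 = s1 M f1 u lam1 L in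
       (\<integral>x. r0 u lam0 (L x) * ln (r0 u lam0 (L x) / S0) * f0 x / S0 \<partial>M) = eps0 \<and>
       (\<integral>x. r1 u lam1 (L x) * ln (r1 u lam1 (L x) / S1) * f1 x / S1 \<partial>M) = eps1 \<and>
       (AE x in M. L x = (r1 u lam1 (L x) * S0) / (r0 u lam0 (L x) * S1) * (f1 x / f0 x)))"

end

theory Submission
  imports Defs
begin

text \<open>The affinity is jointly concave and the divergence balls are convex. For fixed \<open>u\<close>, bounded
  relative perturbations of an optimal density and a Farkas argument produce the multipliers; if the
  divergence constraint were slack or its multiplier zero, the likelihood ratio \<open>g1 / g0\<close> would be
  constant, hence \<open>g0 = g1\<close>, against disjointness. Conversely, the tangent plane inequalities for the
  affinity and the divergence turn the stationarity equations into joint optimality, so coordinatewise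
  optima are joint optima; two of them coincide because the constraint would be slack at their
  midpoint otherwise. For existence, a maximizing sequence that is nearly minimal for a strictly convex
  functional converges almost everywhere along a subsequence; the limit is positive since moving
  from a zero towards \<open>min f0 f1\<close> lowers the divergence at rate \<open>t * ln t\<close>. The optimal value is
  convex in \<open>u\<close>, below 1 inside the unit interval and tends to 1 at its ends, so it has a minimum,
  which is unique because the affinity is strictly convex in \<open>u\<close>.\<close>

section \<open>Pointwise inequalities\<close>

text \<open>The integrand \<open>q powr u * g powr (1 - u)\<close> is homogeneous of degree 1 in
  \<open>(g, q)\<close>. Its tangent planes therefore have no constant term and depend on the ratio
  \<open>q / g\<close> alone, and by Euler's identity the two partial derivatives of the affinity,
  integrated against \<open>g0\<close> and \<open>g1\<close>, return the fractions
  \<open>1 - u\<close> and \<open>u\<close> of its value. This is why two separate stationarity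
  conditions add up to one joint bound. The price of homogeneity is that the affinity is linear
  between pairs with the same ratio: it is not strictly concave, so uniqueness has to come from the
  divergence. For existence the obstacle is to get pointwise convergence, since the divergence is
  only controlled from one side in the limit. The auxiliary functional is the integral of
  \<open>f * f / (f + a)\<close>: it lies between 0 and 1 for every density \<open>a\<close>, is
  strictly convex in \<open>a\<close>, and its integrand determines \<open>a\<close>, so that
  convergence of the integrand can be turned back into convergence of the densities.\<close>

lemma young_le:
  fixes a b u :: real
  assumes "0 \<le> a" "0 \<le> b" "0 < u" "u < 1"
  shows "a powr u * b powr (1 - u) \<le> u * a + (1 - u) * b"
proof (cases "a = 0 \<or> b = 0")
  case True
  then show ?thesis using assms by auto
next
  case False
  then show ?thesis using assms Youngs_inequality_0[of u "1 - u" a b] by simp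
qed

text \<open>After division by the arithmetic mean \<open>m\<close>, the hypothesis says that the
  weighted sum of the logarithms vanishes; the weighted sum of their upper bounds
  \<open>x - 1\<close> vanishes as well. Hence both bounds \<open>ln x \<le> x - 1\<close> are
  attained, which happens only at \<open>x = 1\<close>.\<close>

lemma young_eq:
  fixes a b u :: real
  assumes "0 < a" "0 < b" "0 < u" "u < 1"
    and eq: "a powr u * b powr (1 - u) = u * a + (1 - u) * b"
  shows "a = b"
proof -
  define m where "m = u * a + (1 - u) * b"
  have m: "m > 0" using assms by (simp add: m_def add_pos_pos)
  have "ln m = u * ln a + (1 - u) * ln b"
    using assms by (simp add: m_def flip: eq) (simp add: ln_mult ln_powr)
  then have 1: "u * ln (a / m) + (1 - u) * ln (b / m) = 0"
    using m assms by (simp add: ln_div algebra_simps)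
  have a: "ln (a / m) \<le> a / m - 1" and b: "ln (b / m) \<le> b / m - 1"
    using m assms by (auto intro: ln_le_minus_one)
  have 2: "u * (a / m - 1) + (1 - u) * (b / m - 1) = 0"
  proof -
    have "u * (a / m - 1) + (1 - u) * (b / m - 1) = (u * a + (1 - u) * b) / m - 1"
      using m by (simp add: field_simps)
    then show ?thesis using m by (simp add: m_def)
  qed
  have u': "0 < 1 - u" using assms by simp
  have "u * ln (a / m) \<le> u * (a / m - 1)"
    using a assms by simp
  moreover have "(1 - u) * ln (b / m) \<le> (1 - u) * (b / m - 1)"
    using b assms by simp
  ultimately have "u * ln (a / m) = u * (a / m - 1)" "(1 - u) * ln (b / m) = (1 - u) * (b / m - 1)"
    using 1 2 by linarith+
  then have "ln (a / m) = a / m - 1" "ln (b / m) = b / m - 1"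
    using assms(3) u' by (auto simp only: mult_cancel_left)
  then have "a / m = 1" "b / m = 1"
    using m assms(1,2) by (intro ln_eq_minus_one; simp)+
  then show ?thesis using m by simp
qed

lemma powr_ratio_tangent_form:
  fixes L p h u :: real
  assumes "0 < L" "0 \<le> p" "0 \<le> h"
  shows "(L powr (u - 1) * p) powr u * (L powr u * h) powr (1 - u) = p powr u * h powr (1 - u)"
proof -
  have "(L powr (u - 1) * p) powr u * (L powr u * h) powr (1 - u)
      = L powr ((u - 1) * u + u * (1 - u)) * (p powr u * h powr (1 - u))"
    using assms by (simp add: powr_mult powr_powr powr_add)
  also have "(u - 1) * u + u * (1 - u) = 0" by (simp add: algebra_simps)
  finally show ?thesis using assms by simp
qed

text \<open>The right-hand side is the tangent plane of \<open>p powr u * h powr (1 - u)\<close>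
  along the ray \<open>p = L * h\<close>. The rescaling makes the two arguments of Young's
  inequality equal on that ray, and by \<open>powr_ratio_tangent_form\<close> it leaves the
  geometric mean unchanged.\<close>

lemma affinity_tangent:
  fixes L p h u :: real
  assumes "0 < L" "0 \<le> p" "0 \<le> h" "0 < u" "u < 1"
  shows "p powr u * h powr (1 - u) \<le> u * (L powr (u - 1) * p) + (1 - u) * (L powr u * h)"
  using young_le[of "L powr (u - 1) * p" "L powr u * h" u] powr_ratio_tangent_form[of L p h u] assms
  by simp

text \<open>At the base point of the tangent plane, where \<open>L = q / g\<close>, both of its
  terms reduce to the same geometric mean; equality in \<open>affinity_tangent\<close> comes from
  here.\<close>

lemma powr_ratio_mult:
  fixes g q u :: real
  assumes "0 < g" "0 < q"
  shows "(q / g) powr u * g = q powr u * g powr (1 - u)"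
    and "(q / g) powr (u - 1) * q = q powr u * g powr (1 - u)"
  using assms by (auto simp: powr_divide powr_diff field_simps)

text \<open>The tangent plane at the combined point \<open>(m, n)\<close> lies above both summands
  and is linear, so its value at \<open>(m, n)\<close> bounds their sum. Homogeneity of degree 1
  allows arbitrary nonnegative \<open>s\<close> and \<open>t\<close>.\<close>

lemma affinity_concave:
  fixes a b p h u s t :: real
  assumes "0 \<le> a" "0 \<le> b" "0 \<le> p" "0 \<le> h" "0 < u" "u < 1" "0 \<le> s" "0 \<le> t"
  shows "s * (a powr u * b powr (1 - u)) + t * (p powr u * h powr (1 - u))
     \<le> (s * a + t * p) powr u * (s * b + t * h) powr (1 - u)"
proof (cases "s * a + t * p = 0 \<or> s * b + t * h = 0")
  case True
  then have "(s * a = 0 \<and> t * p = 0) \<or> (s * b = 0 \<and> t * h = 0)"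
    using assms by (metis add_nonneg_eq_0_iff mult_nonneg_nonneg)
  then have "s * (a powr u * b powr (1 - u)) = 0" "t * (p powr u * h powr (1 - u)) = 0"
    using assms by auto
  then show ?thesis
    by (metis add.right_neutral mult_nonneg_nonneg powr_ge_zero)
next
  case False
  define m n where "m = s * a + t * p" and "n = s * b + t * h"
  have "m \<ge> 0" "n \<ge> 0" unfolding m_def n_def using assms by auto
  with False have mn: "m > 0" "n > 0" by (auto simp: m_def n_def)
  define L where "L = m / n"
  have L: "L > 0" using mn by (simp add: L_def)
  have "s * (a powr u * b powr (1 - u)) + t * (p powr u * h powr (1 - u))
     \<le> s * (u * (L powr (u - 1) * a) + (1 - u) * (L powr u * b))
       + t * (u * (L powr (u - 1) * p) + (1 - u) * (L powr u * h))"
    using assms L by (intro add_mono mult_left_mono affinity_tangent) auto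
  also have "\<dots> = u * (L powr (u - 1) * m) + (1 - u) * (L powr u * n)"
    by (simp add: m_def n_def algebra_simps)
  also have "\<dots> = m powr u * n powr (1 - u)"
    unfolding L_def powr_ratio_mult[OF mn(2,1)] by (simp add: algebra_simps)
  finally show ?thesis by (simp add: m_def n_def)
qed

text \<open>An abbreviation, so that facts about it match the integrand of \<open>KL_div\<close> as
  it stands. At \<open>a = 0\<close> the factor \<open>a\<close> gives the value 0, which is the
  continuous extension.\<close>

abbreviation kl_term :: "real \<Rightarrow> real \<Rightarrow> real" where
  "kl_term a f \<equiv> ln (a / f) * a"

text \<open>Tangent line at \<open>m\<close> of the convex function \<open>a * ln (a / f)\<close> of
  \<open>a\<close>, whose slope there is \<open>ln (m / f) + 1\<close>. It is the inequality
  \<open>ln y \<le> y - 1\<close> at \<open>y = m / a\<close>.\<close>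

lemma kl_tangent:
  fixes a m f :: real
  assumes "0 \<le> a" "0 < m" "0 < f"
  shows "a * ln (m / f) + a - m \<le> kl_term a f"
proof (cases "a = 0")
  case False
  then have a: "a > 0" using assms by simp
  have "ln (m / a) \<le> m / a - 1" using a assms by (intro ln_le_minus_one) auto
  then have "a * ln (m / a) \<le> a * (m / a - 1)" using a by simp
  then show ?thesis using a assms by (simp add: ln_div algebra_simps)
qed (use assms in auto)

lemma kl_tangent_eq:
  fixes a m f :: real
  assumes "0 < a" "0 < m" "0 < f" "a * ln (m / f) + a - m = kl_term a f"
  shows "a = m"
proof -
  have "a * ln (m / a) = a * (m / a - 1)"
    using assms by (simp add: ln_div algebra_simps)
  then have "ln (m / a) = m / a - 1" using assms(1) by (metis mult_left_cancel less_irrefl)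
  then have "m / a = 1" using assms by (intro ln_eq_minus_one) auto
  then show ?thesis using assms by simp
qed

lemma kl_convex:
  fixes a b f s t :: real
  assumes "0 \<le> a" "0 \<le> b" "0 < f" "0 \<le> s" "0 \<le> t" "s + t = 1"
  shows "kl_term (s * a + t * b) f \<le> s * kl_term a f + t * kl_term b f"
proof (cases "s * a + t * b = 0")
  case True
  then have "s * a = 0" "t * b = 0"
    using assms by (metis add_nonneg_eq_0_iff mult_nonneg_nonneg)+
  then show ?thesis using True by (auto simp: algebra_simps)
next
  case False
  define m where "m = s * a + t * b"
  have "0 \<le> m" unfolding m_def using assms by auto
  with False have m: "m > 0" by (simp add: m_def)
  have "s * (a * ln (m / f) + a - m) + t * (b * ln (m / f) + b - m)
      \<le> s * kl_term a f + t * kl_term b f"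
    using assms m by (intro add_mono mult_left_mono kl_tangent) auto
  also have "s * (a * ln (m / f) + a - m) + t * (b * ln (m / f) + b - m)
      = m * ln (m / f) + m - (s + t) * m"
    by (simp add: m_def algebra_simps)
  finally show ?thesis using assms by (simp add: m_def algebra_simps)
qed

lemma kl_ge:
  fixes a f :: real
  assumes "0 \<le> a" "0 < f"
  shows "a - f \<le> kl_term a f"
  using kl_tangent[of a f f] assms by simp

text \<open>The tangent lines at the midpoint \<open>m\<close>, evaluated at \<open>a\<close> and
  \<open>b\<close>, add up to \<open>2 * kl_term m f\<close>. Equality at the midpoint therefore
  makes both tangent inequalities equalities.\<close>

lemma kl_strictly_midconvex:
  fixes a b f :: real
  assumes "0 < a" "0 < b" "0 < f"
    and eq: "kl_term ((a + b) / 2) f = (kl_term a f + kl_term b f) / 2"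
  shows "a = b"
proof -
  define m where "m = (a + b) / 2"
  have m: "m > 0" using assms by (simp add: m_def)
  have "a * ln (m / f) + a - m \<le> kl_term a f" "b * ln (m / f) + b - m \<le> kl_term b f"
    using assms m by (auto intro!: kl_tangent)
  moreover have "(a * ln (m / f) + a - m) + (b * ln (m / f) + b - m) = 2 * kl_term m f"
    by (simp add: m_def algebra_simps add_divide_distrib)
  ultimately have "a * ln (m / f) + a - m = kl_term a f"
    using eq unfolding m_def[symmetric] by argo
  then have "a = m" using assms(1,3) m kl_tangent_eq by blast
  then show ?thesis by (simp add: m_def)
qed

section \<open>Feasible densities\<close>

text \<open>Strict positivity is dropped here, as limits do not preserve it.\<close>

definition closed_feasible :: "'a measure \<Rightarrow> ('a \<Rightarrow> real) \<Rightarrow> real \<Rightarrow> ('a \<Rightarrow> real) set" where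
  "closed_feasible M f eps = {g \<in> borel_measurable M. (AE x in M. 0 \<le> g x) \<and> integrable M g \<and>
     (\<integral>x. g x \<partial>M) = 1 \<and> integrable M (\<lambda>x. kl_term (g x) (f x)) \<and>
     (\<integral>x. kl_term (g x) (f x) \<partial>M) \<le> eps}"

text \<open>Integrability comes from total mass 1: a non-integrable function has Bochner integral
  0.\<close>

lemma pos_densityD:
  assumes "pos_density M f"
  shows "f \<in> borel_measurable M" "AE x in M. 0 < f x" "integrable M f" "(\<integral>x. f x \<partial>M) = 1"
  using assms not_integrable_integral_eq[of M f]
  by (fastforce simp: pos_density_def total_mass_def)+

text \<open>The real bound on \<open>KL_div\<close> selects the branch in which the divergence
  integrand is integrable, since the other branch has value \<infinity>.\<close>

lemma feasible_iff:
  "g \<in> feasible M f eps \<longleftrightarrow> g \<in> closed_feasible M f eps \<and> (AE x in M. 0 < g x)"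
proof
  assume g: "g \<in> feasible M f eps"
  then have "AE x in M. 0 < g x" by (simp add: feasible_def)
  moreover from this have "AE x in M. 0 \<le> g x" by (auto elim: eventually_mono)
  ultimately show "g \<in> closed_feasible M f eps \<and> (AE x in M. 0 < g x)"
    using g not_integrable_integral_eq[of M g]
    by (auto simp: feasible_def closed_feasible_def KL_ball_def KL_div_def total_mass_def
        split: if_splits)
next
  assume "g \<in> closed_feasible M f eps \<and> (AE x in M. 0 < g x)"
  then show "g \<in> feasible M f eps"
    by (auto simp: feasible_def closed_feasible_def KL_ball_def KL_div_def total_mass_def)
qed

lemma closed_feasibleD:
  assumes "g \<in> closed_feasible M f eps"
  shows "g \<in> borel_measurable M" "AE x in M. 0 \<le> g x" "integrable M g" "(\<integral>x. g x \<partial>M) = 1"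
    "integrable M (\<lambda>x. kl_term (g x) (f x))" "(\<integral>x. kl_term (g x) (f x) \<partial>M) \<le> eps"
  using assms by (auto simp: closed_feasible_def)

lemma feasibleD:
  assumes "g \<in> feasible M f eps"
  shows "g \<in> borel_measurable M" "AE x in M. 0 < g x" "AE x in M. 0 \<le> g x" "integrable M g"
    "(\<integral>x. g x \<partial>M) = 1" "integrable M (\<lambda>x. kl_term (g x) (f x))"
    "(\<integral>x. kl_term (g x) (f x) \<partial>M) \<le> eps" "pos_density M g"
  using assms unfolding feasible_iff closed_feasible_def
  by (auto simp: pos_density_def total_mass_def)

lemma feasible_cong_AE:
  assumes g: "g \<in> feasible M f eps" and h: "h \<in> borel_measurable M"
    and eq: "AE x in M. h x = g x" and f: "f \<in> borel_measurable M"
  shows "h \<in> feasible M f eps"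
proof -
  note g' = feasibleD[OF g]
  note [measurable] = g'(1) f h
  have "AE x in M. 0 \<le> h x" "AE x in M. 0 < h x"
    using eq g'(2,3) by (eventually_elim, simp)+
  moreover have "integrable M h" "(\<integral>x. h x \<partial>M) = 1"
    using integrable_cong_AE[of h M g] integral_cong_AE[of h M g] eq g'(4,5) by auto
  moreover have k: "AE x in M. kl_term (h x) (f x) = kl_term (g x) (f x)"
    using eq by eventually_elim simp
  have "integrable M (\<lambda>x. kl_term (h x) (f x))"
    by (subst integrable_cong_AE[OF _ _ k]) (use g' in auto)
  moreover have "(\<integral>x. kl_term (h x) (f x) \<partial>M) \<le> eps"
    by (subst integral_cong_AE[OF _ _ k]) (use g' in auto)
  ultimately show ?thesis
    using h by (simp add: feasible_iff closed_feasible_def)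
qed

section \<open>Affinity and divergence as integrals\<close>

lemma integrable_affinity:
  fixes g0 g1 :: "'a \<Rightarrow> real"
  assumes "integrable M g0" "integrable M g1" "AE x in M. 0 \<le> g0 x" "AE x in M. 0 \<le> g1 x"
    and "0 < u" "u < 1"
  shows "integrable M (\<lambda>x. g1 x powr u * g0 x powr (1 - u))"
proof (rule Bochner_Integration.integrable_bound)
  show "integrable M (\<lambda>x. u * g1 x + (1 - u) * g0 x)" using assms by simp
  have [measurable]: "g0 \<in> borel_measurable M" "g1 \<in> borel_measurable M"
    using assms(1,2) by auto
  show "(\<lambda>x. g1 x powr u * g0 x powr (1 - u)) \<in> borel_measurable M"
    by measurable
  show "AE x in M. norm (g1 x powr u * g0 x powr (1 - u)) \<le> norm (u * g1 x + (1 - u) * g0 x)"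
    using assms(3,4)
  proof eventually_elim
    case (elim x)
    have "g1 x powr u * g0 x powr (1 - u) \<le> u * g1 x + (1 - u) * g0 x"
      using elim assms by (intro young_le) auto
    then show ?case using elim assms by simp
  qed
qed

text \<open>Exchanging the hypotheses replaces \<open>u\<close> by \<open>1 - u\<close>. Through
  this symmetry every statement about one density with the other one fixed is proved once and used
  for both.\<close>

lemma affinity_swap: "affinity M u g0 g1 = affinity M (1 - u) g1 g0"
  by (simp add: affinity_def mult.commute)

lemma affinity_nonneg: "0 \<le> affinity M u g0 g1"
  unfolding affinity_def by (intro integral_nonneg_AE) auto

lemma integral_affinity_concave:
  assumes "integrable M a0" "integrable M a1" "integrable M h0" "integrable M h1"
    and "AE x in M. 0 \<le> a0 x" "AE x in M. 0 \<le> a1 x" "AE x in M. 0 \<le> h0 x" "AE x in M. 0 \<le> h1 x"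
    and u: "0 < u" "u < 1" and st: "0 \<le> s" "0 \<le> t"
  shows "s * affinity M u a0 a1 + t * affinity M u h0 h1
    \<le> affinity M u (\<lambda>x. s * a0 x + t * h0 x) (\<lambda>x. s * a1 x + t * h1 x)"
proof -
  have i: "integrable M (\<lambda>x. a1 x powr u * a0 x powr (1 - u))"
    "integrable M (\<lambda>x. h1 x powr u * h0 x powr (1 - u))"
    using assms by (auto intro!: integrable_affinity)
  have "s * affinity M u a0 a1 + t * affinity M u h0 h1
     = (\<integral>x. s * (a1 x powr u * a0 x powr (1 - u)) + t * (h1 x powr u * h0 x powr (1 - u)) \<partial>M)"
    using i by (simp add: affinity_def)
  also have "\<dots> \<le> affinity M u (\<lambda>x. s * a0 x + t * h0 x) (\<lambda>x. s * a1 x + t * h1 x)"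
    unfolding affinity_def
  proof (rule integral_mono_AE)
    show "integrable M (\<lambda>x. (s * a1 x + t * h1 x) powr u * (s * a0 x + t * h0 x) powr (1 - u))"
    proof (rule integrable_affinity)
      show "AE x in M. 0 \<le> s * a0 x + t * h0 x"
        using assms(5,7) by eventually_elim (use st in simp)
      show "AE x in M. 0 \<le> s * a1 x + t * h1 x"
        using assms(6,8) by eventually_elim (use st in simp)
    qed (use assms in auto)
    show "AE x in M. s * (a1 x powr u * a0 x powr (1 - u)) + t * (h1 x powr u * h0 x powr (1 - u))
        \<le> (s * a1 x + t * h1 x) powr u * (s * a0 x + t * h0 x) powr (1 - u)"
      using assms(5-8) by eventually_elim (use u st in \<open>intro affinity_concave; simp\<close>)
  qed (use i in auto)
  finally show ?thesis .
qed

text \<open>An integrable upper bound \<open>U\<close> is enough for integrability, because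
  \<open>kl_ge\<close> supplies the integrable lower bound \<open>g - f\<close>.\<close>

lemma integrable_kl_term:
  assumes [measurable]: "g \<in> borel_measurable M" "f \<in> borel_measurable M"
    and "integrable M g" "integrable M f" "AE x in M. 0 \<le> g x" "AE x in M. 0 < f x"
    and U: "integrable M U" "AE x in M. kl_term (g x) (f x) \<le> U x"
  shows "integrable M (\<lambda>x. kl_term (g x) (f x))"
    "(\<integral>x. kl_term (g x) (f x) \<partial>M) \<le> (\<integral>x. U x \<partial>M)"
proof -
  show *: "integrable M (\<lambda>x. kl_term (g x) (f x))"
  proof (rule Bochner_Integration.integrable_bound)
    show "integrable M (\<lambda>x. \<bar>g x\<bar> + \<bar>f x\<bar> + \<bar>U x\<bar>)" using assms by auto
    show "AE x in M. norm (kl_term (g x) (f x)) \<le> norm (\<bar>g x\<bar> + \<bar>f x\<bar> + \<bar>U x\<bar>)"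
      using assms(5,6,8)
    proof eventually_elim
      case (elim x)
      then show ?case using kl_ge[of "g x" "f x"] by (simp del: abs_mult)
    qed
  qed measurable
  show "(\<integral>x. kl_term (g x) (f x) \<partial>M) \<le> (\<integral>x. U x \<partial>M)"
    using * U by (intro integral_mono_AE)
qed

lemma integral_kl_convex:
  assumes [measurable]: "g \<in> borel_measurable M" "h \<in> borel_measurable M" "f \<in> borel_measurable M"
    and "integrable M g" "integrable M h" "integrable M f"
    and "AE x in M. 0 \<le> g x" "AE x in M. 0 \<le> h x" "AE x in M. 0 < f x"
    and "integrable M (\<lambda>x. kl_term (g x) (f x))" "integrable M (\<lambda>x. kl_term (h x) (f x))"
    and st: "0 \<le> s" "0 \<le> t" "s + t = 1"
  shows "integrable M (\<lambda>x. kl_term (s * g x + t * h x) (f x))"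
    "(\<integral>x. kl_term (s * g x + t * h x) (f x) \<partial>M)
      \<le> s * (\<integral>x. kl_term (g x) (f x) \<partial>M) + t * (\<integral>x. kl_term (h x) (f x) \<partial>M)"
proof -
  have 1: "AE x in M. 0 \<le> s * g x + t * h x"
    using assms(7,8) by eventually_elim (use st in simp)
  have 2: "AE x in M. kl_term (s * g x + t * h x) (f x)
      \<le> s * kl_term (g x) (f x) + t * kl_term (h x) (f x)"
    using assms(7-9) by eventually_elim (use st in \<open>intro kl_convex; simp\<close>)
  have 3: "integrable M (\<lambda>x. s * kl_term (g x) (f x) + t * kl_term (h x) (f x))"
    using assms by auto
  show "integrable M (\<lambda>x. kl_term (s * g x + t * h x) (f x))"
    by (rule integrable_kl_term[OF _ _ _ _ 1 _ 3 2]) (use assms in auto)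
  have "(\<integral>x. kl_term (s * g x + t * h x) (f x) \<partial>M)
      \<le> (\<integral>x. s * kl_term (g x) (f x) + t * kl_term (h x) (f x) \<partial>M)"
    by (rule integrable_kl_term[OF _ _ _ _ 1 _ 3 2]) (use assms in auto)
  then show "(\<integral>x. kl_term (s * g x + t * h x) (f x) \<partial>M)
      \<le> s * (\<integral>x. kl_term (g x) (f x) \<partial>M) + t * (\<integral>x. kl_term (h x) (f x) \<partial>M)"
    using assms by simp
qed

lemma closed_feasible_convex:
  assumes f: "pos_density M f"
    and g: "g \<in> closed_feasible M f eps" and h: "h \<in> closed_feasible M f eps"
    and st: "0 \<le> s" "0 \<le> t" "s + t = 1"
  shows "(\<lambda>x. s * g x + t * h x) \<in> closed_feasible M f eps"
proof -
  note f' = pos_densityD[OF f] and g' = closed_feasibleD[OF g] and h' = closed_feasibleD[OF h]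
  have "AE x in M. 0 \<le> s * g x + t * h x"
    using g'(2) h'(2) by eventually_elim (use st in simp)
  moreover have "(\<integral>x. s * g x + t * h x \<partial>M) = 1"
    using g' h' st by simp
  moreover note kl = integral_kl_convex[OF g'(1) h'(1) f'(1) g'(3) h'(3) f'(3) g'(2) h'(2) f'(2)
      g'(5) h'(5) st]
  have "s * (\<integral>x. kl_term (g x) (f x) \<partial>M) + t * (\<integral>x. kl_term (h x) (f x) \<partial>M) \<le> s * eps + t * eps"
    using g'(6) h'(6) st by (intro add_mono mult_left_mono)
  then have "(\<integral>x. kl_term (s * g x + t * h x) (f x) \<partial>M) \<le> eps"
    using kl(2) st by (simp flip: distrib_right)
  ultimately show ?thesis
    using kl(1) g' h' by (simp add: closed_feasible_def)
qed

lemma feasible_convex: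
  assumes f: "pos_density M f" and "g \<in> feasible M f eps" "h \<in> feasible M f eps"
    and st: "0 \<le> s" "0 \<le> t" "s + t = 1"
  shows "(\<lambda>x. s * g x + t * h x) \<in> feasible M f eps"
proof -
  have "AE x in M. 0 < g x" "AE x in M. 0 < h x"
    using assms by (auto simp: feasible_iff)
  then have "AE x in M. 0 < s * g x + t * h x"
  proof eventually_elim
    case (elim x)
    then show ?case using st by (cases "s = 0") (auto intro: add_pos_nonneg)
  qed
  then show ?thesis
    using assms closed_feasible_convex[OF f _ _ st] by (simp add: feasible_iff)
qed

lemma nominal_feasible:
  assumes "pos_density M f" "0 < eps"
  shows "f \<in> feasible M f eps"
proof -
  note f = pos_densityD[OF assms(1)]
  have *: "AE x in M. kl_term (f x) (f x) = 0"
    using f(2) by eventually_elim simp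
  have "integrable M (\<lambda>x. kl_term (f x) (f x))"
    by (subst integrable_cong_AE[OF _ _ *]) (use f in auto)
  moreover have "(\<integral>x. kl_term (f x) (f x) \<partial>M) = 0"
    by (subst integral_cong_AE[OF _ _ *]) (use f in auto)
  ultimately show ?thesis
    using f assms(2) by (auto simp: feasible_iff closed_feasible_def elim: eventually_mono)
qed

text \<open>The normalized minimum of \<open>f0\<close> and \<open>f1\<close> satisfies
  \<open>p / f \<le> 1 / Z\<close> for both of them, so that \<open>ln (1 / Z) * p\<close> dominates
  the divergence integrand. Later \<open>p\<close> is the point toward which densities with zeros
  are moved.\<close>

lemma common_density:
  assumes "pos_density M f0" "pos_density M f1"
  obtains p where "pos_density M p" "integrable M (\<lambda>x. kl_term (p x) (f0 x))"
    "integrable M (\<lambda>x. kl_term (p x) (f1 x))"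
proof -
  note f0 = pos_densityD[OF assms(1)] and f1 = pos_densityD[OF assms(2)]
  note [measurable] = f0(1) f1(1)
  define w where "w x = min (f0 x) (f1 x)" for x
  have w[measurable]: "w \<in> borel_measurable M" by (simp add: w_def[abs_def])
  have w_pos: "AE x in M. 0 < w x" using f0(2) f1(2) by eventually_elim (simp add: w_def)
  have int: "integrable M w" using f0 f1 by (simp add: w_def[abs_def])
  define Z where "Z = (\<integral>x. w x \<partial>M)"
  have "Z \<noteq> 0"
  proof
    assume "Z = 0"
    then have "AE x in M. w x = 0"
      by (subst integral_nonneg_eq_0_iff_AE[OF int, symmetric])
        (use w_pos in \<open>auto simp: Z_def elim: eventually_mono\<close>)
    \<comment> \<open>A function that is both zero and positive almost everywhere exists only over a
      null measure, where \<open>f0\<close> could not have mass 1.\<close>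
    with w_pos have "AE x in M. False" by eventually_elim simp
    then have "(\<integral>x. f0 x \<partial>M) = (\<integral>x. 0 \<partial>M)"
      by (intro integral_cong_AE) auto
    then show False using f0 by simp
  qed
  moreover have "Z \<ge> 0" unfolding Z_def
    using w_pos by (intro integral_nonneg_AE) (auto elim: eventually_mono)
  ultimately have Z: "Z > 0" by simp
  define p where "p x = w x / Z" for x
  have p: "p \<in> borel_measurable M" "AE x in M. 0 < p x" "integrable M p" "(\<integral>x. p x \<partial>M) = 1"
    using w w_pos int Z unfolding p_def[abs_def] by (auto simp flip: Z_def elim: eventually_mono)
  have "integrable M (\<lambda>x. kl_term (p x) (f x))"
    if [measurable]: "f \<in> borel_measurable M" and "integrable M f" and "AE x in M. 0 < f x"
      and le: "\<And>x. w x \<le> f x" for f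
  proof (rule integrable_kl_term(1))
    show "integrable M (\<lambda>x. ln (1 / Z) * p x)" using p by simp
    show "AE x in M. kl_term (p x) (f x) \<le> ln (1 / Z) * p x"
      using p(2) that(3)
    proof eventually_elim
      case (elim x)
      have "p x / f x \<le> 1 / Z" using le[of x] elim Z by (simp add: p_def field_simps)
      then have "ln (p x / f x) \<le> ln (1 / Z)" using elim Z by (subst ln_le_cancel_iff) auto
      then show ?case using elim by (intro mult_right_mono) auto
    qed
  qed (use that p in \<open>auto elim: eventually_mono\<close>)
  then show ?thesis
    using that[of p] f0 f1 p by (simp add: pos_density_def total_mass_def w_def)
qed

section \<open>Differentiation under the integral\<close>

text \<open>The perturbation is relative, \<open>1 + t * \<eta>\<close> with bounded
  \<open>\<eta>\<close>, so the linearization error of \<open>F\<close> at 1 is uniform in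
  \<open>x\<close> and integrates against \<open>\<bar>w\<bar>\<close>. Differentiability of
  \<open>F\<close> at the single point 1 suffices, and \<open>w\<close> may change sign.\<close>

lemma has_real_derivative_integral_mult:
  fixes F :: "real \<Rightarrow> real" and w \<eta> :: "'a \<Rightarrow> real"
  assumes F: "(F has_real_derivative c) (at 1)"
    and [measurable]: "F \<in> borel_measurable borel" "\<eta> \<in> borel_measurable M"
    and w: "integrable M w" and K: "AE x in M. \<bar>\<eta> x\<bar> \<le> K"
  shows "\<forall>\<^sub>F t in at 0. integrable M (\<lambda>x. w x * F (1 + t * \<eta> x))"
    and "((\<lambda>t. \<integral>x. w x * F (1 + t * \<eta> x) \<partial>M) has_real_derivative c * (\<integral>x. w x * \<eta> x \<partial>M)) (at 0)"
proof -
  have [measurable]: "w \<in> borel_measurable M" using w by auto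
  define K' where "K' = \<bar>K\<bar> + 1"
  have K': "K' > 0" "AE x in M. \<bar>\<eta> x\<bar> \<le> K'"
    using K by (auto simp: K'_def elim!: eventually_mono)
  have int_w\<eta>: "integrable M (\<lambda>x. w x * \<eta> x)"
  proof (rule Bochner_Integration.integrable_bound)
    show "integrable M (\<lambda>x. K' * w x)" using w by simp
    show "AE x in M. norm (w x * \<eta> x) \<le> norm (K' * w x)"
      using K'(2) by eventually_elim (use K'(1) in \<open>simp add: abs_mult mult.commute mult_right_mono\<close>)
  qed measurable
  have lin: "\<exists>d>0. \<forall>h. \<bar>h\<bar> < d \<longrightarrow> \<bar>F (1 + h) - F 1 - c * h\<bar> \<le> e * \<bar>h\<bar>" if e: "e > 0" for e
  proof -
    from F have "((\<lambda>h. (F (1 + h) - F 1) / h) \<longlongrightarrow> c) (at 0)" by (simp add: DERIV_def)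
    from LIM_D[OF this e] obtain d where d: "d > 0"
      "\<And>h. h \<noteq> 0 \<Longrightarrow> \<bar>h\<bar> < d \<Longrightarrow> \<bar>(F (1 + h) - F 1) / h - c\<bar> < e" by auto
    have "\<bar>F (1 + h) - F 1 - c * h\<bar> \<le> e * \<bar>h\<bar>" if h: "\<bar>h\<bar> < d" for h
    proof (cases "h = 0")
      case False
      have "F (1 + h) - F 1 - c * h = ((F (1 + h) - F 1) / h - c) * h"
        using False by (simp add: field_simps)
      then have "\<bar>F (1 + h) - F 1 - c * h\<bar> = \<bar>(F (1 + h) - F 1) / h - c\<bar> * \<bar>h\<bar>"
        by (simp add: abs_mult)
      then show ?thesis using d(2)[OF False h] by (simp add: mult_right_mono)
    qed simp
    then show ?thesis using d(1) by auto
  qed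
  define R where "R t x = w x * (F (1 + t * \<eta> x) - F 1 - c * (t * \<eta> x))" for t x
  have [measurable]: "R t \<in> borel_measurable M" for t
    unfolding R_def[abs_def] by measurable
  have Rbound: "AE x in M. \<bar>R t x\<bar> \<le> (e * \<bar>t\<bar> * K') * \<bar>w x\<bar>"
    if t: "\<bar>t\<bar> < d / K'" and d: "\<forall>h. \<bar>h\<bar> < d \<longrightarrow> \<bar>F (1 + h) - F 1 - c * h\<bar> \<le> e * \<bar>h\<bar>"
      and e: "e > 0" for t d e
    using K'(2)
  proof eventually_elim
    case (elim x)
    have le: "\<bar>t * \<eta> x\<bar> \<le> \<bar>t\<bar> * K'" using elim by (simp add: abs_mult mult_left_mono)
    also have "\<dots> < d" using t K'(1) by (simp add: field_simps)
    finally have "\<bar>F (1 + t * \<eta> x) - F 1 - c * (t * \<eta> x)\<bar> \<le> e * \<bar>t * \<eta> x\<bar>" using d by blast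
    also have "\<dots> \<le> e * \<bar>t\<bar> * K'" using le e by (simp add: mult.assoc)
    finally show ?case
      by (simp add: R_def abs_mult mult.commute mult_left_mono)
  qed
  have intR: "integrable M (R t)"
    if "\<bar>t\<bar> < d / K'" "\<forall>h. \<bar>h\<bar> < d \<longrightarrow> \<bar>F (1 + h) - F 1 - c * h\<bar> \<le> e * \<bar>h\<bar>" "e > 0" for t d e
  proof (rule Bochner_Integration.integrable_bound)
    show "integrable M (\<lambda>x. (e * \<bar>t\<bar> * K') * \<bar>w x\<bar>)" using w by simp
    show "AE x in M. norm (R t x) \<le> norm ((e * \<bar>t\<bar> * K') * \<bar>w x\<bar>)"
      using Rbound[OF that] by eventually_elim (simp add: order_trans[OF _ abs_ge_self])
  qed measurable
  have split: "w x * F (1 + t * \<eta> x) = R t x + (F 1 * w x + (c * t) * (w x * \<eta> x))" for t x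
    by (simp add: R_def algebra_simps)
  have intF: "integrable M (\<lambda>x. w x * F (1 + t * \<eta> x))" if "integrable M (R t)" for t
    unfolding split using that w int_w\<eta> by auto
  obtain d1 where d1: "d1 > 0" "\<forall>h. \<bar>h\<bar> < d1 \<longrightarrow> \<bar>F (1 + h) - F 1 - c * h\<bar> \<le> 1 * \<bar>h\<bar>"
    using lin[of 1] by auto
  have "\<forall>\<^sub>F t in at 0. \<bar>t\<bar> < d1 / K'"
    using d1(1) K'(1) by (auto simp: eventually_at intro!: exI[of _ "d1 / K'"])
  then show "\<forall>\<^sub>F t in at 0. integrable M (\<lambda>x. w x * F (1 + t * \<eta> x))"
    by eventually_elim (auto intro!: intF intR[OF _ d1(2)])
  define G where "G t = (\<integral>x. w x * F (1 + t * \<eta> x) \<partial>M)" for t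
  define B where "B = (\<integral>x. w x * \<eta> x \<partial>M)"
  define W where "W = (\<integral>x. \<bar>w x\<bar> \<partial>M)"
  have W: "W \<ge> 0" by (simp add: W_def)
  have "((\<lambda>h. (G (0 + h) - G 0) / h) \<longlongrightarrow> c * B) (at 0)"
  proof (rule LIM_I)
    fix r :: real assume r: "r > 0"
    \<comment> \<open>The total error is at most \<open>e * (K' * W)\<close>; the added 1 makes it
      strictly less than \<open>r\<close> and keeps the denominator positive when
      \<open>W = 0\<close>.\<close>
    define e where "e = r / (K' * W + 1)"
    have KW: "0 < K' * W + 1" using K' W by (intro add_nonneg_pos) auto
    have e: "e > 0" using r KW by (simp add: e_def)
    obtain d where d: "d > 0" "\<forall>h. \<bar>h\<bar> < d \<longrightarrow> \<bar>F (1 + h) - F 1 - c * h\<bar> \<le> e * \<bar>h\<bar>"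
      using lin[OF e] by auto
    show "\<exists>s>0. \<forall>t::real. t \<noteq> 0 \<and> norm (t - 0) < s \<longrightarrow> norm ((G (0 + t) - G 0) / t - c * B) < r"
    proof (intro exI[of _ "d / K'"] conjI allI impI)
      show "d / K' > 0" using d K' by simp
      fix t :: real assume t: "t \<noteq> 0 \<and> norm (t - 0) < d / K'"
      then have t': "\<bar>t\<bar> < d / K'" by simp
      note iR = intR[OF t' d(2) e]
      have "G t = (\<integral>x. R t x \<partial>M) + (F 1 * (\<integral>x. w x \<partial>M) + (c * t) * B)"
        unfolding G_def split B_def using iR w int_w\<eta> by simp
      moreover have "G 0 = F 1 * (\<integral>x. w x \<partial>M)" unfolding G_def by simp
      ultimately have *: "(G (0 + t) - G 0) / t - c * B = (\<integral>x. R t x \<partial>M) / t"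
        using t by (simp add: field_simps)
      have "\<bar>\<integral>x. R t x \<partial>M\<bar> \<le> (\<integral>x. \<bar>R t x\<bar> \<partial>M)"
        using iR by simp
      also have "\<dots> \<le> (\<integral>x. (e * \<bar>t\<bar> * K') * \<bar>w x\<bar> \<partial>M)"
        using iR w Rbound[OF t' d(2) e] by (intro integral_mono_AE) auto
      also have "\<dots> = (e * \<bar>t\<bar> * K') * W" unfolding W_def by simp
      finally have "\<bar>\<integral>x. R t x \<partial>M\<bar> / \<bar>t\<bar> \<le> e * (K' * W)"
        using t by (simp add: field_simps)
      also have "\<dots> < e * (K' * W + 1)" using e by simp
      also have "\<dots> = r" using KW by (simp add: e_def)
      finally show "norm ((G (0 + t) - G 0) / t - c * B) < r"
        unfolding * by simp
    qed
  qed
  then show "((\<lambda>t. \<integral>x. w x * F (1 + t * \<eta> x) \<partial>M) has_real_derivative c * (\<integral>x. w x * \<eta> x \<partial>M)) (at 0)"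
    unfolding DERIV_def G_def B_def .
qed

text \<open>Domination of \<open>\<psi>\<close> by a multiple of \<open>g\<close> bounds
  \<open>\<psi> / g\<close>. It thereby keeps \<open>g + t * \<psi>\<close> positive for small
  \<open>t\<close> of either sign, and it provides the bounded factor for differentiation under the
  integral.\<close>

locale direction =
  fixes M :: "'a measure" and g \<psi> :: "'a \<Rightarrow> real" and K :: real
  assumes g: "integrable M g" "AE x in M. 0 < g x"
    and \<psi>_meas: "\<psi> \<in> borel_measurable M"
    and dominated: "AE x in M. \<bar>\<psi> x\<bar> \<le> K * g x"
begin

lemma measurable_g [measurable]: "g \<in> borel_measurable M" "\<psi> \<in> borel_measurable M"
  using g \<psi>_meas by auto

lemma quotient_le: "AE x in M. \<bar>\<psi> x / g x\<bar> \<le> K"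
  using g(2) dominated by eventually_elim (simp add: field_simps)

lemma integrable_\<psi>: "integrable M \<psi>"
proof (rule Bochner_Integration.integrable_bound)
  show "integrable M (\<lambda>x. K * g x)" using g by simp
  show "AE x in M. norm (\<psi> x) \<le> norm (K * g x)"
    using dominated by eventually_elim simp
qed measurable

lemma eventually_pos:
  "\<forall>\<^sub>F t in at 0. AE x in M. 0 < g x + t * \<psi> x"
proof -
  have "\<forall>\<^sub>F t in at (0::real). \<bar>t\<bar> < 1 / (\<bar>K\<bar> + 1)"
    by (auto simp: eventually_at intro!: exI[of _ "1 / (\<bar>K\<bar> + 1)"] add_nonneg_pos)
  then show ?thesis
  proof eventually_elim
    case (elim t)
    show ?case using g(2) dominated
    proof eventually_elim
      case (elim x)
      have "\<bar>t * \<psi> x\<bar> \<le> \<bar>t\<bar> * ((\<bar>K\<bar> + 1) * g x)"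
        unfolding abs_mult
        by (intro mult_left_mono order_trans[OF elim(2)] mult_right_mono) (use elim(1) in auto)
      also have "\<dots> < g x"
        using \<open>\<bar>t\<bar> < 1 / (\<bar>K\<bar> + 1)\<close> elim(1)
        by (simp add: field_simps abs_add_one_gt_zero)
           (smt (verit) mult_less_cancel_left2 distrib_left mult.commute mult.assoc)
      finally show ?case by linarith
    qed
  qed
qed

text \<open>Factoring out \<open>g\<close>, the integrand becomes
  \<open>w * F (1 + t * (\<psi> / g))\<close> with \<open>F s = s powr (1 - u)\<close> and the
  integrable weight \<open>w\<close> that does not depend on \<open>t\<close>.\<close>

lemma affinity_deriv:
  assumes q: "integrable M q" "AE x in M. 0 \<le> q x" and u: "0 < u" "u < 1"
  shows "((\<lambda>t. affinity M u (\<lambda>x. g x + t * \<psi> x) q)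
    has_real_derivative (\<integral>x. (1 - u) * (q x / g x) powr u * \<psi> x \<partial>M)) (at 0)"
proof -
  have [measurable]: "q \<in> borel_measurable M" using q by auto
  define w where "w x = q x powr u * g x powr (1 - u)" for x
  have w: "integrable M w" unfolding w_def
    by (rule integrable_affinity) (use g q u in \<open>auto elim: eventually_mono\<close>)
  have "((\<lambda>s. s powr (1 - u)) has_real_derivative (1 - u)) (at 1)"
    by (auto intro!: derivative_eq_intros)
  note D = has_real_derivative_integral_mult(2)[OF this _ _ w quotient_le]
  have "AE x in M. (1 - u) * (w x * (\<psi> x / g x)) = (1 - u) * (q x / g x) powr u * \<psi> x"
    using g(2) q(2)
  proof eventually_elim
    case (elim x)
    then show ?case
      using powr_ratio_mult(1)[of "g x" "q x" u] by (cases "q x = 0") (auto simp: w_def field_simps)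
  qed
  then have "(\<integral>x. (1 - u) * (w x * (\<psi> x / g x)) \<partial>M) = (\<integral>x. (1 - u) * (q x / g x) powr u * \<psi> x \<partial>M)"
    by (intro integral_cong_AE) (auto simp: w_def[abs_def])
  then have eq: "(1 - u) * (\<integral>x. w x * (\<psi> x / g x) \<partial>M) = (\<integral>x. (1 - u) * (q x / g x) powr u * \<psi> x \<partial>M)"
    by (simp only: integral_mult_right_zero)
  have "\<forall>\<^sub>F t in at 0. (\<integral>x. w x * (1 + t * (\<psi> x / g x)) powr (1 - u) \<partial>M)
      = affinity M u (\<lambda>x. g x + t * \<psi> x) q"
    using eventually_pos
  proof eventually_elim
    case (elim t)
    have "AE x in M. w x * (1 + t * (\<psi> x / g x)) powr (1 - u)
       = q x powr u * (g x + t * \<psi> x) powr (1 - u)"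
      using elim g(2)
    proof eventually_elim
      case (elim x)
      have "g x + t * \<psi> x = g x * (1 + t * (\<psi> x / g x))" using elim by (simp add: field_simps)
      moreover from this have "1 + t * (\<psi> x / g x) > 0"
        using elim by (simp add: zero_less_mult_iff)
      ultimately show ?case using elim by (simp add: w_def powr_mult)
    qed
    then show ?case unfolding affinity_def
      by (intro integral_cong_AE) (auto simp: w_def[abs_def])
  qed
  moreover have "(\<integral>x. w x * (1 + 0 * (\<psi> x / g x)) powr (1 - u) \<partial>M)
      = affinity M u (\<lambda>x. g x + 0 * \<psi> x) q"
    by (simp add: affinity_def w_def)
  ultimately have "\<forall>\<^sub>F t in nhds 0. (\<integral>x. w x * (1 + t * (\<psi> x / g x)) powr (1 - u) \<partial>M)
      = affinity M u (\<lambda>x. g x + t * \<psi> x) q"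
    by (auto simp: eventually_at_filter elim: eventually_mono)
  from DERIV_cong_ev[OF refl this eq] D show ?thesis by simp
qed

text \<open>With \<open>r = 1 + t * (\<psi> / g)\<close> the integrand splits as
  \<open>kl_term (g * r) f = kl_term g f * r + g * (r * ln r)\<close>. These are two products of a
  fixed integrable weight and a function of \<open>r\<close>, the identity and
  \<open>r * ln r\<close>, both with derivative 1 at \<open>r = 1\<close>.\<close>

lemma kl_deriv:
  assumes f: "f \<in> borel_measurable M" "AE x in M. 0 < f x"
    and kl: "integrable M (\<lambda>x. kl_term (g x) (f x))"
  shows "\<forall>\<^sub>F t in at 0. integrable M (\<lambda>x. kl_term (g x + t * \<psi> x) (f x))"
    and "((\<lambda>t. \<integral>x. kl_term (g x + t * \<psi> x) (f x) \<partial>M)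
      has_real_derivative (\<integral>x. (ln (g x / f x) + 1) * \<psi> x \<partial>M)) (at 0)"
    and "integrable M (\<lambda>x. (ln (g x / f x) + 1) * \<psi> x)"
proof -
  note [measurable] = f(1)
  have D1: "((\<lambda>s. s) has_real_derivative 1) (at (1::real))" by simp
  have D2: "((\<lambda>s. s * ln s) has_real_derivative 1) (at (1::real))"
    by (auto intro!: derivative_eq_intros)
  note A = has_real_derivative_integral_mult[OF D1 _ _ kl quotient_le, simplified]
    and B = has_real_derivative_integral_mult[OF D2 _ _ g(1) quotient_le, simplified]
  have split: "AE x in M. kl_term (g x + t * \<psi> x) (f x)
     = kl_term (g x) (f x) * (1 + t * (\<psi> x / g x))
       + g x * ((1 + t * (\<psi> x / g x)) * ln (1 + t * (\<psi> x / g x)))"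
    if "AE x in M. 0 < g x + t * \<psi> x" for t
    using that g(2) f(2)
  proof eventually_elim
    case (elim x)
    define r where "r = 1 + t * (\<psi> x / g x)"
    have eq: "g x + t * \<psi> x = g x * r" using elim by (simp add: r_def field_simps)
    then have r: "r > 0" using elim by (simp add: zero_less_mult_iff)
    show ?case unfolding r_def[symmetric] eq
      using r elim by (simp add: ln_div ln_mult algebra_simps)
  qed
  have iA: "\<forall>\<^sub>F t in at 0. integrable M (\<lambda>x. kl_term (g x) (f x) * (1 + t * (\<psi> x / g x)))"
    using A(1) by simp
  have iB: "\<forall>\<^sub>F t in at 0. integrable M (\<lambda>x. g x * ((1 + t * (\<psi> x / g x)) * ln (1 + t * (\<psi> x / g x))))"
    using B(1) by simp
  have ev: "\<forall>\<^sub>F t in at 0. integrable M (\<lambda>x. kl_term (g x + t * \<psi> x) (f x)) \<and>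
     (\<integral>x. kl_term (g x) (f x) * (1 + t * (\<psi> x / g x)) \<partial>M)
       + (\<integral>x. g x * ((1 + t * (\<psi> x / g x)) * ln (1 + t * (\<psi> x / g x))) \<partial>M)
      = (\<integral>x. kl_term (g x + t * \<psi> x) (f x) \<partial>M)"
    using iA iB eventually_pos
  proof eventually_elim
    case (elim t)
    have "integrable M (\<lambda>x. kl_term (g x + t * \<psi> x) (f x))"
      by (subst integrable_cong_AE[OF _ _ split[OF elim(3)]])
        (use elim in \<open>auto intro!: Bochner_Integration.integrable_add\<close>)
    moreover have "(\<integral>x. kl_term (g x + t * \<psi> x) (f x) \<partial>M)
      = (\<integral>x. kl_term (g x) (f x) * (1 + t * (\<psi> x / g x))
       + g x * ((1 + t * (\<psi> x / g x)) * ln (1 + t * (\<psi> x / g x))) \<partial>M)"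
      by (rule integral_cong_AE[OF _ _ split[OF elim(3)]]) measurable
    ultimately show ?case
      using Bochner_Integration.integral_add[OF elim(1,2)] by simp
  qed
  then show "\<forall>\<^sub>F t in at 0. integrable M (\<lambda>x. kl_term (g x + t * \<psi> x) (f x))"
    by (auto elim: eventually_mono)
  have i1: "integrable M (\<lambda>x. kl_term (g x) (f x) * (\<psi> x / g x))"
  proof (rule Bochner_Integration.integrable_bound)
    show "integrable M (\<lambda>x. K * kl_term (g x) (f x))" using kl by simp
    show "AE x in M. norm (kl_term (g x) (f x) * (\<psi> x / g x)) \<le> norm (K * kl_term (g x) (f x))"
      using quotient_le
    proof eventually_elim
      case (elim x)
      have "\<bar>kl_term (g x) (f x)\<bar> * \<bar>\<psi> x / g x\<bar> \<le> \<bar>kl_term (g x) (f x)\<bar> * \<bar>K\<bar>"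
        using elim by (intro mult_left_mono) auto
      then show ?case
        unfolding real_norm_def abs_mult[of "kl_term (g x) (f x)" "\<psi> x / g x"]
          abs_mult[of K "kl_term (g x) (f x)"]
        by (simp only: mult.commute[of "\<bar>K\<bar>"])
    qed
  qed measurable
  have i2: "AE x in M. kl_term (g x) (f x) * (\<psi> x / g x) + \<psi> x = (ln (g x / f x) + 1) * \<psi> x"
    using g(2) by eventually_elim (simp add: field_simps)
  have "integrable M (\<lambda>x. kl_term (g x) (f x) * (\<psi> x / g x) + \<psi> x)"
    using i1 integrable_\<psi> by auto
  then show "integrable M (\<lambda>x. (ln (g x / f x) + 1) * \<psi> x)"
    by (subst integrable_cong_AE[OF _ _ i2, symmetric]) measurable
  have "AE x in M. g x * (\<psi> x / g x) = \<psi> x" using g(2) by eventually_elim simp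
  then have i3: "(\<integral>x. g x * (\<psi> x / g x) \<partial>M) = (\<integral>x. \<psi> x \<partial>M)"
    by (intro integral_cong_AE) measurable
  have eq: "(\<integral>x. kl_term (g x) (f x) * (\<psi> x / g x) \<partial>M) + (\<integral>x. g x * (\<psi> x / g x) \<partial>M)
      = (\<integral>x. (ln (g x / f x) + 1) * \<psi> x \<partial>M)"
    unfolding i3 Bochner_Integration.integral_add[OF i1 integrable_\<psi>, symmetric]
    by (rule integral_cong_AE[OF _ _ i2]) measurable
  have "\<forall>\<^sub>F t in nhds 0. (\<integral>x. kl_term (g x) (f x) * (1 + t * (\<psi> x / g x)) \<partial>M)
       + (\<integral>x. g x * ((1 + t * (\<psi> x / g x)) * ln (1 + t * (\<psi> x / g x))) \<partial>M)
      = (\<integral>x. kl_term (g x + t * \<psi> x) (f x) \<partial>M)"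
  proof -
    have "\<forall>\<^sub>F t in nhds 0. t \<noteq> 0 \<longrightarrow> (\<integral>x. kl_term (g x) (f x) * (1 + t * (\<psi> x / g x)) \<partial>M)
       + (\<integral>x. g x * ((1 + t * (\<psi> x / g x)) * ln (1 + t * (\<psi> x / g x))) \<partial>M)
      = (\<integral>x. kl_term (g x + t * \<psi> x) (f x) \<partial>M)"
      using ev unfolding eventually_at_filter by (auto elim: eventually_mono)
    then show ?thesis by eventually_elim (case_tac "t = 0"; simp)
  qed
  from DERIV_cong_ev[OF refl this eq] DERIV_add[OF A(2) B(2)]
  show "((\<lambda>t. \<integral>x. kl_term (g x + t * \<psi> x) (f x) \<partial>M)
      has_real_derivative (\<integral>x. (ln (g x / f x) + 1) * \<psi> x \<partial>M)) (at 0)"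
    by simp
qed

end

section \<open>Multipliers with the other density fixed\<close>

text \<open>The test direction is \<open>g\<close> times the centred sign of \<open>c - (\<integral>x. c x * g x \<partial>M)\<close>.\<close>

lemma const_if_nonpos_on_mean_zero:
  fixes g c :: "'a \<Rightarrow> real"
  assumes g: "pos_density M g" and [measurable]: "c \<in> borel_measurable M"
    and cg: "integrable M (\<lambda>x. c x * g x)"
    and nonpos: "\<And>\<psi>. \<psi> \<in> borel_measurable M \<Longrightarrow> AE x in M. \<bar>\<psi> x\<bar> \<le> 2 * g x \<Longrightarrow>
      (\<integral>x. \<psi> x \<partial>M) = 0 \<Longrightarrow> (\<integral>x. c x * \<psi> x \<partial>M) \<le> 0"
  shows "AE x in M. c x = (\<integral>x. c x * g x \<partial>M)"
proof -
  note g' = pos_densityD[OF g]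
  note [measurable] = g'(1)
  define C where "C = (\<integral>x. c x * g x \<partial>M)"
  define s where "s x = sgn (c x - C)" for x
  have [measurable]: "s \<in> borel_measurable M" unfolding s_def[abs_def] by measurable
  have s1: "\<bar>s x\<bar> \<le> 1" for x by (simp add: s_def sgn_real_def)
  have sg: "integrable M (\<lambda>x. s x * g x)"
  proof (rule Bochner_Integration.integrable_bound[OF g'(3)])
    show "AE x in M. norm (s x * g x) \<le> norm (g x)"
      using s1 by (auto simp: abs_mult mult_left_le_one_le)
  qed measurable
  define \<sigma> where "\<sigma> = (\<integral>x. s x * g x \<partial>M)"
  have "\<bar>\<sigma>\<bar> \<le> (\<integral>x. \<bar>s x * g x\<bar> \<partial>M)" using sg by (simp add: \<sigma>_def)
  also have "\<dots> \<le> (\<integral>x. g x \<partial>M)"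
  proof (rule integral_mono_AE)
    show "AE x in M. \<bar>s x * g x\<bar> \<le> g x"
      using g'(2) by eventually_elim (use s1 in \<open>simp add: abs_mult mult_left_le_one_le\<close>)
  qed (use sg g' in auto)
  finally have \<sigma>: "\<bar>\<sigma>\<bar> \<le> 1" using g' by simp
  define \<psi> where "\<psi> x = s x * g x - \<sigma> * g x" for x
  have [measurable]: "\<psi> \<in> borel_measurable M" unfolding \<psi>_def[abs_def] by measurable
  have i\<psi>: "integrable M \<psi>" unfolding \<psi>_def[abs_def] using sg g' by auto
  have \<psi>0: "(\<integral>x. \<psi> x \<partial>M) = 0"
    unfolding \<psi>_def using sg g' by (simp add: \<sigma>_def)
  \<comment> \<open>The bound 2 on test directions originates here: both \<open>s x\<close> and
    \<open>\<sigma>\<close> lie between -1 and 1.\<close>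
  have "AE x in M. \<bar>\<psi> x\<bar> \<le> 2 * g x"
    using g'(2)
  proof eventually_elim
    case (elim x)
    have "\<bar>s x - \<sigma>\<bar> * g x \<le> 2 * g x" using s1[of x] \<sigma> elim by (intro mult_right_mono) auto
    moreover have "\<psi> x = (s x - \<sigma>) * g x" by (simp add: \<psi>_def algebra_simps)
    ultimately show ?case using elim by (simp add: abs_mult)
  qed
  from nonpos[OF _ this \<psi>0] have le: "(\<integral>x. c x * \<psi> x \<partial>M) \<le> 0" by simp
  have iabs: "integrable M (\<lambda>x. \<bar>c x - C\<bar> * g x)"
  proof (rule Bochner_Integration.integrable_bound)
    show "integrable M (\<lambda>x. c x * g x - C * g x)" using cg g' by simp
    show "AE x in M. norm (\<bar>c x - C\<bar> * g x) \<le> norm (c x * g x - C * g x)"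
      by (simp add: abs_mult flip: left_diff_distrib)
  qed measurable
  \<comment> \<open>All terms on the left except the first integrate to
    \<open>- \<sigma> * C + C * \<sigma> + 0 = 0\<close>, which leaves the weighted mean absolute
    deviation of \<open>c\<close>.\<close>
  have "\<bar>c x - C\<bar> * g x - \<sigma> * (c x * g x) + C * (\<sigma> * g x) + C * \<psi> x = c x * \<psi> x" for x
  proof -
    have abs_eq: "\<bar>c x - C\<bar> = (c x - C) * s x" by (simp add: s_def abs_sgn)
    show ?thesis unfolding abs_eq \<psi>_def by (simp add: algebra_simps)
  qed
  then have "(\<integral>x. c x * \<psi> x \<partial>M)
     = (\<integral>x. \<bar>c x - C\<bar> * g x - \<sigma> * (c x * g x) + C * (\<sigma> * g x) + C * \<psi> x \<partial>M)" by simp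
  also have "\<dots> = (\<integral>x. \<bar>c x - C\<bar> * g x \<partial>M)"
    using iabs cg g' i\<psi> \<psi>0 by (simp add: C_def[symmetric])
  finally have "(\<integral>x. \<bar>c x - C\<bar> * g x \<partial>M) \<le> 0" using le by simp
  moreover have nn: "AE x in M. 0 \<le> \<bar>c x - C\<bar> * g x"
    using g'(2) by eventually_elim simp
  ultimately have "AE x in M. \<bar>c x - C\<bar> * g x = 0"
    using integral_nonneg_eq_0_iff_AE[OF iabs nn] integral_nonneg_AE[OF nn] by simp
  then show ?thesis unfolding C_def[symmetric]
    using g'(2) by eventually_elim simp
qed

lemma AE_cong_pos:
  assumes "AE x in M. R x" "\<And>x. R x \<Longrightarrow> P x \<longleftrightarrow> Q x"
  shows "(AE x in M. P x) \<longleftrightarrow> (AE x in M. Q x)"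
  using assms by (auto elim: eventually_elim2)

text \<open>Both coupled maximizations are instances: \<open>g0\<close> against \<open>g1\<close>
  with exponent \<open>u\<close>, and \<open>g1\<close> against \<open>g0\<close> with exponent
  \<open>1 - u\<close>.\<close>

locale one_sided =
  fixes M :: "'a measure" and f :: "'a \<Rightarrow> real" and eps u :: real and g q :: "'a \<Rightarrow> real"
  assumes f: "pos_density M f" and eps: "0 < eps" and u: "0 < u" "u < 1"
    and g_feasible: "g \<in> feasible M f eps"
    and q: "integrable M q" "AE x in M. 0 < q x"
begin

lemmas f' = pos_densityD[OF f]
lemmas g' = feasibleD[OF g_feasible]

lemma measurable_densities [measurable]:
  "f \<in> borel_measurable M" "g \<in> borel_measurable M" "q \<in> borel_measurable M"
  using f' g' q by auto

definition KL :: real where "KL = (\<integral>x. kl_term (g x) (f x) \<partial>M)"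
text \<open>\<open>a\<close> and \<open>b\<close> are the pointwise gradients of the affinity and of
  the divergence in \<open>g\<close>. The gradient of the mass is 1, so stationarity of the
  Lagrangian is \<open>a = lam * b + mu\<close>.\<close>

definition a :: "'a \<Rightarrow> real" where "a x = (1 - u) * (q x / g x) powr u"
definition b :: "'a \<Rightarrow> real" where "b x = ln (g x / f x) + 1"

lemma measurable_ab [measurable]: "a \<in> borel_measurable M" "b \<in> borel_measurable M"
  unfolding a_def[abs_def] b_def[abs_def] by measurable

lemma KL_le: "KL \<le> eps"
  using g'(7) by (simp add: KL_def)

lemma KL_div_eq: "KL_div M g f = ereal KL"
  using g'(6) by (simp add: KL_div_def KL_def)

text \<open>Euler's identity: with \<open>q\<close> fixed the affinity has degree
  \<open>1 - u\<close> in \<open>g\<close>.\<close>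

lemma integrable_ag: "integrable M (\<lambda>x. a x * g x)"
  and integral_ag: "(\<integral>x. a x * g x \<partial>M) = (1 - u) * affinity M u g q"
proof -
  have eq: "AE x in M. a x * g x = (1 - u) * (q x powr u * g x powr (1 - u))"
    using g'(2) q(2) by eventually_elim (simp add: a_def mult.assoc powr_ratio_mult)
  have i: "integrable M (\<lambda>x. (1 - u) * (q x powr u * g x powr (1 - u)))"
    by (rule integrable_mult_right[OF integrable_affinity])
      (use g' q u in \<open>auto elim: eventually_mono\<close>)
  show "integrable M (\<lambda>x. a x * g x)"
    by (subst integrable_cong_AE[OF _ _ eq]) (use i in auto)
  have "(\<integral>x. a x * g x \<partial>M) = (\<integral>x. (1 - u) * (q x powr u * g x powr (1 - u)) \<partial>M)"
    by (rule integral_cong_AE[OF _ _ eq]) auto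
  then show "(\<integral>x. a x * g x \<partial>M) = (1 - u) * affinity M u g q"
    by (simp add: affinity_def)
qed

lemma integrable_bg: "integrable M (\<lambda>x. b x * g x)"
  and integral_bg: "(\<integral>x. b x * g x \<partial>M) = KL + 1"
  using g' by (auto simp: b_def KL_def distrib_right)

lemma directionI:
  assumes "\<psi> \<in> borel_measurable M" "AE x in M. \<bar>\<psi> x\<bar> \<le> K * g x"
  shows "direction M g \<psi> K"
  using assms g' by unfold_locales

lemma integrable_a:
  assumes [measurable]: "\<psi> \<in> borel_measurable M" and K: "AE x in M. \<bar>\<psi> x\<bar> \<le> K * g x"
  shows "integrable M (\<lambda>x. a x * \<psi> x)"
proof (rule Bochner_Integration.integrable_bound)
  show "integrable M (\<lambda>x. K * (a x * g x))" using integrable_ag by simp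
  show "AE x in M. norm (a x * \<psi> x) \<le> norm (K * (a x * g x))"
    using K
  proof eventually_elim
    case (elim x)
    have "\<bar>a x\<bar> * \<bar>\<psi> x\<bar> \<le> \<bar>a x\<bar> * \<bar>K * g x\<bar>" using elim by (intro mult_left_mono) auto
    then show ?case by (simp add: abs_mult mult.left_commute)
  qed
qed measurable

lemma integrable_b:
  assumes "\<psi> \<in> borel_measurable M" "AE x in M. \<bar>\<psi> x\<bar> \<le> K * g x"
  shows "integrable M (\<lambda>x. b x * \<psi> x)"
  using direction.kl_deriv(3)[OF directionI[OF assms] f'(1,2) g'(6)] by (simp add: b_def)

lemma affinity_derivative_along:
  assumes "\<psi> \<in> borel_measurable M" "AE x in M. \<bar>\<psi> x\<bar> \<le> K * g x"
  shows "((\<lambda>t. affinity M u (\<lambda>x. g x + t * \<psi> x) q) has_real_derivative (\<integral>x. a x * \<psi> x \<partial>M)) (at 0)"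
proof -
  have "AE x in M. 0 \<le> q x" using q(2) by eventually_elim simp
  from direction.affinity_deriv[OF directionI[OF assms] q(1) this u] show ?thesis
    by (simp add: a_def)
qed

lemma kl_derivative_along:
  assumes "\<psi> \<in> borel_measurable M" "AE x in M. \<bar>\<psi> x\<bar> \<le> K * g x"
  shows "\<forall>\<^sub>F t in at 0. integrable M (\<lambda>x. kl_term (g x + t * \<psi> x) (f x))"
    and "((\<lambda>t. \<integral>x. kl_term (g x + t * \<psi> x) (f x) \<partial>M) has_real_derivative
      (\<integral>x. b x * \<psi> x \<partial>M)) (at 0)"
  using direction.kl_deriv(1,2)[OF directionI[OF assms] f'(1,2) g'(6)] by (auto simp: b_def)

lemma lagrangian_deriv:
  assumes \<psi>: "\<psi> \<in> borel_measurable M" "AE x in M. \<bar>\<psi> x\<bar> \<le> K * g x"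
  shows "((\<lambda>t. lagrangian M (\<lambda>h. affinity M u h q) f eps lam mu (\<lambda>x. g x + t * \<psi> x))
    has_real_derivative (\<integral>x. (a x - lam * b x - mu) * \<psi> x \<partial>M)) (at 0)"
proof -
  interpret direction M g \<psi> K by (rule directionI[OF \<psi>])
  let ?A = "\<lambda>t. affinity M u (\<lambda>x. g x + t * \<psi> x) q"
  let ?B = "\<lambda>t. \<integral>x. kl_term (g x + t * \<psi> x) (f x) \<partial>M"
  have mass: "total_mass M (\<lambda>x. g x + t * \<psi> x) = 1 + t * (\<integral>x. \<psi> x \<partial>M)" for t
    using g' integrable_\<psi> by (simp add: total_mass_def)
  have D: "((\<lambda>t. ?A t + lam * (eps - ?B t) + mu * (1 - (1 + t * (\<integral>x. \<psi> x \<partial>M))))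
      has_real_derivative (\<integral>x. a x * \<psi> x \<partial>M) - lam * (\<integral>x. b x * \<psi> x \<partial>M) - mu * (\<integral>x. \<psi> x \<partial>M)) (at 0)"
    by (auto intro!: derivative_eq_intros affinity_derivative_along[OF \<psi>] kl_derivative_along(2)[OF \<psi>])
  have eq: "(\<integral>x. a x * \<psi> x \<partial>M) - lam * (\<integral>x. b x * \<psi> x \<partial>M) - mu * (\<integral>x. \<psi> x \<partial>M)
      = (\<integral>x. (a x - lam * b x - mu) * \<psi> x \<partial>M)"
    using integrable_a[OF \<psi>] integrable_b[OF \<psi>] integrable_\<psi>
    by (simp add: left_diff_distrib mult.assoc)
  have "\<forall>\<^sub>F t in nhds 0. t \<noteq> 0 \<longrightarrow> integrable M (\<lambda>x. kl_term (g x + t * \<psi> x) (f x))"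
    using kl_derivative_along(1)[OF \<psi>] by (simp add: eventually_at_filter)
  then have "\<forall>\<^sub>F t in nhds 0. ?A t + lam * (eps - ?B t) + mu * (1 - (1 + t * (\<integral>x. \<psi> x \<partial>M)))
     = lagrangian M (\<lambda>h. affinity M u h q) f eps lam mu (\<lambda>x. g x + t * \<psi> x)"
  proof eventually_elim
    case (elim t)
    then have "integrable M (\<lambda>x. kl_term (g x + t * \<psi> x) (f x))"
      using g'(6) by (cases "t = 0") auto
    then show ?case by (simp add: lagrangian_def mass KL_div_def)
  qed
  from DERIV_cong_ev[OF refl this eq] D show ?thesis by simp
qed

text \<open>Directions of mean zero show that the residual \<open>a - lam * b - mu\<close> is
  constant almost everywhere. The direction \<open>g\<close> itself, which changes the mass, then
  forces the constant to be 0.\<close>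

lemma KKT_iff:
  "KKT_multipliers M (\<lambda>h. affinity M u h q) f eps g lam mu \<longleftrightarrow>
    0 \<le> lam \<and> lam * (eps - KL) = 0 \<and> (AE x in M. a x = lam * b x + mu)"
proof
  assume kkt: "KKT_multipliers M (\<lambda>h. affinity M u h q) f eps g lam mu"
  let ?c = "\<lambda>x. a x - lam * b x - mu"
  have int0: "(\<integral>x. ?c x * \<psi> x \<partial>M) = 0"
    if \<psi>: "\<psi> \<in> borel_measurable M" "AE x in M. \<bar>\<psi> x\<bar> \<le> 2 * g x" for \<psi>
  proof -
    have "AE x in M. 1 / 2 * \<bar>\<psi> x\<bar> \<le> g x" using \<psi>(2) by eventually_elim simp
    then have "\<exists>\<delta>>0. AE x in M. \<delta> * \<bar>\<psi> x\<bar> \<le> g x" by (intro exI[of _ "1 / 2"]) auto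
    with kkt \<psi>(1) have
      "((\<lambda>t. lagrangian M (\<lambda>h. affinity M u h q) f eps lam mu (\<lambda>x. g x + t * \<psi> x))
        has_real_derivative 0) (at 0)"
      unfolding KKT_multipliers_def by blast
    from DERIV_unique[OF this lagrangian_deriv[OF \<psi>]] show ?thesis by simp
  qed
  have cg: "integrable M (\<lambda>x. ?c x * g x)"
    using integrable_ag integrable_bg g' by (simp add: left_diff_distrib mult.assoc)
  have "AE x in M. ?c x = (\<integral>x. ?c x * g x \<partial>M)"
    by (rule const_if_nonpos_on_mean_zero[OF g'(8) _ cg]) (use int0 in auto)
  moreover have "(\<integral>x. ?c x * g x \<partial>M) = 0"
  proof (rule int0)
    show "AE x in M. \<bar>g x\<bar> \<le> 2 * g x" using g'(2) by eventually_elim simp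
  qed measurable
  ultimately have "AE x in M. a x = lam * b x + mu" by (auto elim!: eventually_mono)
  then show "0 \<le> lam \<and> lam * (eps - KL) = 0 \<and> (AE x in M. a x = lam * b x + mu)"
    using kkt by (simp add: KKT_multipliers_def KL_div_eq)
next
  assume R: "0 \<le> lam \<and> lam * (eps - KL) = 0 \<and> (AE x in M. a x = lam * b x + mu)"
  have "((\<lambda>t. lagrangian M (\<lambda>h. affinity M u h q) f eps lam mu (\<lambda>x. g x + t * \<psi> x))
        has_real_derivative 0) (at 0)"
    if [measurable]: "\<psi> \<in> borel_measurable M" and "\<delta> > 0" "AE x in M. \<delta> * \<bar>\<psi> x\<bar> \<le> g x" for \<psi> \<delta>
  proof -
    have "AE x in M. \<bar>\<psi> x\<bar> \<le> 1 / \<delta> * g x"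
      using that(3) by eventually_elim (use that(2) in \<open>simp add: field_simps\<close>)
    note D = lagrangian_deriv[OF that(1) this, of lam mu]
    have "AE x in M. (a x - lam * b x - mu) * \<psi> x = 0"
      using R by (auto elim!: eventually_mono)
    then have "(\<integral>x. (a x - lam * b x - mu) * \<psi> x \<partial>M) = (\<integral>x. 0 \<partial>M)"
      by (intro integral_cong_AE) auto
    with D show ?thesis by simp
  qed
  with R show "KKT_multipliers M (\<lambda>h. affinity M u h q) f eps g lam mu"
    using g_feasible by (auto simp: KKT_multipliers_def KL_div_eq)
qed

text \<open>Strictness absorbs the first-order error: either the constraint is slack and continuity
  of the divergence suffices, or the divergence decreases to first order.\<close>

lemma feasible_direction:
  assumes \<psi>: "\<psi> \<in> borel_measurable M" "AE x in M. \<bar>\<psi> x\<bar> \<le> K * g x" "(\<integral>x. \<psi> x \<partial>M) = 0"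
    and less: "KL < eps \<or> (\<integral>x. b x * \<psi> x \<partial>M) < 0"
  shows "\<forall>\<^sub>F t in at_right 0. (\<lambda>x. g x + t * \<psi> x) \<in> feasible M f eps"
proof -
  interpret direction M g \<psi> K by (rule directionI[OF \<psi>(1,2)])
  let ?B = "\<lambda>t. \<integral>x. kl_term (g x + t * \<psi> x) (f x) \<partial>M"
  have B0: "?B 0 = KL" by (simp add: KL_def)
  note D = kl_derivative_along(2)[OF \<psi>(1,2)]
  have "\<forall>\<^sub>F t in at_right 0. ?B t \<le> eps"
    using less
  proof
    assume "KL < eps"
    from D have "isCont ?B 0" by (rule DERIV_isCont)
    then have "(?B \<longlongrightarrow> KL) (at_right 0)"
      unfolding isCont_def B0 by (rule tendsto_within_subset) simp
    from order_tendstoD(2)[OF this \<open>KL < eps\<close>] show ?thesis by (auto elim: eventually_mono)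
  next
    assume "(\<integral>x. b x * \<psi> x \<partial>M) < 0"
    from DERIV_neg_dec_right[OF D this] obtain d where "d > 0"
      and d: "\<And>h. 0 < h \<Longrightarrow> h < d \<Longrightarrow> ?B h < KL" unfolding B0 by auto
    have "?B h \<le> eps" if "0 < h" "h < d" for h
      using d[OF that] KL_le by simp
    then show ?thesis
      using \<open>d > 0\<close> by (auto simp: eventually_at_right_field intro!: exI[of _ d])
  qed
  moreover have "\<forall>\<^sub>F t in at_right 0. AE x in M. 0 < g x + t * \<psi> x"
    using eventually_pos by (rule filter_leD[OF at_within_le_at])
  moreover have "\<forall>\<^sub>F t in at_right 0. integrable M (\<lambda>x. kl_term (g x + t * \<psi> x) (f x))"
    using kl_derivative_along(1)[OF \<psi>(1,2)] by (rule filter_leD[OF at_within_le_at])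
  ultimately show ?thesis
  proof eventually_elim
    case (elim t)
    then show ?case
      using g' integrable_\<psi> \<psi> by (auto simp: feasible_iff closed_feasible_def elim: eventually_mono)
  qed
qed

lemma first_order_condition:
  assumes max: "is_arg_max (\<lambda>h. affinity M u h q) (\<lambda>h. h \<in> feasible M f eps) g"
    and \<psi>: "\<psi> \<in> borel_measurable M" "AE x in M. \<bar>\<psi> x\<bar> \<le> K * g x" "(\<integral>x. \<psi> x \<partial>M) = 0"
    and less: "KL < eps \<or> (\<integral>x. b x * \<psi> x \<partial>M) < 0"
  shows "(\<integral>x. a x * \<psi> x \<partial>M) \<le> 0"
proof (rule ccontr)
  assume "\<not> (\<integral>x. a x * \<psi> x \<partial>M) \<le> 0"
  then have "0 < (\<integral>x. a x * \<psi> x \<partial>M)" by simp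
  from DERIV_pos_inc_right[OF affinity_derivative_along[OF \<psi>(1,2)] this] obtain d where d: "d > 0"
    "\<And>h. 0 < h \<Longrightarrow> h < d \<Longrightarrow> affinity M u g q < affinity M u (\<lambda>x. g x + h * \<psi> x) q" by auto
  then have "\<forall>\<^sub>F t in at_right 0. affinity M u g q < affinity M u (\<lambda>x. g x + t * \<psi> x) q"
    by (auto simp: eventually_at_right_field intro!: exI[of _ d])
  with feasible_direction[OF \<psi> less] have "\<forall>\<^sub>F t in at_right (0::real). False"
  proof eventually_elim
    case (elim t)
    then show ?case using max by (auto simp: is_arg_max_def)
  qed
  then show False by simp
qed

text \<open>The gradient \<open>a\<close> is a strictly increasing function of \<open>q / g\<close>.
  A constant gradient is the degenerate case that disjointness of the two balls will
  exclude.\<close>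

lemma ratio_const:
  assumes "AE x in M. a x = c"
  shows "\<exists>r. AE x in M. q x / g x = r"
proof
  show "AE x in M. q x / g x = (c / (1 - u)) powr (1 / u)"
    using assms g'(2) q(2)
  proof eventually_elim
    case (elim x)
    then have "(q x / g x) powr u = c / (1 - u)" using u by (simp add: a_def field_simps)
    then have "((q x / g x) powr u) powr (1 / u) = (c / (1 - u)) powr (1 / u)" by simp
    then show ?case using elim u by (simp add: powr_powr)
  qed
qed

text \<open>A constant \<open>b\<close> makes \<open>g\<close> proportional to \<open>f\<close>,
  hence equal to \<open>f\<close> by mass 1, with divergence 0 instead of \<open>eps\<close>. This
  is the constraint qualification: the gradients of divergence and mass are linearly
  independent.\<close>

lemma b_not_const:
  assumes "KL = eps"
  shows "\<not> (AE x in M. b x = c)"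
proof
  assume c: "AE x in M. b x = c"
  have "AE x in M. g x = exp (c - 1) * f x"
    using c g'(2) f'(2)
  proof eventually_elim
    case (elim x)
    then have "ln (g x / f x) = c - 1" by (simp add: b_def)
    then have "g x / f x = exp (c - 1)" using elim by (metis divide_pos_pos exp_ln)
    then show ?case using elim by (simp add: field_simps)
  qed
  then have "(\<integral>x. g x \<partial>M) = (\<integral>x. exp (c - 1) * f x \<partial>M)"
    by (intro integral_cong_AE) auto
  then have c1: "c = 1" using g' f' by simp
  have "AE x in M. kl_term (g x) (f x) = 0"
    using c by eventually_elim (simp add: b_def c1)
  then have "KL = (\<integral>x. 0 \<partial>M)" unfolding KL_def by (intro integral_cong_AE) auto
  then show False using assms eps by simp
qed

lemma KKT_active:
  assumes "0 \<le> lam" "lam * (eps - KL) = 0" "AE x in M. a x = lam * b x + mu"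
    and nonconst: "\<nexists>r. AE x in M. q x / g x = r"
  shows "0 < lam" "KL = eps"
proof -
  have "lam \<noteq> 0" using assms ratio_const[of mu] by auto
  then show "0 < lam" "KL = eps" using assms by auto
qed

lemma KKT_unique:
  assumes "KL = eps" "AE x in M. a x = lam * b x + mu" "AE x in M. a x = lam' * b x + mu'"
  shows "lam = lam' \<and> mu = mu'"
proof -
  have *: "AE x in M. (lam - lam') * b x = mu' - mu"
    using assms(2,3) by eventually_elim (simp add: algebra_simps)
  have "lam = lam'"
  proof (rule ccontr)
    assume "lam \<noteq> lam'"
    then have "AE x in M. b x = (mu' - mu) / (lam - lam')"
      using * by (auto simp: field_simps elim!: eventually_mono)
    then show False using b_not_const[OF assms(1)] by blast
  qed
  moreover have "mu' = mu"
  proof (rule ccontr)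
    assume "mu' \<noteq> mu"
    \<comment> \<open>With \<open>lam = lam'\<close> and \<open>mu' \<noteq> mu\<close> the relation
      \<open>*\<close> is false at every point, so any property holds almost everywhere.\<close>
    have "AE x in M. b x = 0"
      using * by eventually_elim (use \<open>lam = lam'\<close> \<open>mu' \<noteq> mu\<close> in simp)
    then show False using b_not_const[OF assms(1)] by blast
  qed
  ultimately show ?thesis by simp
qed

text \<open>Farkas' lemma by hand: \<open>\<psi>0\<close> is a direction along which the divergence increases, and
  subtracting multiples of it moves any other mean-zero direction into the feasible cone.\<close>

lemma multipliers_exist:
  assumes max: "is_arg_max (\<lambda>h. affinity M u h q) (\<lambda>h. h \<in> feasible M f eps) g"
    and nonconst: "\<nexists>r. AE x in M. q x / g x = r"
  shows "KL = eps" "\<exists>lam>0. \<exists>mu. AE x in M. a x = lam * b x + mu"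
proof -
  note foc = first_order_condition[OF max]
  show KL: "KL = eps"
  proof (rule ccontr)
    assume "KL \<noteq> eps"
    then have "KL < eps" using KL_le by simp
    then have "AE x in M. a x = (\<integral>x. a x * g x \<partial>M)"
      by (intro const_if_nonpos_on_mean_zero[OF g'(8) _ integrable_ag]) (auto intro: foc)
    then show False using ratio_const nonconst by blast
  qed
  \<comment> \<open>If no mean-zero direction increased the divergence, \<open>b\<close> would be
    constant, which is impossible while the constraint is active.\<close>
  obtain \<psi>0 where \<psi>0: "\<psi>0 \<in> borel_measurable M" "AE x in M. \<bar>\<psi>0 x\<bar> \<le> 2 * g x"
    "(\<integral>x. \<psi>0 x \<partial>M) = 0" "0 < (\<integral>x. b x * \<psi>0 x \<partial>M)"
    using const_if_nonpos_on_mean_zero[OF g'(8) _ integrable_bg] b_not_const[OF KL]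
    by (meson measurable_ab(2) not_le)
  note [measurable] = \<psi>0(1)
  define \<alpha> \<beta> where "\<alpha> = (\<integral>x. a x * \<psi>0 x \<partial>M)" and "\<beta> = (\<integral>x. b x * \<psi>0 x \<partial>M)"
  have \<beta>: "\<beta> > 0" using \<psi>0 by (simp add: \<beta>_def)
  have int\<psi>: "integrable M \<psi>" "integrable M (\<lambda>x. a x * \<psi> x)" "integrable M (\<lambda>x. b x * \<psi> x)"
    if "\<psi> \<in> borel_measurable M" "AE x in M. \<bar>\<psi> x\<bar> \<le> K * g x" for \<psi> K
    using that direction.integrable_\<psi>[OF directionI[OF that]] integrable_a integrable_b by auto
  note i0 = int\<psi>[OF \<psi>0(1,2)]
  have comb: "(\<lambda>x. \<psi> x - s * \<psi>0 x) \<in> borel_measurable M"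
    "AE x in M. \<bar>\<psi> x - s * \<psi>0 x\<bar> \<le> (2 + 2 * \<bar>s\<bar>) * g x"
    "(\<integral>x. \<psi> x - s * \<psi>0 x \<partial>M) = 0"
    "(\<integral>x. a x * (\<psi> x - s * \<psi>0 x) \<partial>M) = (\<integral>x. a x * \<psi> x \<partial>M) - s * \<alpha>"
    "(\<integral>x. b x * (\<psi> x - s * \<psi>0 x) \<partial>M) = (\<integral>x. b x * \<psi> x \<partial>M) - s * \<beta>"
    if \<psi>: "\<psi> \<in> borel_measurable M" "AE x in M. \<bar>\<psi> x\<bar> \<le> 2 * g x" "(\<integral>x. \<psi> x \<partial>M) = 0" for \<psi> s
  proof -
    note i = int\<psi>[OF \<psi>(1,2)]
    show "(\<lambda>x. \<psi> x - s * \<psi>0 x) \<in> borel_measurable M" using \<psi>(1) by measurable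
    show "AE x in M. \<bar>\<psi> x - s * \<psi>0 x\<bar> \<le> (2 + 2 * \<bar>s\<bar>) * g x"
      using \<psi>(2) \<psi>0(2)
    proof eventually_elim
      case (elim x)
      have "\<bar>\<psi> x - s * \<psi>0 x\<bar> \<le> \<bar>\<psi> x\<bar> + \<bar>s\<bar> * \<bar>\<psi>0 x\<bar>"
        using abs_triangle_ineq4[of "\<psi> x" "s * \<psi>0 x"] by (simp add: abs_mult)
      also have "\<dots> \<le> 2 * g x + \<bar>s\<bar> * (2 * g x)"
        using elim by (intro add_mono mult_left_mono) auto
      finally show ?case by (simp add: algebra_simps)
    qed
    show "(\<integral>x. \<psi> x - s * \<psi>0 x \<partial>M) = 0" using i i0 \<psi> \<psi>0 by simp
    show "(\<integral>x. a x * (\<psi> x - s * \<psi>0 x) \<partial>M) = (\<integral>x. a x * \<psi> x \<partial>M) - s * \<alpha>"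
      "(\<integral>x. b x * (\<psi> x - s * \<psi>0 x) \<partial>M) = (\<integral>x. b x * \<psi> x \<partial>M) - s * \<beta>"
      using i i0 by (simp_all add: \<alpha>_def \<beta>_def right_diff_distrib mult.left_commute)
  qed
  have "\<alpha> \<ge> 0"
  proof -
    have "(\<integral>x. a x * (0 - 1 * \<psi>0 x) \<partial>M) \<le> 0"
    proof (rule foc)
      show "AE x in M. \<bar>0 - 1 * \<psi>0 x\<bar> \<le> 2 * g x" using \<psi>0(2) by simp
      show "(\<integral>x. 0 - 1 * \<psi>0 x \<partial>M) = 0" using \<psi>0(3) by simp
      show "KL < eps \<or> (\<integral>x. b x * (0 - 1 * \<psi>0 x) \<partial>M) < 0" using \<psi>0(4) by simp
    qed measurable
    then show ?thesis by (simp add: \<alpha>_def)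
  qed
  have key: "(\<integral>x. a x * \<psi> x \<partial>M) \<le> \<alpha> / \<beta> * (\<integral>x. b x * \<psi> x \<partial>M)"
    if \<psi>: "\<psi> \<in> borel_measurable M" "AE x in M. \<bar>\<psi> x\<bar> \<le> 2 * g x" "(\<integral>x. \<psi> x \<partial>M) = 0" for \<psi>
  proof (rule field_le_epsilon)
    fix e :: real assume e: "e > 0"
    define B where "B = (\<integral>x. b x * \<psi> x \<partial>M)"
    \<comment> \<open>The first term cancels the divergence slope of \<open>\<psi>\<close> and the
      second makes it strictly negative. The latter costs
      \<open>e * \<alpha> / (\<alpha> + 1) \<le> e\<close>, where the 1 covers the case
      \<open>\<alpha> = 0\<close>.\<close>
    define s where "s = B / \<beta> + e / (\<alpha> + 1)"
    have "s * \<beta> = B + e / (\<alpha> + 1) * \<beta>" using \<beta> by (simp add: s_def distrib_right)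
    moreover have "0 < e / (\<alpha> + 1) * \<beta>" using e \<beta> \<open>\<alpha> \<ge> 0\<close> by simp
    ultimately have "B - s * \<beta> < 0" by simp
    with foc[OF comb(1-3)[OF \<psi>]] have "(\<integral>x. a x * \<psi> x \<partial>M) \<le> s * \<alpha>"
      unfolding comb(4,5)[OF \<psi>] B_def by force
    also have "s * \<alpha> = \<alpha> / \<beta> * B + e * (\<alpha> / (\<alpha> + 1))" by (simp add: s_def algebra_simps)
    also have "\<dots> \<le> \<alpha> / \<beta> * B + e * 1"
      using e \<open>\<alpha> \<ge> 0\<close> by (intro add_left_mono mult_left_mono) auto
    finally show "(\<integral>x. a x * \<psi> x \<partial>M) \<le> \<alpha> / \<beta> * (\<integral>x. b x * \<psi> x \<partial>M) + e" by (simp add: B_def)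
  qed
  define lam where "lam = \<alpha> / \<beta>"
  let ?c = "\<lambda>x. a x - lam * b x"
  have "AE x in M. ?c x = (\<integral>x. ?c x * g x \<partial>M)"
  proof (rule const_if_nonpos_on_mean_zero[OF g'(8)])
    show "integrable M (\<lambda>x. ?c x * g x)"
      using integrable_ag integrable_bg by (simp add: left_diff_distrib mult.assoc)
    fix \<psi> assume \<psi>: "\<psi> \<in> borel_measurable M" "AE x in M. \<bar>\<psi> x\<bar> \<le> 2 * g x" "(\<integral>x. \<psi> x \<partial>M) = 0"
    show "(\<integral>x. ?c x * \<psi> x \<partial>M) \<le> 0"
      using key[OF \<psi>] int\<psi>[OF \<psi>(1,2)] by (simp add: left_diff_distrib mult.assoc lam_def)
  qed measurable
  then have eq: "AE x in M. a x = lam * b x + (\<integral>x. ?c x * g x \<partial>M)"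
    by (auto elim!: eventually_mono)
  have "lam \<ge> 0" using \<beta> \<open>\<alpha> \<ge> 0\<close> by (simp add: lam_def)
  with KKT_active(1)[OF this _ eq nonconst] eq show "\<exists>lam>0. \<exists>mu. AE x in M. a x = lam * b x + mu"
    using KL by auto
qed

text \<open>Substituting stationarity into \<open>a * h\<close> and applying the tangent line of the
  divergence at \<open>g\<close> bounds \<open>a * h\<close> by \<open>U\<close>. After integration
  the comparison reduces to the divergence of \<open>h\<close> being at most \<open>eps\<close>, the
  divergence of \<open>g\<close>. Since \<open>a * h\<close> is nonnegative, the same bound yields
  its integrability, although \<open>h\<close> need not be dominated by a multiple of
  \<open>g\<close>.\<close>

lemma linearization_bound:
  assumes KL: "KL = eps" and lam: "0 < lam" and eq: "AE x in M. a x = lam * b x + mu"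
    and h: "h \<in> closed_feasible M f eps"
  shows "integrable M (\<lambda>x. a x * h x)" "(\<integral>x. a x * h x \<partial>M) \<le> (\<integral>x. a x * g x \<partial>M)"
proof -
  note h' = closed_feasibleD[OF h]
  note [measurable] = h'(1)
  define U where "U x = lam * (kl_term (h x) (f x) + g x) + mu * h x" for x
  have iU: "integrable M U" unfolding U_def[abs_def] using h' g' by auto
  have le: "AE x in M. a x * h x \<le> U x"
    using h'(2) g'(2) f'(2) eq
  proof eventually_elim
    case (elim x)
    have "h x * ln (g x / f x) + h x - g x \<le> kl_term (h x) (f x)"
      using elim by (intro kl_tangent) auto
    then have "lam * (h x * ln (g x / f x) + h x) \<le> lam * (kl_term (h x) (f x) + g x)"
      using lam by (intro mult_left_mono) auto
    then show ?case using elim by (simp add: U_def b_def algebra_simps)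
  qed
  have nn: "AE x in M. 0 \<le> a x * h x" using h'(2) by eventually_elim (use u in \<open>simp add: a_def\<close>)
  show i: "integrable M (\<lambda>x. a x * h x)"
  proof (rule Bochner_Integration.integrable_bound[OF iU])
    show "AE x in M. norm (a x * h x) \<le> norm (U x)" using le nn by eventually_elim simp
  qed measurable
  have "(\<integral>x. a x * h x \<partial>M) \<le> (\<integral>x. U x \<partial>M)" using i iU le by (rule integral_mono_AE)
  also have "(\<integral>x. U x \<partial>M) = lam * ((\<integral>x. kl_term (h x) (f x) \<partial>M) + 1) + mu"
    unfolding U_def using h' g' by simp
  also have "\<dots> \<le> lam * (KL + 1) + mu" using h'(6) lam KL by simp
  also have "\<dots> = (\<integral>x. lam * (b x * g x) + mu * g x \<partial>M)"
    using integral_bg integrable_bg g' by simp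
  also have "\<dots> = (\<integral>x. a x * g x \<partial>M)"
    by (intro integral_cong_AE) (use eq in \<open>auto simp: algebra_simps elim!: eventually_mono\<close>)
  finally show "(\<integral>x. a x * h x \<partial>M) \<le> (\<integral>x. a x * g x \<partial>M)" .
qed

lemma exponential_form:
  assumes lam: "0 < lam"
  shows "(AE x in M. a x = lam * b x + mu) \<longleftrightarrow>
    (AE x in M. g x = exp ((- lam - mu) / lam) * exp ((1 - u) * (q x / g x) powr u / lam) * f x)"
proof (rule AE_cong_pos)
  show "AE x in M. 0 < g x \<and> 0 < f x" using g'(2) f'(2) by eventually_elim simp
  fix x assume "0 < g x \<and> 0 < f x"
  then have x: "0 < g x" "0 < f x" by auto
  have "g x = exp ((- lam - mu) / lam) * exp (a x / lam) * f x
    \<longleftrightarrow> g x / f x = exp ((- lam - mu) / lam + a x / lam)"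
    using x by (simp add: exp_add field_simps)
  also have "\<dots> \<longleftrightarrow> ln (g x / f x) = (- lam - mu) / lam + a x / lam"
    using x by (metis divide_pos_pos exp_ln ln_exp)
  also have "\<dots> \<longleftrightarrow> a x = lam * b x + mu"
    using lam unfolding add_divide_distrib[symmetric] by (auto simp: b_def eq_divide_eq algebra_simps)
  finally show "(a x = lam * b x + mu) \<longleftrightarrow>
    (g x = exp ((- lam - mu) / lam) * exp ((1 - u) * (q x / g x) powr u / lam) * f x)"
    by (simp add: a_def)
qed

end

section \<open>Least favorable pairs\<close>

lemma reciprocal_powr:
  fixes x y u :: real
  assumes "0 < x" "0 < y"
  shows "(x / y) powr (1 - u) = (y / x) powr (u - 1)"
  using assms by (simp add: powr_divide powr_diff field_simps)

lemma exp_minus_divide: "exp ((- x - y) / x) = 1 / exp ((x + y) / (x::real))"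
proof -
  have "(- x - y) / x = - ((x + y) / x)" by (cases "x = 0") (simp_all add: field_simps)
  then show ?thesis by (simp add: exp_minus divide_inverse)
qed

lemma normalizing_constant:
  fixes R f g :: "'a \<Rightarrow> real"
  assumes f: "pos_density M f" and g: "pos_density M g" and [measurable]: "R \<in> borel_measurable M"
    and lam: "lam \<noteq> 0" and eq: "AE x in M. g x = exp ((- lam - mu) / lam) * R x * f x"
    and S_def: "S = (\<integral>x. R x * f x \<partial>M)"
  shows "S = exp ((lam + mu) / lam)"
    and "(\<integral>x. R x * ln (R x / S) * f x / S \<partial>M) = (\<integral>x. kl_term (g x) (f x) \<partial>M)"
proof -
  note f' = pos_densityD[OF f] and g' = pos_densityD[OF g]
  note [measurable] = f'(1) g'(1)
  note inv = exp_minus_divide[of lam mu]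
  have "AE x in M. R x * f x = exp ((lam + mu) / lam) * g x"
    using eq by eventually_elim (simp add: inv)
  then have "S = (\<integral>x. exp ((lam + mu) / lam) * g x \<partial>M)"
    unfolding S_def by (intro integral_cong_AE) auto
  then show S: "S = exp ((lam + mu) / lam)" using g' by simp
  show "(\<integral>x. R x * ln (R x / S) * f x / S \<partial>M) = (\<integral>x. kl_term (g x) (f x) \<partial>M)"
  proof (rule integral_cong_AE)
    show "AE x in M. R x * ln (R x / S) * f x / S = kl_term (g x) (f x)"
      using eq f'(2) by eventually_elim (simp add: S inv)
  qed measurable
qed

text \<open>The value \<open>eps \<noteq> 0\<close> excludes the degenerate readings of the
  equation: with \<open>S = 0\<close> the quotients by \<open>S\<close> and hence the integral would
  be 0, and a non-integrable integrand would have Bochner integral 0 too.\<close>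

lemma normalized_density:
  fixes R f :: "'a \<Rightarrow> real"
  assumes f: "pos_density M f" and [measurable]: "R \<in> borel_measurable M"
    and R: "\<And>x. 1 \<le> R x" and eps: "eps \<noteq> 0"
    and eq: "(\<integral>x. R x * ln (R x / S) * f x / S \<partial>M) = eps" and S: "S = (\<integral>x. R x * f x \<partial>M)"
  shows "0 < S" "pos_density M (\<lambda>x. R x * f x / S)" "KL_div M (\<lambda>x. R x * f x / S) f = ereal eps"
proof -
  note f' = pos_densityD[OF f]
  note [measurable] = f'(1)
  have "S \<noteq> 0" using eq eps by auto
  have pos: "AE x in M. 0 < R x * f x"
    using f'(2) by eventually_elim (use R in \<open>auto intro: mult_pos_pos less_le_trans[OF zero_less_one]\<close>)
  then have "0 \<le> S" unfolding S by (intro integral_nonneg_AE) (auto elim: eventually_mono)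
  with \<open>S \<noteq> 0\<close> show S_pos: "0 < S" by simp
  have "AE x in M. 0 < R x * f x / S" using pos by eventually_elim (use S_pos in simp)
  moreover have "(\<integral>x. R x * f x / S \<partial>M) = 1"
    using S_pos by (simp flip: S)
  ultimately show "pos_density M (\<lambda>x. R x * f x / S)"
    by (simp add: pos_density_def total_mass_def)
  have kl: "AE x in M. R x * ln (R x / S) * f x / S = kl_term (R x * f x / S) (f x)"
    using f'(2) by eventually_elim simp
  have i: "integrable M (\<lambda>x. R x * ln (R x / S) * f x / S)"
    using eq eps not_integrable_integral_eq by blast
  have "integrable M (\<lambda>x. kl_term (R x * f x / S) (f x))"
    by (subst integrable_cong_AE[OF _ _ kl, symmetric]) (use i in auto)
  moreover have "(\<integral>x. kl_term (R x * f x / S) (f x) \<partial>M) = eps"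
    unfolding eq[symmetric] by (rule integral_cong_AE[OF _ _ kl, symmetric]) measurable
  ultimately show "KL_div M (\<lambda>x. R x * f x / S) f = ereal eps"
    by (simp add: KL_div_def)
qed

locale nominal_pair =
  fixes M :: "'a measure" and f0 f1 :: "'a \<Rightarrow> real" and eps0 eps1 :: real
  assumes f0: "pos_density M f0" and f1: "pos_density M f1"
    and eps0: "0 < eps0" and eps1: "0 < eps1"
begin

lemma one_sided_0:
  assumes "u \<in> {0<..<1}" "g0 \<in> feasible M f0 eps0" "g1 \<in> feasible M f1 eps1"
  shows "one_sided M f0 eps0 u g0 g1"
  using assms f0 eps0 by unfold_locales (auto dest: feasibleD)

lemma one_sided_1:
  assumes "u \<in> {0<..<1}" "g0 \<in> feasible M f0 eps0" "g1 \<in> feasible M f1 eps1"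
  shows "one_sided M f1 eps1 (1 - u) g1 g0"
  using assms f1 eps1 by unfold_locales (auto dest: feasibleD)

text \<open>These are the equations \<open>a = lam * b + mu\<close> of the two instances of
  \<open>one_sided\<close>; in the second instance the coefficient \<open>1 - (1 - u)\<close> has
  become \<open>u\<close>.\<close>

definition stationary_0 where
  "stationary_0 u g0 g1 lam mu \<longleftrightarrow>
    (AE x in M. (1 - u) * (g1 x / g0 x) powr u = lam * (ln (g0 x / f0 x) + 1) + mu)"

definition stationary_1 where
  "stationary_1 u g0 g1 lam mu \<longleftrightarrow>
    (AE x in M. u * (g0 x / g1 x) powr (1 - u) = lam * (ln (g1 x / f1 x) + 1) + mu)"

text \<open>The tangent plane at \<open>(g0, g1)\<close> bounds the affinity of
  \<open>(h0, h1)\<close> by a sum in which \<open>h0\<close> and \<open>h1\<close> are decoupled.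
  Each part is bounded by \<open>linearization_bound\<close>, and by Euler's identity the bounds are
  the fractions \<open>1 - u\<close> and \<open>u\<close> of the affinity of
  \<open>(g0, g1)\<close>.\<close>

lemma joint_maximum:
  assumes u: "u \<in> {0<..<1}" and g0: "g0 \<in> feasible M f0 eps0" and g1: "g1 \<in> feasible M f1 eps1"
    and KL: "KL_div M g0 f0 = ereal eps0" "KL_div M g1 f1 = ereal eps1"
    and lam: "0 < lam0" "0 < lam1"
    and st: "stationary_0 u g0 g1 lam0 mu0" "stationary_1 u g0 g1 lam1 mu1"
    and h0: "h0 \<in> closed_feasible M f0 eps0" and h1: "h1 \<in> closed_feasible M f1 eps1"
  shows "affinity M u h0 h1 \<le> affinity M u g0 g1"
proof -
  interpret A: one_sided M f0 eps0 u g0 g1 using one_sided_0[OF u g0 g1] .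
  interpret B: one_sided M f1 eps1 "1 - u" g1 g0 using one_sided_1[OF u g0 g1] .
  note h0' = closed_feasibleD[OF h0] and h1' = closed_feasibleD[OF h1]
  have KLA: "A.KL = eps0" and KLB: "B.KL = eps1"
    using KL A.KL_div_eq B.KL_div_eq by auto
  have stA: "AE x in M. A.a x = lam0 * A.b x + mu0" using st(1) by (simp add: stationary_0_def A.a_def A.b_def)
  have stB: "AE x in M. B.a x = lam1 * B.b x + mu1" using st(2) by (simp add: stationary_1_def B.a_def B.b_def)
  note bA = A.linearization_bound[OF KLA lam(1) stA h0]
    and bB = B.linearization_bound[OF KLB lam(2) stB h1]
  have "affinity M u h0 h1 \<le> (\<integral>x. A.a x * h0 x + B.a x * h1 x \<partial>M)"
    unfolding affinity_def
  proof (rule integral_mono_AE)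
    show "integrable M (\<lambda>x. h1 x powr u * h0 x powr (1 - u))"
      using h0' h1' u by (intro integrable_affinity) auto
    show "AE x in M. h1 x powr u * h0 x powr (1 - u) \<le> A.a x * h0 x + B.a x * h1 x"
      using h0'(2) h1'(2) A.g'(2) B.g'(2)
    proof eventually_elim
      case (elim x)
      have "h1 x powr u * h0 x powr (1 - u)
         \<le> u * ((g1 x / g0 x) powr (u - 1) * h1 x) + (1 - u) * ((g1 x / g0 x) powr u * h0 x)"
        using elim u by (intro affinity_tangent) auto
      then show ?case using reciprocal_powr[of "g0 x" "g1 x" u] elim by (simp add: A.a_def B.a_def)
    qed
  qed (use bA bB in auto)
  also have "\<dots> = (\<integral>x. A.a x * h0 x \<partial>M) + (\<integral>x. B.a x * h1 x \<partial>M)" using bA bB by simp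
  also have "\<dots> \<le> (1 - u) * affinity M u g0 g1 + u * affinity M u g0 g1"
    using bA(2) bB(2) unfolding A.integral_ag B.integral_ag
    by (simp add: affinity_swap[of M u g0 g1])
  finally show ?thesis by (simp add: algebra_simps)
qed

lemma least_favorableI:
  assumes g0: "g0 \<in> feasible M f0 eps0" and g1: "g1 \<in> feasible M f1 eps1"
    and max: "\<And>h0 h1. h0 \<in> feasible M f0 eps0 \<Longrightarrow> h1 \<in> feasible M f1 eps1 \<Longrightarrow>
      affinity M u h0 h1 \<le> affinity M u g0 g1"
  shows "least_favorable M f0 f1 eps0 eps1 u g0 g1"
  using g0 g1 max by (auto simp: least_favorable_def is_arg_max_def not_less)

lemma least_favorable_feasible:
  assumes "least_favorable M f0 f1 eps0 eps1 u g0 g1"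
  shows "g0 \<in> feasible M f0 eps0" "g1 \<in> feasible M f1 eps1"
  using assms by (auto simp: least_favorable_def is_arg_max_def)

text \<open>With both constraints active, complementary slackness holds for every multiplier and
  only stationarity remains.\<close>

lemma KKT_stationary:
  assumes "u \<in> {0<..<1}" "g0 \<in> feasible M f0 eps0" "g1 \<in> feasible M f1 eps1"
    and KL: "KL_div M g0 f0 = ereal eps0" "KL_div M g1 f1 = ereal eps1"
    and lam: "0 \<le> lam0" "0 \<le> lam1"
  shows "KKT_multipliers M (\<lambda>g. affinity M u g g1) f0 eps0 g0 lam0 mu0
      \<longleftrightarrow> stationary_0 u g0 g1 lam0 mu0"
    and "KKT_multipliers M (\<lambda>g. affinity M u g0 g) f1 eps1 g1 lam1 mu1
      \<longleftrightarrow> stationary_1 u g0 g1 lam1 mu1"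
proof -
  interpret A: one_sided M f0 eps0 u g0 g1 using one_sided_0[OF assms(1-3)] .
  interpret B: one_sided M f1 eps1 "1 - u" g1 g0 using one_sided_1[OF assms(1-3)] .
  have "A.KL = eps0" "B.KL = eps1" using KL A.KL_div_eq B.KL_div_eq by auto
  then show "KKT_multipliers M (\<lambda>g. affinity M u g g1) f0 eps0 g0 lam0 mu0
      \<longleftrightarrow> stationary_0 u g0 g1 lam0 mu0"
    "KKT_multipliers M (\<lambda>g. affinity M u g0 g) f1 eps1 g1 lam1 mu1
      \<longleftrightarrow> stationary_1 u g0 g1 lam1 mu1"
    using A.KKT_iff[of lam0 mu0] B.KKT_iff[of lam1 mu1] lam
    by (simp_all add: stationary_0_def stationary_1_def A.a_def A.b_def B.a_def B.b_def
        affinity_swap[of M u g0])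
qed

lemma stationary_exp_form:
  assumes "u \<in> {0<..<1}" "g0 \<in> feasible M f0 eps0" "g1 \<in> feasible M f1 eps1"
    and lam: "0 < lam0" "0 < lam1"
  shows "stationary_0 u g0 g1 lam0 mu0 \<longleftrightarrow>
      (AE x in M. g0 x = exp ((- lam0 - mu0) / lam0)
        * exp ((1 - u) * (g1 x / g0 x) powr u / lam0) * f0 x)"
    and "stationary_1 u g0 g1 lam1 mu1 \<longleftrightarrow>
      (AE x in M. g1 x = exp ((- lam1 - mu1) / lam1)
        * exp (u * (g1 x / g0 x) powr (-1 + u) / lam1) * f1 x)"
proof -
  interpret A: one_sided M f0 eps0 u g0 g1 using one_sided_0[OF assms(1-3)] .
  interpret B: one_sided M f1 eps1 "1 - u" g1 g0 using one_sided_1[OF assms(1-3)] .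
  show "stationary_0 u g0 g1 lam0 mu0 \<longleftrightarrow>
      (AE x in M. g0 x = exp ((- lam0 - mu0) / lam0)
        * exp ((1 - u) * (g1 x / g0 x) powr u / lam0) * f0 x)"
    using A.exponential_form[OF lam(1), of mu0] by (simp add: stationary_0_def A.a_def A.b_def)
  have "stationary_1 u g0 g1 lam1 mu1 \<longleftrightarrow>
      (AE x in M. g1 x = exp ((- lam1 - mu1) / lam1)
        * exp (u * (g0 x / g1 x) powr (1 - u) / lam1) * f1 x)"
    using B.exponential_form[OF lam(2), of mu1] by (simp add: stationary_1_def B.a_def B.b_def)
  also have "\<dots> \<longleftrightarrow> (AE x in M. g1 x = exp ((- lam1 - mu1) / lam1)
        * exp (u * (g1 x / g0 x) powr (-1 + u) / lam1) * f1 x)"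
  proof (rule AE_cong_pos)
    show "AE x in M. 0 < g0 x \<and> 0 < g1 x" using A.g'(2) B.g'(2) by eventually_elim simp
  qed (simp add: reciprocal_powr)
  finally show "stationary_1 u g0 g1 lam1 mu1 \<longleftrightarrow>
      (AE x in M. g1 x = exp ((- lam1 - mu1) / lam1)
        * exp (u * (g1 x / g0 x) powr (-1 + u) / lam1) * f1 x)" .
qed

lemma exp_forms_imp_KKT:
  assumes u: "u \<in> {0<..<1}" and lam: "0 < lam0" "0 < lam1"
    and dens: "pos_density M g0" "pos_density M g1"
    and KL: "KL_div M g0 f0 = ereal eps0" "KL_div M g1 f1 = ereal eps1"
    and form: "AE x in M. g0 x = exp ((- lam0 - mu0) / lam0)
           * exp ((1 - u) * (g1 x / g0 x) powr u / lam0) * f0 x"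
      "AE x in M. g1 x = exp ((- lam1 - mu1) / lam1)
           * exp (u * (g1 x / g0 x) powr (-1 + u) / lam1) * f1 x"
  shows "least_favorable_KKT M f0 f1 eps0 eps1 u g0 g1 lam0 lam1 mu0 mu1"
proof -
  have feas: "g0 \<in> feasible M f0 eps0" "g1 \<in> feasible M f1 eps1"
    using dens KL by (auto simp: feasible_def KL_ball_def pos_density_def)
  note st = stationary_exp_form(1)[OF u feas lam, THEN iffD2, OF form(1)]
    stationary_exp_form(2)[OF u feas lam, THEN iffD2, OF form(2)]
  have "least_favorable M f0 f1 eps0 eps1 u g0 g1"
    by (rule least_favorableI[OF feas])
      (auto intro!: joint_maximum[OF u feas KL lam st] simp: feasible_iff)
  then show ?thesis
    using KKT_stationary[OF u feas KL lam[THEN less_imp_le]] st by (simp add: least_favorable_KKT_def)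
qed

end

section \<open>Consequences of disjoint divergence balls\<close>

locale disjoint_pair = nominal_pair +
  assumes disjoint: "feasible M f0 eps0 \<inter> feasible M f1 eps1 = {}"
begin

text \<open>Equal masses force a constant ratio to be 1. The two densities then agree almost
  everywhere, and since feasibility is invariant under such changes, \<open>g0\<close> would lie in
  both balls.\<close>

lemma ratio_not_const:
  assumes g0: "g0 \<in> feasible M f0 eps0" and g1: "g1 \<in> feasible M f1 eps1"
  shows "\<nexists>r. AE x in M. g1 x / g0 x = r" "\<nexists>r. AE x in M. g0 x / g1 x = r"
proof -
  note g0' = feasibleD[OF g0] and g1' = feasibleD[OF g1]
  have *: "False" if r: "AE x in M. g1 x = r * g0 x" for r
  proof -
    have "(\<integral>x. g1 x \<partial>M) = (\<integral>x. r * g0 x \<partial>M)"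
      using g0' g1' by (intro integral_cong_AE[OF _ _ r]) auto
    then have "r = 1" using g0' g1' by simp
    then have "AE x in M. g0 x = g1 x" using r by (auto elim: eventually_mono)
    from feasible_cong_AE[OF g1 g0'(1) this pos_densityD(1)[OF f1]] g0 disjoint
    show False by blast
  qed
  show "\<nexists>r. AE x in M. g1 x / g0 x = r"
  proof
    assume "\<exists>r. AE x in M. g1 x / g0 x = r"
    then obtain r where "AE x in M. g1 x / g0 x = r" by blast
    then have "AE x in M. g1 x = r * g0 x" using g0'(2) by eventually_elim auto
    then show False by (rule *)
  qed
  show "\<nexists>r. AE x in M. g0 x / g1 x = r"
  proof
    assume "\<exists>r. AE x in M. g0 x / g1 x = r"
    then obtain r where "AE x in M. g0 x / g1 x = r" by blast
    then have "AE x in M. g1 x = (1 / r) * g0 x"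
      using g0'(2) g1'(2) by eventually_elim (auto simp: field_simps)
    then show False by (rule *)
  qed
qed

lemma least_favorable_multipliers:
  assumes u: "u \<in> {0<..<1}" and lf: "least_favorable M f0 f1 eps0 eps1 u g0 g1"
  obtains lam0 lam1 mu0 mu1 where "0 < lam0" "0 < lam1"
    "KL_div M g0 f0 = ereal eps0" "KL_div M g1 f1 = ereal eps1"
    "stationary_0 u g0 g1 lam0 mu0" "stationary_1 u g0 g1 lam1 mu1"
proof -
  note feas = least_favorable_feasible[OF lf]
  interpret A: one_sided M f0 eps0 u g0 g1 using one_sided_0[OF u feas] .
  interpret B: one_sided M f1 eps1 "1 - u" g1 g0 using one_sided_1[OF u feas] .
  have "is_arg_max (\<lambda>g. affinity M u g g1) (\<lambda>g. g \<in> feasible M f0 eps0) g0"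
    "is_arg_max (\<lambda>g. affinity M (1 - u) g g0) (\<lambda>g. g \<in> feasible M f1 eps1) g1"
    using lf by (simp_all add: least_favorable_def affinity_swap[of M u g0])
  note A = A.multipliers_exist[OF this(1) ratio_not_const(1)[OF feas]]
    and B = B.multipliers_exist[OF this(2) ratio_not_const(2)[OF feas]]
  obtain lam0 mu0 where 0: "0 < lam0" "stationary_0 u g0 g1 lam0 mu0"
    using A(2) unfolding stationary_0_def A.a_def A.b_def by blast
  obtain lam1 mu1 where 1: "0 < lam1" "stationary_1 u g0 g1 lam1 mu1"
    using B(2) unfolding stationary_1_def B.a_def B.b_def by auto
  show ?thesis
    using that[OF 0(1) 1(1) _ _ 0(2) 1(2)] A.KL_div_eq B.KL_div_eq A(1) B(1) by simp
qed

text \<open>The exponential forms divide by the multipliers, while dual feasibility only gives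
  \<open>0 \<le> lam\<close>. The non-constant ratio is what makes the multipliers positive and the
  constraints active.\<close>

lemma KKT_iff_exp_forms:
  assumes u: "u \<in> {0<..<1}"
  shows "least_favorable_KKT M f0 f1 eps0 eps1 u g0 g1 lam0 lam1 mu0 mu1 \<longleftrightarrow>
        0 < lam0 \<and> 0 < lam1 \<and> pos_density M g0 \<and> pos_density M g1 \<and>
        KL_div M g0 f0 = ereal eps0 \<and> KL_div M g1 f1 = ereal eps1 \<and>
        (AE x in M. g0 x = exp ((- lam0 - mu0) / lam0)
           * exp ((1 - u) * (g1 x / g0 x) powr u / lam0) * f0 x) \<and>
        (AE x in M. g1 x = exp ((- lam1 - mu1) / lam1)
           * exp (u * (g1 x / g0 x) powr (-1 + u) / lam1) * f1 x)"
    (is "?L \<longleftrightarrow> ?R")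
proof
  assume kkt: ?L
  then have "least_favorable M f0 f1 eps0 eps1 u g0 g1" by (simp add: least_favorable_KKT_def)
  note feas = least_favorable_feasible[OF this]
  interpret A: one_sided M f0 eps0 u g0 g1 using one_sided_0[OF u feas] .
  interpret B: one_sided M f1 eps1 "1 - u" g1 g0 using one_sided_1[OF u feas] .
  have "KKT_multipliers M (\<lambda>g. affinity M u g g1) f0 eps0 g0 lam0 mu0"
    "KKT_multipliers M (\<lambda>g. affinity M (1 - u) g g0) f1 eps1 g1 lam1 mu1"
    using kkt by (simp_all add: least_favorable_KKT_def affinity_swap[of M u g0])
  then have K0: "0 \<le> lam0" "lam0 * (eps0 - A.KL) = 0" "AE x in M. A.a x = lam0 * A.b x + mu0"
    and K1: "0 \<le> lam1" "lam1 * (eps1 - B.KL) = 0" "AE x in M. B.a x = lam1 * B.b x + mu1"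
    by (simp_all only: A.KKT_iff B.KKT_iff)
  note act = A.KKT_active[OF K0 ratio_not_const(1)[OF feas]]
    B.KKT_active[OF K1 ratio_not_const(2)[OF feas]]
  have lam: "0 < lam0" "0 < lam1" by (fact act)+
  have "stationary_0 u g0 g1 lam0 mu0" "stationary_1 u g0 g1 lam1 mu1"
    using K0(3) K1(3) by (simp_all add: stationary_0_def stationary_1_def A.a_def A.b_def B.a_def B.b_def)
  note forms = this[unfolded stationary_exp_form[OF u feas lam]]
  have "KL_div M g0 f0 = ereal eps0" "KL_div M g1 f1 = ereal eps1"
    using act A.KL_div_eq B.KL_div_eq by simp_all
  with lam forms A.g'(8) B.g'(8) show ?R by blast
next
  assume ?R
  then show ?L by (intro exp_forms_imp_KKT[OF u]) (elim conjE; assumption)+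
qed

lemma multipliers_unique_exist:
  assumes u: "u \<in> {0<..<1}" and lf: "least_favorable M f0 f1 eps0 eps1 u g0 g1"
  shows "\<exists>!(p :: (real \<times> real) \<times> real \<times> real). case p of ((lam0, lam1), mu0, mu1) \<Rightarrow>
           least_favorable_KKT M f0 f1 eps0 eps1 u g0 g1 lam0 lam1 mu0 mu1"
proof -
  note feas = least_favorable_feasible[OF lf]
  interpret A: one_sided M f0 eps0 u g0 g1 using one_sided_0[OF u feas] .
  interpret B: one_sided M f1 eps1 "1 - u" g1 g0 using one_sided_1[OF u feas] .
  obtain lam0 lam1 mu0 mu1 where lam: "0 < lam0" "0 < lam1"
    and KL: "KL_div M g0 f0 = ereal eps0" "KL_div M g1 f1 = ereal eps1"
    and st: "stationary_0 u g0 g1 lam0 mu0" "stationary_1 u g0 g1 lam1 mu1"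
    using least_favorable_multipliers[OF u lf] .
  have KL': "A.KL = eps0" "B.KL = eps1" using KL A.KL_div_eq B.KL_div_eq by auto
  have ex: "least_favorable_KKT M f0 f1 eps0 eps1 u g0 g1 lam0 lam1 mu0 mu1"
    using lf st KKT_stationary[OF u feas KL lam[THEN less_imp_le]] by (simp add: least_favorable_KKT_def)
  have uni: "k0 = lam0 \<and> k1 = lam1 \<and> m0 = mu0 \<and> m1 = mu1"
    if "least_favorable_KKT M f0 f1 eps0 eps1 u g0 g1 k0 k1 m0 m1" for k0 k1 m0 m1
  proof -
    have k: "0 < k0" "0 < k1" using that unfolding KKT_iff_exp_forms[OF u] by blast+
    with that have "stationary_0 u g0 g1 k0 m0" "stationary_1 u g0 g1 k1 m1"
      using KKT_stationary[OF u feas KL k[THEN less_imp_le]] by (auto simp: least_favorable_KKT_def)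
    with st A.KKT_unique[OF KL'(1), of k0 m0 lam0 mu0] B.KKT_unique[OF KL'(2), of k1 m1 lam1 mu1]
    show ?thesis
      by (simp add: stationary_0_def stationary_1_def A.a_def A.b_def B.a_def B.b_def)
  qed
  show ?thesis
  proof (rule ex1I[of _ "((lam0, lam1), mu0, mu1)"])
    fix p :: "(real \<times> real) \<times> real \<times> real"
    assume p: "case p of ((lam0, lam1), mu0, mu1) \<Rightarrow>
           least_favorable_KKT M f0 f1 eps0 eps1 u g0 g1 lam0 lam1 mu0 mu1"
    obtain k0 k1 m0 m1 where "p = ((k0, k1), m0, m1)" by (metis prod.exhaust)
    with p uni show "p = ((lam0, lam1), mu0, mu1)" by simp
  qed (use ex in simp)
qed

lemma KKT_imp_parameter_system:
  assumes u: "u \<in> {0<..<1}"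
    and kkt: "least_favorable_KKT M f0 f1 eps0 eps1 u g0 g1 lam0 lam1 mu0 mu1"
  shows "parameter_system M f0 f1 eps0 eps1 u lam0 lam1 (\<lambda>x. g1 x / g0 x)"
    "s0 M f0 u lam0 (\<lambda>x. g1 x / g0 x) = exp ((lam0 + mu0) / lam0)"
    "s1 M f1 u lam1 (\<lambda>x. g1 x / g0 x) = exp ((lam1 + mu1) / lam1)"
proof -
  note K = kkt[unfolded KKT_iff_exp_forms[OF u]]
  have dens: "pos_density M g0" "pos_density M g1" using K by auto
  note g0' = pos_densityD[OF dens(1)] and g1' = pos_densityD[OF dens(2)]
  note [measurable] = g0'(1) g1'(1)
  define L where "L x = g1 x / g0 x" for x
  define R0 R1 where "R0 x = r0 u lam0 (L x)" and "R1 x = r1 u lam1 (L x)" for x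
  have R_meas [measurable]: "R0 \<in> borel_measurable M" "R1 \<in> borel_measurable M"
    unfolding R0_def[abs_def] R1_def[abs_def] r0_def r1_def L_def by measurable
  have e0: "AE x in M. g0 x = exp ((- lam0 - mu0) / lam0) * R0 x * f0 x"
    and e1: "AE x in M. g1 x = exp ((- lam1 - mu1) / lam1) * R1 x * f1 x"
    using K by (auto simp: R0_def R1_def L_def r0_def r1_def)
  have "lam0 \<noteq> 0" "lam1 \<noteq> 0" using K by auto
  note n0 = normalizing_constant[OF f0 dens(1) R_meas(1) this(1) e0 refl]
    and n1 = normalizing_constant[OF f1 dens(2) R_meas(2) this(2) e1 refl]
  have S0_eq: "s0 M f0 u lam0 L = (\<integral>x. R0 x * f0 x \<partial>M)"
    and S1_eq: "s1 M f1 u lam1 L = (\<integral>x. R1 x * f1 x \<partial>M)"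
    by (simp_all add: s0_def s1_def R0_def R1_def)
  have S0: "s0 M f0 u lam0 L = exp ((lam0 + mu0) / lam0)"
    using n0(1) by (simp add: S0_eq)
  then show "s0 M f0 u lam0 (\<lambda>x. g1 x / g0 x) = exp ((lam0 + mu0) / lam0)"
    unfolding L_def[abs_def] .
  have S1: "s1 M f1 u lam1 L = exp ((lam1 + mu1) / lam1)"
    using n1(1) by (simp add: S1_eq)
  then show "s1 M f1 u lam1 (\<lambda>x. g1 x / g0 x) = exp ((lam1 + mu1) / lam1)"
    unfolding L_def[abs_def] .
  have kl: "(\<integral>x. kl_term (g0 x) (f0 x) \<partial>M) = eps0" "(\<integral>x. kl_term (g1 x) (f1 x) \<partial>M) = eps1"
    using K by (auto simp: KL_div_def split: if_splits)
  note inv = exp_minus_divide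
  have "AE x in M. L x = R1 x * s0 M f0 u lam0 L / (R0 x * s1 M f1 u lam1 L) * (f1 x / f0 x)"
    using e0 e1
  proof eventually_elim
    case (elim x)
    have "L x = (1 / exp ((lam1 + mu1) / lam1) * R1 x * f1 x)
        / (1 / exp ((lam0 + mu0) / lam0) * R0 x * f0 x)"
      using elim unfolding L_def inv by simp
    also have "\<dots> = R1 x * exp ((lam0 + mu0) / lam0) / (R0 x * exp ((lam1 + mu1) / lam1))
        * (f1 x / f0 x)"
      by (simp add: ac_simps)
    finally show ?case unfolding S0 S1 .
  qed
  then have "parameter_system M f0 f1 eps0 eps1 u lam0 lam1 L"
    unfolding parameter_system_def Let_def R0_def[symmetric] R1_def[symmetric] S0_eq S1_eq
    by (intro conjI n0(2)[THEN trans, OF kl(1)] n1(2)[THEN trans, OF kl(2)])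
  then show "parameter_system M f0 f1 eps0 eps1 u lam0 lam1 (\<lambda>x. g1 x / g0 x)"
    unfolding L_def[abs_def] .
qed

text \<open>The first two equations say that the normalized densities have divergences
  \<open>eps0\<close> and \<open>eps1\<close>. The third says that their ratio is \<open>L\<close>,
  so that \<open>L\<close> inside \<open>r0\<close> and \<open>r1\<close> may be replaced by this
  ratio, which gives the implicit exponential forms.\<close>

lemma parameter_system_imp_KKT:
  assumes u: "u \<in> {0<..<1}" and lam: "0 < lam0" "0 < lam1"
    and [measurable]: "L \<in> borel_measurable M"
    and sys: "parameter_system M f0 f1 eps0 eps1 u lam0 lam1 L"
  shows "\<exists>mu0 mu1. s0 M f0 u lam0 L = exp ((lam0 + mu0) / lam0) \<and>
           s1 M f1 u lam1 L = exp ((lam1 + mu1) / lam1) \<and>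
           least_favorable_KKT M f0 f1 eps0 eps1 u
             (\<lambda>x. r0 u lam0 (L x) * f0 x / s0 M f0 u lam0 L)
             (\<lambda>x. r1 u lam1 (L x) * f1 x / s1 M f1 u lam1 L) lam0 lam1 mu0 mu1"
proof -
  define S0 S1 where "S0 = s0 M f0 u lam0 L" and "S1 = s1 M f1 u lam1 L"
  define R0 R1 where "R0 x = r0 u lam0 (L x)" and "R1 x = r1 u lam1 (L x)" for x
  have R_meas [measurable]: "R0 \<in> borel_measurable M" "R1 \<in> borel_measurable M"
    unfolding R0_def[abs_def] R1_def[abs_def] r0_def r1_def by measurable
  have R_ge: "1 \<le> R0 x" "1 \<le> R1 x" for x
    using u lam by (auto simp: R0_def R1_def r0_def r1_def)
  have sys': "(\<integral>x. R0 x * ln (R0 x / S0) * f0 x / S0 \<partial>M) = eps0"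
    "(\<integral>x. R1 x * ln (R1 x / S1) * f1 x / S1 \<partial>M) = eps1"
    "AE x in M. L x = (R1 x * S0) / (R0 x * S1) * (f1 x / f0 x)"
    using sys by (auto simp: parameter_system_def Let_def S0_def S1_def R0_def R1_def)
  have S: "S0 = (\<integral>x. R0 x * f0 x \<partial>M)" "S1 = (\<integral>x. R1 x * f1 x \<partial>M)"
    by (simp_all add: S0_def S1_def s0_def s1_def R0_def R1_def)
  note N0 = normalized_density[OF f0 R_meas(1) R_ge(1) _ sys'(1) S(1)]
    and N1 = normalized_density[OF f1 R_meas(2) R_ge(2) _ sys'(2) S(2)]
  have eps: "eps0 \<noteq> 0" "eps1 \<noteq> 0" using eps0 eps1 by auto
  note N0 = N0[OF eps(1)] and N1 = N1[OF eps(2)]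
  \<comment> \<open>These values solve \<open>S = exp ((lam + mu) / lam)\<close> for
    \<open>mu\<close>.\<close>
  define mu0 mu1 where "mu0 = lam0 * ln S0 - lam0" and "mu1 = lam1 * ln S1 - lam1"
  have mu: "S0 = exp ((lam0 + mu0) / lam0)" "S1 = exp ((lam1 + mu1) / lam1)"
    using lam N0(1) N1(1) by (simp_all add: mu0_def mu1_def)
  have mu': "exp ((- lam0 - mu0) / lam0) = 1 / S0" "exp ((- lam1 - mu1) / lam1) = 1 / S1"
    by (simp_all add: mu exp_minus_divide)
  let ?g0 = "\<lambda>x. R0 x * f0 x / S0" and ?g1 = "\<lambda>x. R1 x * f1 x / S1"
  have ratio: "AE x in M. ?g1 x / ?g0 x = L x"
    using sys'(3) by eventually_elim (simp add: field_simps)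
  have "least_favorable_KKT M f0 f1 eps0 eps1 u ?g0 ?g1 lam0 lam1 mu0 mu1"
  proof (rule exp_forms_imp_KKT[OF u lam N0(2) N1(2) N0(3) N1(3)])
    show "AE x in M. ?g0 x = exp ((- lam0 - mu0) / lam0)
       * exp ((1 - u) * (?g1 x / ?g0 x) powr u / lam0) * f0 x"
      using ratio
    proof eventually_elim
      case (elim x)
      show ?case unfolding elim mu' by (simp add: R0_def r0_def)
    qed
    show "AE x in M. ?g1 x = exp ((- lam1 - mu1) / lam1)
       * exp (u * (?g1 x / ?g0 x) powr (-1 + u) / lam1) * f1 x"
      using ratio
    proof eventually_elim
      case (elim x)
      show ?case unfolding elim mu' by (simp add: R1_def r1_def)
    qed
  qed
  with mu show ?thesis unfolding S0_def S1_def R0_def R1_def by blast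
qed

lemma least_favorable_joint_maximum:
  assumes u: "u \<in> {0<..<1}" and lf: "least_favorable M f0 f1 eps0 eps1 u g0 g1"
    and h: "h0 \<in> feasible M f0 eps0" "h1 \<in> feasible M f1 eps1"
  shows "affinity M u h0 h1 \<le> affinity M u g0 g1"
proof -
  obtain lam0 lam1 mu0 mu1 where "0 < lam0" "0 < lam1"
    "KL_div M g0 f0 = ereal eps0" "KL_div M g1 f1 = ereal eps1"
    "stationary_0 u g0 g1 lam0 mu0" "stationary_1 u g0 g1 lam1 mu1"
    using least_favorable_multipliers[OF u lf] .
  from joint_maximum[OF u least_favorable_feasible[OF lf] this(3,4,1,2,5,6)] h
  show ?thesis by (simp add: feasible_iff)
qed

lemma least_favorable_KL:
  assumes u: "u \<in> {0<..<1}" and lf: "least_favorable M f0 f1 eps0 eps1 u g0 g1"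
  shows "(\<integral>x. kl_term (g0 x) (f0 x) \<partial>M) = eps0" "(\<integral>x. kl_term (g1 x) (f1 x) \<partial>M) = eps1"
proof -
  have "KL_div M g0 f0 = ereal eps0" "KL_div M g1 f1 = ereal eps1"
    using least_favorable_multipliers[OF u lf] by blast+
  then show "(\<integral>x. kl_term (g0 x) (f0 x) \<partial>M) = eps0" "(\<integral>x. kl_term (g1 x) (f1 x) \<partial>M) = eps1"
    by (auto simp: KL_div_def split: if_splits)
qed

end

text \<open>The convexity gap \<open>d\<close> is nonnegative, and its integral is at most
  \<open>eps - eps = 0\<close> because both end points have divergence at most \<open>eps\<close>.
  So the gap vanishes, and strict convexity applies pointwise.\<close>

lemma AE_eq_if_KL_midpoint_eq:
  assumes f: "pos_density M f" and g: "g \<in> feasible M f eps" and h: "h \<in> feasible M f eps"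
    and kl: "(\<integral>x. kl_term (1 / 2 * g x + 1 / 2 * h x) (f x) \<partial>M) = eps"
  shows "AE x in M. g x = h x"
proof -
  note f' = pos_densityD[OF f] and g' = feasibleD[OF g] and h' = feasibleD[OF h]
  let ?m = "\<lambda>x. 1 / 2 * g x + 1 / 2 * h x"
  have m: "integrable M (\<lambda>x. kl_term (?m x) (f x))"
    by (rule integral_kl_convex(1)) (use f' g' h' in auto)
  define d where "d x = 1 / 2 * kl_term (g x) (f x) + 1 / 2 * kl_term (h x) (f x)
    - kl_term (?m x) (f x)" for x
  have i: "integrable M d" unfolding d_def[abs_def] using m g' h' by auto
  have nn: "AE x in M. 0 \<le> d x"
    using f'(2) g'(3) h'(3)
  proof eventually_elim
    case (elim x)
    then show ?case using kl_convex[of "g x" "h x" "f x" "1 / 2" "1 / 2"] by (simp add: d_def)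
  qed
  have "(\<integral>x. d x \<partial>M) = 1 / 2 * (\<integral>x. kl_term (g x) (f x) \<partial>M)
    + 1 / 2 * (\<integral>x. kl_term (h x) (f x) \<partial>M) - (\<integral>x. kl_term (?m x) (f x) \<partial>M)"
    unfolding d_def using m g' h' by (simp del: times_divide_eq_left times_divide_eq_right)
  then have "(\<integral>x. d x \<partial>M) \<le> 0" using kl g'(7) h'(7) by simp
  then have "AE x in M. d x = 0"
    using integral_nonneg_eq_0_iff_AE[OF i nn] integral_nonneg_AE[OF nn] by simp
  then show ?thesis
    using f'(2) g'(2) h'(2)
  proof eventually_elim
    case (elim x)
    have m: "1 / 2 * g x + 1 / 2 * h x = (g x + h x) / 2" by simp
    from elim(1) have "kl_term (1 / 2 * g x + 1 / 2 * h x) (f x)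
        = (kl_term (g x) (f x) + kl_term (h x) (f x)) / 2"
      unfolding d_def by argo
    then have "kl_term ((g x + h x) / 2) (f x) = (kl_term (g x) (f x) + kl_term (h x) (f x)) / 2"
      unfolding m .
    from kl_strictly_midconvex[OF elim(3,4,2) this] show ?case .
  qed
qed

context disjoint_pair
begin

text \<open>By joint concavity the midpoint pair attains at least the common maximal value, so it is
  least favorable itself and its constraints are active as well.\<close>

lemma least_favorable_unique:
  assumes u: "u \<in> {0<..<1}" and g: "least_favorable M f0 f1 eps0 eps1 u g0 g1"
    and h: "least_favorable M f0 f1 eps0 eps1 u h0 h1"
  shows "AE x in M. g0 x = h0 x" "AE x in M. g1 x = h1 x"
proof -
  note gf = least_favorable_feasible[OF g] and hf = least_favorable_feasible[OF h]
  let ?m0 = "\<lambda>x. 1 / 2 * g0 x + 1 / 2 * h0 x" and ?m1 = "\<lambda>x. 1 / 2 * g1 x + 1 / 2 * h1 x"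
  have mf: "?m0 \<in> feasible M f0 eps0" "?m1 \<in> feasible M f1 eps1"
    by (rule feasible_convex[OF f0 gf(1) hf(1)] feasible_convex[OF f1 gf(2) hf(2)]; simp)+
  have "affinity M u g0 g1 \<le> affinity M u h0 h1"
    by (rule least_favorable_joint_maximum[OF u h gf])
  then have "affinity M u g0 g1 \<le> 1 / 2 * affinity M u g0 g1 + 1 / 2 * affinity M u h0 h1" by simp
  also have "\<dots> \<le> affinity M u ?m0 ?m1"
    using feasibleD[OF gf(1)] feasibleD[OF gf(2)] feasibleD[OF hf(1)] feasibleD[OF hf(2)] u
    by (intro integral_affinity_concave) auto
  finally have "affinity M u g0 g1 \<le> affinity M u ?m0 ?m1" .
  then have m: "least_favorable M f0 f1 eps0 eps1 u ?m0 ?m1"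
    using least_favorable_joint_maximum[OF u g] by (intro least_favorableI mf) (blast intro: order_trans)
  from AE_eq_if_KL_midpoint_eq[OF f0 gf(1) hf(1) least_favorable_KL(1)[OF u m]]
    AE_eq_if_KL_midpoint_eq[OF f1 gf(2) hf(2) least_favorable_KL(2)[OF u m]]
  show "AE x in M. g0 x = h0 x" "AE x in M. g1 x = h1 x" .
qed

end

section \<open>Limits of maximizing sequences\<close>

text \<open>A maximizing sequence for \<open>D\<close> need not converge, since \<open>D\<close> is not strictly concave. Choosing
  its members to be nearly minimal for \<open>J\<close> within the superlevel sets of \<open>D\<close> makes the midpoint
  defect of \<open>J\<close> small along the sequence.\<close>

lemma near_optimal_sequence:
  fixes D J :: "'b \<Rightarrow> real" and mid :: "'b \<Rightarrow> 'b \<Rightarrow> 'b"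
  assumes ne: "C \<noteq> {}" and mid: "\<And>x y. x \<in> C \<Longrightarrow> y \<in> C \<Longrightarrow> mid x y \<in> C"
    and D_bdd: "\<And>x. x \<in> C \<Longrightarrow> D x \<le> B" and J_bdd: "\<And>x. x \<in> C \<Longrightarrow> 0 \<le> J x \<and> J x \<le> B'"
    and concave: "\<And>x y. x \<in> C \<Longrightarrow> y \<in> C \<Longrightarrow> (D x + D y) / 2 \<le> D (mid x y)"
  obtains X where "\<And>n. X n \<in> C" "\<And>n y. y \<in> C \<Longrightarrow> D y - 1 / real (Suc n) \<le> D (X n)"
    "\<And>e. 0 < e \<Longrightarrow> \<exists>N. \<forall>i\<ge>N. \<forall>j\<ge>N. (J (X i) + J (X j)) / 2 - J (mid (X i) (X j)) < e"
proof -
  define S where "S = (SUP x\<in>C. D x)"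
  have bddD: "bdd_above (D ` C)" using D_bdd by (auto intro!: bdd_aboveI)
  have S_ge: "D x \<le> S" if "x \<in> C" for x
    unfolding S_def using that bddD by (rule cSUP_upper)
  define Cn where "Cn n = {x \<in> C. S - 1 / real (Suc n) \<le> D x}" for n
  have Cn_C: "x \<in> C" if "x \<in> Cn n" for x n using that by (simp add: Cn_def)
  have Cn_ne: "Cn n \<noteq> {}" for n
  proof -
    have "S - 1 / real (Suc n) < S" by simp
    then obtain x where "x \<in> C" "S - 1 / real (Suc n) < D x"
      unfolding S_def less_cSUP_iff[OF ne bddD] by blast
    then have "x \<in> Cn n" by (simp add: Cn_def)
    then show ?thesis by blast
  qed
  have Cn_mono: "Cn j \<subseteq> Cn i" if "i \<le> j" for i j
  proof -
    have "1 / real (Suc j) \<le> 1 / real (Suc i)" using that by (simp add: frac_le)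
    then show ?thesis by (auto simp: Cn_def)
  qed
  have Cn_mid: "mid x y \<in> Cn n" if "x \<in> Cn n" "y \<in> Cn n" for x y n
    using that mid concave[of x y] by (auto simp: Cn_def)
  have bddJ: "bdd_below (J ` Cn n)" for n
    using J_bdd Cn_C by (intro bdd_belowI[of _ 0]) auto
  \<comment> \<open>Superlevel sets shrink with \<open>n\<close>, so these infima increase. Their
    convergence is what controls the midpoint defect.\<close>
  define m where "m n = (INF x\<in>Cn n. J x)" for n
  have m_le: "m n \<le> J x" if "x \<in> Cn n" for x n
    unfolding m_def using bddJ that by (rule cINF_lower)
  have m_mono: "incseq m"
    unfolding m_def by (intro incseq_SucI cINF_superset_mono Cn_ne bddJ Cn_mono) auto
  have m_le_B: "m n \<le> B'" for n
  proof -
    obtain x where "x \<in> Cn n" using Cn_ne by blast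
    with m_le J_bdd Cn_C show ?thesis by (meson order_trans)
  qed
  obtain l where l: "m \<longlonglongrightarrow> l" "\<forall>i. m i \<le> l"
    using incseq_convergent[OF m_mono] m_le_B by blast
  have "\<exists>x\<in>Cn n. J x < m n + 1 / real (Suc n)" for n
  proof -
    have "m n < m n + 1 / real (Suc n)" by simp
    then show ?thesis unfolding m_def using cINF_less_iff[OF Cn_ne bddJ] by blast
  qed
  then obtain X where X: "\<And>n. X n \<in> Cn n" "\<And>n. J (X n) < m n + 1 / real (Suc n)" by metis
  show ?thesis
  proof (rule that)
    show "X n \<in> C" for n using X Cn_C by blast
    show "D y - 1 / real (Suc n) \<le> D (X n)" if "y \<in> C" for n y
      using X(1)[of n] S_ge[OF that] by (simp add: Cn_def)
    fix e :: real assume e: "0 < e"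
    have "(\<lambda>N. l + 1 / real (Suc N) - m N) \<longlonglongrightarrow> l + 0 - l"
      by (intro tendsto_intros l LIMSEQ_Suc[OF lim_1_over_n])
    then have "\<forall>\<^sub>F N in sequentially. l + 1 / real (Suc N) - m N < e"
      using e by (intro order_tendstoD(2)) auto
    \<comment> \<open>Beyond \<open>N\<close> the members have \<open>J\<close> at most
      \<open>l + 1 / real (Suc N)\<close>, while their midpoints stay in \<open>Cn N\<close> and
      have \<open>J\<close> at least \<open>m N\<close>.\<close>
    then obtain N where N: "l + 1 / real (Suc N) - m N < e" by (auto simp: eventually_sequentially)
    show "\<exists>N. \<forall>i\<ge>N. \<forall>j\<ge>N. (J (X i) + J (X j)) / 2 - J (mid (X i) (X j)) < e"
    proof (intro exI allI impI)
      fix i j assume ij: "N \<le> i" "N \<le> j"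
      have le: "J (X k) \<le> l + 1 / real (Suc N)" if "N \<le> k" for k
      proof -
        have "1 / real (Suc k) \<le> 1 / real (Suc N)" using that by (simp add: frac_le)
        then show ?thesis using X(2)[of k] l(2) by (smt (verit))
      qed
      have "mid (X i) (X j) \<in> Cn N" using X Cn_mono ij by (blast intro: Cn_mid)
      then have "m N \<le> J (mid (X i) (X j))" by (rule m_le)
      then show "(J (X i) + J (X j)) / 2 - J (mid (X i) (X j)) < e"
        using le[OF ij(1)] le[OF ij(2)] N by argo
    qed
  qed
qed

text \<open>Quantitative strict convexity: writing \<open>x\<close> for the distance and
  \<open>d\<close> for the midpoint defect, \<open>x * x \<le> 4 * f * d\<close>. The product is
  split by the arithmetic-geometric mean inequality with a free parameter \<open>e\<close>, so that
  the bound is linear in \<open>f\<close> and \<open>d\<close> and can be integrated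
  directly.\<close>

lemma reciprocal_midpoint_defect:
  fixes f a b e :: real
  assumes "0 < f" "0 \<le> a" "0 \<le> b" "0 < e"
  defines "\<phi> \<equiv> \<lambda>a. f\<^sup>2 / (f + a)"
  shows "\<bar>\<phi> a - \<phi> b\<bar> \<le> e * f + ((\<phi> a + \<phi> b) / 2 - \<phi> ((a + b) / 2)) / e"
proof -
  define P Q where "P = f + a" and "Q = f + b"
  have PQ: "f \<le> P" "f \<le> Q" "0 < P" "0 < Q" using assms by (auto simp: P_def Q_def)
  have mid: "f + (a + b) / 2 = (P + Q) / 2" by (simp add: P_def Q_def field_simps)
  have \<phi>: "\<phi> a = f\<^sup>2 / P" "\<phi> b = f\<^sup>2 / Q" "\<phi> ((a + b) / 2) = f\<^sup>2 * (2 / (P + Q))"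
    by (simp_all add: \<phi>_def mid) (simp_all add: P_def Q_def)
  define x where "x = \<bar>\<phi> a - \<phi> b\<bar>"
  define d where "d = (\<phi> a + \<phi> b) / 2 - \<phi> ((a + b) / 2)"
  have "\<phi> a - \<phi> b = f\<^sup>2 * (Q - P) / (P * Q)"
    unfolding \<phi> using PQ by (simp add: field_simps)
  then have x2: "x\<^sup>2 = (f\<^sup>2 * (Q - P) / (P * Q))\<^sup>2" by (simp only: x_def power2_abs)
  have d: "d = f\<^sup>2 * (Q - P)\<^sup>2 / (2 * (P * Q) * (P + Q))"
  proof -
    have "(1 / P + 1 / Q) / 2 - 2 / (P + Q) = (Q - P)\<^sup>2 / (2 * (P * Q) * (P + Q))"
      using PQ by (simp add: field_simps power2_eq_square)
    moreover have "d = f\<^sup>2 * ((1 / P + 1 / Q) / 2 - 2 / (P + Q))"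
      unfolding d_def \<phi> by (simp add: algebra_simps add_divide_distrib)
    ultimately show ?thesis by simp
  qed
  have "f * (P + Q) \<le> 2 * (P * Q)"
  proof -
    have "f * P \<le> Q * P" "f * Q \<le> P * Q" using PQ by (auto intro: mult_right_mono)
    then show ?thesis by (simp add: algebra_simps)
  qed
  then have quot: "f / (P * Q) \<le> 2 / (P + Q)"
    using PQ by (simp add: divide_le_eq pos_le_divide_eq mult.commute)
  define A where "A = f * f\<^sup>2 * (Q - P)\<^sup>2 / (P * Q)"
  have "0 \<le> A" using PQ assms(1) by (simp add: A_def)
  have "x\<^sup>2 = A * (f / (P * Q))" unfolding x2 A_def by (simp add: power2_eq_square)
  also have "\<dots> \<le> A * (2 / (P + Q))" using quot \<open>0 \<le> A\<close> by (rule mult_left_mono)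
  also have "\<dots> = 4 * f * d"
  proof -
    define W where "W = P * Q * (P + Q)"
    have W: "2 * (P * Q) * (P + Q) = 2 * W" by (simp add: W_def)
    have "4 * f * d = 2 * (f * f\<^sup>2 * (Q - P)\<^sup>2) / W" unfolding d W by simp
    then show ?thesis by (simp add: A_def W_def)
  qed
  finally have "x\<^sup>2 \<le> 4 * f * d" .
  moreover have "x * (4 * e * f) \<le> x\<^sup>2 + (2 * e * f)\<^sup>2"
    using zero_le_power2[of "x - 2 * e * f"] by (simp add: power2_eq_square algebra_simps)
  ultimately have "x * (4 * e * f) \<le> 4 * f * d + (2 * e * f)\<^sup>2" by linarith
  also have "\<dots> = (e * f + d / e) * (4 * e * f)"
    using assms by (simp add: field_simps power2_eq_square)
  finally have "x \<le> e * f + d / e" using assms by simp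
  then show ?thesis by (simp add: x_def d_def)
qed

text \<open>Fatou's lemma for Bochner integrals, with integrability of the limit as part of the
  conclusion. The bounds \<open>c n\<close> may vary, which is used for the values along a
  maximizing sequence.\<close>

lemma integral_fatou:
  fixes h :: "nat \<Rightarrow> 'a \<Rightarrow> real"
  assumes int: "\<And>n. integrable M (h n)" and nn: "\<And>n. AE x in M. 0 \<le> h n x"
    and lim: "AE x in M. (\<lambda>n. h n x) \<longlonglongrightarrow> k x" and [measurable]: "k \<in> borel_measurable M"
    and le: "\<And>n. (\<integral>x. h n x \<partial>M) \<le> c n" and c: "c \<longlonglongrightarrow> C"
  shows "integrable M k" "(\<integral>x. k x \<partial>M) \<le> C"
proof -
  have [measurable]: "h n \<in> borel_measurable M" for n using int by auto
  have nn': "AE x in M. \<forall>n. 0 \<le> h n x" using nn by (simp add: AE_all_countable)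
  have k_nn: "AE x in M. 0 \<le> k x"
    using lim nn' by eventually_elim (auto intro: LIMSEQ_le_const)
  have "0 \<le> c n" for n using le[of n] integral_nonneg_AE[OF nn[of n]] by simp
  then have C: "0 \<le> C" using c by (auto intro: LIMSEQ_le_const)
  have "(\<integral>\<^sup>+ x. ennreal (k x) \<partial>M) = (\<integral>\<^sup>+ x. liminf (\<lambda>n. ennreal (h n x)) \<partial>M)"
  proof (rule nn_integral_cong_AE)
    show "AE x in M. ennreal (k x) = liminf (\<lambda>n. ennreal (h n x))"
      using lim
    proof eventually_elim
      case (elim x)
      then have "(\<lambda>n. ennreal (h n x)) \<longlonglongrightarrow> ennreal (k x)" by (rule tendsto_ennrealI)
      then show ?case by (simp add: lim_imp_Liminf)
    qed
  qed
  also have "\<dots> \<le> liminf (\<lambda>n. \<integral>\<^sup>+ x. ennreal (h n x) \<partial>M)"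
    by (rule nn_integral_liminf) measurable
  also have "\<dots> \<le> liminf (\<lambda>n. ennreal (c n))"
  proof (rule Liminf_mono, rule always_eventually, rule allI)
    fix n
    have "(\<integral>\<^sup>+ x. ennreal (h n x) \<partial>M) = ennreal (\<integral>x. h n x \<partial>M)"
      by (rule nn_integral_eq_integral[OF int nn])
    also have "\<dots> \<le> ennreal (c n)" by (rule ennreal_leI[OF le])
    finally show "(\<integral>\<^sup>+ x. ennreal (h n x) \<partial>M) \<le> ennreal (c n)" .
  qed
  also have "\<dots> = ennreal C"
    using tendsto_ennrealI[OF c] by (simp add: lim_imp_Liminf)
  finally have *: "(\<integral>\<^sup>+ x. ennreal (k x) \<partial>M) \<le> ennreal C" .
  show i: "integrable M k"
  proof (rule integrableI_bounded)
    have "(\<integral>\<^sup>+ x. ennreal (norm (k x)) \<partial>M) = (\<integral>\<^sup>+ x. ennreal (k x) \<partial>M)"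
      using k_nn by (intro nn_integral_cong_AE) (auto elim: eventually_mono)
    then show "(\<integral>\<^sup>+ x. ennreal (norm (k x)) \<partial>M) < \<infinity>"
      using * by (auto intro: le_less_trans)
  qed measurable
  show "(\<integral>x. k x \<partial>M) \<le> C"
    using * C by (simp add: nn_integral_eq_integral[OF i k_nn])
qed

text \<open>Only the limit 0 needs care, since \<open>ln\<close> has no limit there. With
  \<open>t = y / f\<close>, the bound for small \<open>t\<close> comes from
  \<open>ln (1 / sqrt t) \<le> 1 / sqrt t\<close>, and the one for large \<open>t\<close> from
  \<open>ln t \<le> t\<close>.\<close>

lemma tendsto_kl_term:
  fixes a :: "nat \<Rightarrow> real"
  assumes a: "a \<longlonglongrightarrow> l" and nn: "\<And>n. 0 \<le> a n" and f: "0 < f"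
  shows "(\<lambda>n. kl_term (a n) f) \<longlonglongrightarrow> kl_term l f"
proof (cases "l = 0")
  case False
  then show ?thesis using a f by (intro tendsto_intros) auto
next
  case True
  have bound: "\<bar>kl_term y f\<bar> \<le> f * (2 * sqrt (y / f) + (y / f)\<^sup>2)" if "0 \<le> y" for y
  proof (cases "y = 0")
    case False
    define t where "t = y / f"
    have t: "t > 0" and y: "y = f * t" using False that f by (auto simp: t_def)
    have "ln t \<le> t" using t ln_le_minus_one[of t] by simp
    then have "t * ln t \<le> t * t" using t by simp
    moreover have "- (t * ln t) \<le> 2 * sqrt t"
    proof -
      have "ln (1 / sqrt t) \<le> 1 / sqrt t" using t ln_le_minus_one[of "1 / sqrt t"] by simp
      then have "2 * t * ln (1 / sqrt t) \<le> 2 * t * (1 / sqrt t)"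
        using t by (intro mult_left_mono) auto
      also have "2 * t * (1 / sqrt t) = 2 * (t / sqrt t)" by simp
      also have "\<dots> = 2 * sqrt t" using t by (simp only: real_div_sqrt)
      also have "2 * t * ln (1 / sqrt t) = - (t * ln t)" using t by (simp add: ln_div ln_sqrt)
      finally show "- (t * ln t) \<le> 2 * sqrt t" .
    qed
    ultimately have "\<bar>t * ln t\<bar> \<le> 2 * sqrt t + t\<^sup>2"
      using t by (auto simp: abs_le_iff power2_eq_square intro: add_increasing add_increasing2)
    then have "f * \<bar>t * ln t\<bar> \<le> f * (2 * sqrt t + t\<^sup>2)" using f by simp
    then show ?thesis using f t by (simp add: y abs_mult ac_simps)
  qed simp
  have "(\<lambda>n. f * (2 * sqrt (a n / f) + (a n / f)\<^sup>2)) \<longlonglongrightarrow> f * (2 * sqrt (0 / f) + (0 / f)\<^sup>2)"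
    using a True f by (intro tendsto_intros) auto
  then have "(\<lambda>n. f * (2 * sqrt (a n / f) + (a n / f)\<^sup>2)) \<longlonglongrightarrow> 0" by simp
  then have "(\<lambda>n. kl_term (a n) f) \<longlonglongrightarrow> 0"
    by (rule Lim_null_comparison[rotated]) (auto intro!: always_eventually bound nn)
  then show ?thesis using True by simp
qed

text \<open>The divergence bound makes the densities uniformly integrable, so no mass is lost in the
  limit: \<open>c * kl_term a f - a\<close> is bounded below by a multiple of \<open>f\<close> for every \<open>c > 0\<close>.\<close>

lemma closed_feasible_AE_limit:
  assumes f: "pos_density M f" and g: "\<And>n. g n \<in> closed_feasible M f eps"
    and lim: "AE x in M. (\<lambda>n. g n x) \<longlonglongrightarrow> h x" and [measurable]: "h \<in> borel_measurable M"
  shows "h \<in> closed_feasible M f eps"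
proof -
  note f' = pos_densityD[OF f] and g' = closed_feasibleD[OF g]
  note [measurable] = f'(1)
  have nn: "AE x in M. \<forall>n. 0 \<le> g n x" using g'(2) by (simp add: AE_all_countable)
  have kl_lim: "AE x in M. (\<lambda>n. kl_term (g n x) (f x)) \<longlonglongrightarrow> kl_term (h x) (f x)"
    using lim nn f'(2) by eventually_elim (auto intro: tendsto_kl_term)
  have h_nn: "AE x in M. 0 \<le> h x"
    using lim nn by eventually_elim (auto intro: LIMSEQ_le_const)
  have h: "integrable M h" "(\<integral>x. h x \<partial>M) \<le> 1"
    by (rule integral_fatou[OF g'(3) g'(2) lim _ _ tendsto_const[of 1]]; simp add: g'(4))+
  \<comment> \<open>Adding \<open>f - h\<close> makes the integrand nonnegative for Fatou's lemma.
    The resulting bound becomes the divergence constraint only once \<open>h\<close> is known to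
    have mass 1.\<close>
  define H where "H x = kl_term (h x) (f x) - h x + f x" for x
  have H: "integrable M H" "(\<integral>x. H x \<partial>M) \<le> eps"
  proof -
    have lower: "AE x in M. 0 \<le> kl_term (g n x) (f x) - g n x + f x" for n
      using g'(2)[of n] f'(2) by eventually_elim (use kl_ge in \<open>force\<close>)
    have conv: "AE x in M. (\<lambda>n. kl_term (g n x) (f x) - g n x + f x) \<longlonglongrightarrow> H x"
      using kl_lim lim unfolding H_def
      by eventually_elim (auto intro!: tendsto_add tendsto_diff)
    have bound: "(\<integral>x. kl_term (g n x) (f x) - g n x + f x \<partial>M) \<le> eps" for n
      using g' f' by simp
    have "H \<in> borel_measurable M" unfolding H_def[abs_def] by measurable
    note fatou = integral_fatou[OF _ lower conv this bound tendsto_const]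
    show "integrable M H" "(\<integral>x. H x \<partial>M) \<le> eps"
      by (rule fatou; use g' f' in auto)+
  qed
  have kl: "integrable M (\<lambda>x. kl_term (h x) (f x))"
  proof -
    have "integrable M (\<lambda>x. H x + h x - f x)" using H h f' by auto
    then show ?thesis by (simp add: H_def)
  qed
  define I where "I = (\<integral>x. kl_term (h x) (f x) \<partial>M)"
  have I_le: "I - (\<integral>x. h x \<partial>M) + 1 \<le> eps"
    using H(2) kl h f' by (simp add: H_def I_def)
  have mass: "1 - c * (eps - I) \<le> (\<integral>x. h x \<partial>M)" if c: "c > 0" for c
  proof -
    \<comment> \<open>From the tangent line of the divergence integrand at
      \<open>m = f * exp (1 / c)\<close>, multiplied by \<open>c\<close>; there
      \<open>ln (m / f) = 1 / c\<close>, so the factor \<open>c\<close> cancels.\<close>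
    define C where "C = c * exp (1 / c)"
    have lower: "AE x in M. 0 \<le> c * kl_term (g n x) (f x) - g n x + C * f x" for n
      using g'(2)[of n] f'(2)
    proof eventually_elim
      case (elim x)
      have "g n x * ln (f x * exp (1 / c) / f x) + g n x - f x * exp (1 / c) \<le> kl_term (g n x) (f x)"
        using elim by (intro kl_tangent) auto
      then have "g n x / c + g n x - f x * exp (1 / c) \<le> kl_term (g n x) (f x)"
        using elim by simp
      then have "c * (g n x / c + g n x - f x * exp (1 / c)) \<le> c * kl_term (g n x) (f x)"
        using c by (intro mult_left_mono) auto
      moreover have "c * (g n x / c + g n x - f x * exp (1 / c)) = g n x + c * g n x - C * f x"
        using c by (simp add: C_def algebra_simps)
      moreover have "0 \<le> c * g n x" using c elim by simp
      ultimately show ?case by linarith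
    qed
    have bound: "(\<integral>x. c * kl_term (g n x) (f x) - g n x + C * f x \<partial>M) \<le> c * eps - 1 + C" for n
      using g'[of n] f' c by simp
    have conv: "AE x in M. (\<lambda>n. c * kl_term (g n x) (f x) - g n x + C * f x)
        \<longlonglongrightarrow> c * kl_term (h x) (f x) - h x + C * f x"
      using kl_lim lim
      by eventually_elim (auto intro!: tendsto_add tendsto_diff tendsto_mult_left)
    have "integrable M (\<lambda>x. c * kl_term (g n x) (f x) - g n x + C * f x)" for n
      using g' f' by auto
    from integral_fatou(2)[OF this lower conv _ bound tendsto_const]
    have "(\<integral>x. c * kl_term (h x) (f x) - h x + C * f x \<partial>M) \<le> c * eps - 1 + C" by simp
    then show ?thesis using kl h f' by (simp add: I_def algebra_simps)
  qed
  have "1 \<le> (\<integral>x. h x \<partial>M)"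
  proof (rule field_le_epsilon)
    fix e :: real assume e: "0 < e"
    define c where "c = e / (\<bar>eps - I\<bar> + 1)"
    have c: "c > 0" using e by (simp add: c_def)
    have "c * (eps - I) \<le> c * (\<bar>eps - I\<bar> + 1)" using c by (intro mult_left_mono) auto
    also have "\<dots> = e" by (simp add: c_def add_nonneg_eq_0_iff)
    finally show "1 \<le> (\<integral>x. h x \<partial>M) + e" using mass[OF c] by linarith
  qed
  with h(2) have "(\<integral>x. h x \<partial>M) = 1" by simp
  with I_le kl h h_nn show ?thesis
    by (simp add: closed_feasible_def I_def)
qed

text \<open>The densities are recovered from \<open>s = f * f / (f + g)\<close> as
  \<open>f * f / s - f\<close>, which converges unless \<open>s\<close> tends to 0. In that case
  \<open>g\<close> tends to infinity, and Fatou's lemma allows this only on a null set because all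
  masses are 1.\<close>

lemma AE_limit_if_reciprocal_Cauchy:
  assumes f: "pos_density M f" and g: "\<And>n. g n \<in> closed_feasible M f eps"
    and Cauchy: "AE x in M. Cauchy (\<lambda>n. (f x)\<^sup>2 / (f x + g n x))"
  obtains h where "h \<in> borel_measurable M" "AE x in M. (\<lambda>n. g n x) \<longlonglongrightarrow> h x"
proof -
  note f' = pos_densityD[OF f] and g' = closed_feasibleD[OF g]
  note [measurable] = f'(1) g'(1)
  have nn: "AE x in M. \<forall>n. 0 \<le> g n x" using g'(2) by (simp add: AE_all_countable)
  have "(\<integral>\<^sup>+ x. liminf (\<lambda>n. ennreal (g n x)) \<partial>M) \<le> liminf (\<lambda>n. \<integral>\<^sup>+ x. ennreal (g n x) \<partial>M)"
    by (rule nn_integral_liminf) measurable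
  also have "(\<lambda>n. \<integral>\<^sup>+ x. ennreal (g n x) \<partial>M) = (\<lambda>_. 1)"
    using nn_integral_eq_integral[OF g'(3) g'(2)] g'(4) by simp
  also have "liminf (\<lambda>_. 1 :: ennreal) = 1" by (simp add: Liminf_const)
  finally have "(\<integral>\<^sup>+ x. liminf (\<lambda>n. ennreal (g n x)) \<partial>M) \<noteq> \<infinity>"
    by (auto simp: top_unique)
  from nn_integral_PInf_AE[OF _ this]
  have fin: "AE x in M. liminf (\<lambda>n. ennreal (g n x)) \<noteq> \<infinity>" by simp
  have "AE x in M. convergent (\<lambda>n. g n x)"
    using Cauchy nn fin f'(2)
  proof eventually_elim
    case (elim x)
    define s where "s n = (f x)\<^sup>2 / (f x + g n x)" for n
    have s_pos: "s n > 0" for n using elim(2,4) by (auto simp: s_def intro!: divide_pos_pos add_pos_nonneg)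
    have s_ne: "s n \<noteq> 0" for n using s_pos[of n] by simp
    have g_eq: "g n x = (f x)\<^sup>2 / s n - f x" for n
    proof -
      have "f x + g n x > 0" using elim(2,4) by (auto intro!: add_pos_nonneg)
      then show ?thesis using elim(4) by (simp add: s_def)
    qed
    obtain l where l: "s \<longlonglongrightarrow> l"
      using elim(1) unfolding s_def[symmetric] by (auto simp: Cauchy_convergent_iff convergent_def)
    have "l \<noteq> 0"
    proof
      assume "l = 0"
      then have "filterlim s (at_right 0) sequentially"
        using l s_pos s_ne by (auto simp: filterlim_at intro!: always_eventually)
      then have "filterlim (\<lambda>n. inverse (s n)) at_top sequentially"
        by (rule filterlim_compose[OF filterlim_inverse_at_top_right])
      then have "filterlim (\<lambda>n. (f x)\<^sup>2 * inverse (s n)) at_top sequentially"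
        using elim(4) by (intro filterlim_tendsto_pos_mult_at_top[OF tendsto_const]) auto
      then have "filterlim (\<lambda>n. - f x + (f x)\<^sup>2 * inverse (s n)) at_top sequentially"
        by (rule filterlim_tendsto_add_at_top[OF tendsto_const])
      then have "filterlim (\<lambda>n. g n x) at_top sequentially"
        by (simp add: g_eq divide_inverse)
      then have "(\<lambda>n. ennreal (g n x)) \<longlonglongrightarrow> \<infinity>"
        by (simp add: ennreal_tendsto_top_eq_at_top)
      then have "liminf (\<lambda>n. ennreal (g n x)) = \<infinity>" by (simp add: lim_imp_Liminf)
      with elim(3) show False by simp
    qed
    then have "(\<lambda>n. (f x)\<^sup>2 / s n - f x) \<longlonglongrightarrow> (f x)\<^sup>2 / l - f x"
      using l by (intro tendsto_intros)
    then show ?case by (auto simp: g_eq convergent_def)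
  qed
  then have "AE x in M. (\<lambda>n. g n x) \<longlonglongrightarrow> lim (\<lambda>n. g n x)"
    by (auto elim!: eventually_mono simp: convergent_LIMSEQ_iff)
  moreover have "(\<lambda>x. lim (\<lambda>n. g n x)) \<in> borel_measurable M" by measurable
  ultimately show ?thesis using that by blast
qed

section \<open>A joint maximizer over the closed feasible sets\<close>

context nominal_pair
begin

text \<open>Here \<open>D\<close> is the affinity and \<open>J\<close> the sum of the reciprocal
  functionals of the two components. Small midpoint defects of \<open>J\<close> make the transforms
  \<open>\<phi>\<close> Cauchy in L1, hence almost everywhere along a subsequence, and inverting
  \<open>\<phi>\<close> gives the limit densities.\<close>

lemma closed_maximizer_exists:
  assumes u: "0 < u" "u < 1"
  obtains g0 g1 where "g0 \<in> closed_feasible M f0 eps0" "g1 \<in> closed_feasible M f1 eps1"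
    "\<And>h0 h1. h0 \<in> closed_feasible M f0 eps0 \<Longrightarrow> h1 \<in> closed_feasible M f1 eps1 \<Longrightarrow>
      affinity M u h0 h1 \<le> affinity M u g0 g1"
proof -
  note f0' = pos_densityD[OF f0] and f1' = pos_densityD[OF f1]
  note [measurable] = f0'(1) f1'(1)
  define \<phi> where "\<phi> f a = f\<^sup>2 / (f + a)" for f a :: real
  have \<phi>_bound: "0 \<le> \<phi> f a \<and> \<phi> f a \<le> f" if "0 < f" "0 \<le> a" for f a
    using that by (auto simp: \<phi>_def power2_eq_square divide_le_eq add_pos_nonneg mult_left_mono)
  define R where "R f a = (\<integral>x. \<phi> (f x) (a x) \<partial>M)" for f a :: "'a \<Rightarrow> real"
  have \<phi>_int: "integrable M (\<lambda>x. \<phi> (f x) (a x))" and R_bound: "0 \<le> R f a \<and> R f a \<le> 1"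
    if f: "pos_density M f" and a: "a \<in> closed_feasible M f eps" for f a eps
  proof -
    note f' = pos_densityD[OF f] and a' = closed_feasibleD[OF a]
    note [measurable] = f'(1) a'(1)
    have b: "AE x in M. 0 \<le> \<phi> (f x) (a x) \<and> \<phi> (f x) (a x) \<le> f x"
      using f'(2) a'(2) by eventually_elim (rule \<phi>_bound)
    show i: "integrable M (\<lambda>x. \<phi> (f x) (a x))"
    proof (rule Bochner_Integration.integrable_bound[OF f'(3)])
      show "(\<lambda>x. \<phi> (f x) (a x)) \<in> borel_measurable M" unfolding \<phi>_def by measurable
      show "AE x in M. norm (\<phi> (f x) (a x)) \<le> norm (f x)"
        using b by eventually_elim auto
    qed
    have "0 \<le> R f a" unfolding R_def using b by (intro integral_nonneg_AE) (auto elim: eventually_mono)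
    moreover have "R f a \<le> (\<integral>x. f x \<partial>M)"
      unfolding R_def using b by (intro integral_mono_AE[OF i f'(3)]) (auto elim: eventually_mono)
    ultimately show "0 \<le> R f a \<and> R f a \<le> 1" using f' by simp
  qed
  define C where "C = closed_feasible M f0 eps0 \<times> closed_feasible M f1 eps1"
  define mid :: "('a \<Rightarrow> real) \<Rightarrow> ('a \<Rightarrow> real) \<Rightarrow> 'a \<Rightarrow> real"
    where "mid a b x = 1 / 2 * a x + 1 / 2 * b x" for a b x
  define defect where "defect f a b = (R f a + R f b) / 2 - R f (mid a b)" for f a b
  have mid_closed: "mid a b \<in> closed_feasible M f eps"
    if "pos_density M f" "a \<in> closed_feasible M f eps" "b \<in> closed_feasible M f eps" for f a b eps
    unfolding mid_def[abs_def] using that by (intro closed_feasible_convex) auto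
  have defect: "(\<integral>x. \<bar>\<phi> (f x) (a x) - \<phi> (f x) (b x)\<bar> \<partial>M) \<le> e + defect f a b / e"
    if f: "pos_density M f" and a: "a \<in> closed_feasible M f eps" and b: "b \<in> closed_feasible M f eps"
      and e: "0 < e" for f a b eps e
  proof -
    note f' = pos_densityD[OF f] and a' = closed_feasibleD[OF a] and b' = closed_feasibleD[OF b]
    note i = \<phi>_int[OF f a] \<phi>_int[OF f b] \<phi>_int[OF f mid_closed[OF f a b]]
    have "(\<integral>x. \<bar>\<phi> (f x) (a x) - \<phi> (f x) (b x)\<bar> \<partial>M)
      \<le> (\<integral>x. e * f x + ((\<phi> (f x) (a x) + \<phi> (f x) (b x)) / 2 - \<phi> (f x) (mid a b x)) / e \<partial>M)"
    proof (rule integral_mono_AE)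
      show "AE x in M. \<bar>\<phi> (f x) (a x) - \<phi> (f x) (b x)\<bar>
        \<le> e * f x + ((\<phi> (f x) (a x) + \<phi> (f x) (b x)) / 2 - \<phi> (f x) (mid a b x)) / e"
        using f'(2) a'(2) b'(2)
      proof eventually_elim
        case (elim x)
        have "mid a b x = (a x + b x) / 2" by (simp add: mid_def)
        then show ?case
          using reciprocal_midpoint_defect[OF elim e] by (simp only: \<phi>_def)
      qed
    qed (use i f' in auto)
    also have "\<dots> = e + defect f a b / e"
      using i f' by (simp add: defect_def R_def)
    finally show ?thesis .
  qed
  have defect_nonneg: "0 \<le> defect f a b"
    if "pos_density M f" "a \<in> closed_feasible M f eps" "b \<in> closed_feasible M f eps" for f a b eps
  proof (rule ccontr)
    assume neg: "\<not> 0 \<le> defect f a b"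
    \<comment> \<open>With this choice \<open>e + defect f a b / e = - e\<close>, a negative upper
      bound for the integral of an absolute value.\<close>
    define e where "e = sqrt (- defect f a b / 2)"
    have e: "e > 0" using neg by (simp add: e_def)
    have "e * e = - defect f a b / 2" using neg by (simp add: e_def)
    then have "defect f a b / e = - 2 * e" using e by (simp add: field_simps)
    moreover have "0 \<le> (\<integral>x. \<bar>\<phi> (f x) (a x) - \<phi> (f x) (b x)\<bar> \<partial>M)" by simp
    ultimately show False using defect[OF that e] e by simp
  qed
  define D where "D p = affinity M u (fst p) (snd p)" for p
  define J where "J p = R f0 (fst p) + R f1 (snd p)" for p
  define pmid where "pmid p q = (mid (fst p) (fst q), mid (snd p) (snd q))" for p q
  have "(f0, f1) \<in> C"
    using nominal_feasible f0 f1 eps0 eps1 by (auto simp: C_def feasible_iff)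
  then have "C \<noteq> {}" by blast
  moreover have "pmid p q \<in> C" if "p \<in> C" "q \<in> C" for p q
    using that mid_closed f0 f1 by (auto simp: C_def pmid_def)
  moreover have "D p \<le> 1" if "p \<in> C" for p
  proof -
    have p: "fst p \<in> closed_feasible M f0 eps0" "snd p \<in> closed_feasible M f1 eps1"
      using that by (auto simp: C_def)
    note p0 = closed_feasibleD[OF p(1)] and p1 = closed_feasibleD[OF p(2)]
    have "D p \<le> (\<integral>x. u * snd p x + (1 - u) * fst p x \<partial>M)"
      unfolding D_def affinity_def
    proof (rule integral_mono_AE)
      show "integrable M (\<lambda>x. snd p x powr u * fst p x powr (1 - u))"
        using p0 p1 u by (intro integrable_affinity) auto
      show "AE x in M. snd p x powr u * fst p x powr (1 - u) \<le> u * snd p x + (1 - u) * fst p x"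
        using p0(2) p1(2) by eventually_elim (use u in \<open>intro young_le; simp\<close>)
    qed (use p0 p1 in auto)
    then show ?thesis using p0 p1 by simp
  qed
  moreover have "0 \<le> J p \<and> J p \<le> 2" if "p \<in> C" for p
    using that R_bound[OF f0, of "fst p" eps0] R_bound[OF f1, of "snd p" eps1]
    by (auto simp: C_def J_def)
  moreover have "(D p + D q) / 2 \<le> D (pmid p q)" if "p \<in> C" "q \<in> C" for p q
  proof -
    have "1 / 2 * D p + 1 / 2 * D q \<le> D (pmid p q)"
      unfolding D_def pmid_def fst_conv snd_conv mid_def[abs_def]
      using that u by (intro integral_affinity_concave) (auto simp: C_def dest: closed_feasibleD)
    then show ?thesis by (simp add: field_simps)
  qed
  ultimately obtain X where X: "\<And>n. X n \<in> C" "\<And>n p. p \<in> C \<Longrightarrow> D p - 1 / real (Suc n) \<le> D (X n)"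
    and J: "\<And>e. 0 < e \<Longrightarrow> \<exists>N. \<forall>i\<ge>N. \<forall>j\<ge>N. (J (X i) + J (X j)) / 2 - J (pmid (X i) (X j)) < e"
    using near_optimal_sequence[of C pmid D 1 J 2] by blast
  define a b where "a n = fst (X n)" and "b n = snd (X n)" for n
  have a: "a n \<in> closed_feasible M f0 eps0" and b: "b n \<in> closed_feasible M f1 eps1" for n
    using X(1)[of n] by (auto simp: C_def a_def b_def)
  have J_eq: "(J (X i) + J (X j)) / 2 - J (pmid (X i) (X j))
      = defect f0 (a i) (a j) + defect f1 (b i) (b j)" for i j
    by (simp add: J_def pmid_def defect_def a_def b_def field_simps)
  have small: "\<exists>N. \<forall>i\<ge>N. \<forall>j\<ge>N. defect f0 (a i) (a j) < e \<and> defect f1 (b i) (b j) < e" if e: "0 < e" for e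
  proof -
    obtain N where "\<forall>i\<ge>N. \<forall>j\<ge>N. defect f0 (a i) (a j) + defect f1 (b i) (b j) < e"
      using J[OF e] unfolding J_eq by blast
    moreover have "0 \<le> defect f0 (a i) (a j)" "0 \<le> defect f1 (b i) (b j)" for i j
      using defect_nonneg f0 f1 a b by blast+
    ultimately show ?thesis by (smt (verit))
  qed
  have L1: "\<exists>N. \<forall>i\<ge>N. \<forall>j\<ge>N. (\<integral>x. norm (\<phi> (f x) (g i x) - \<phi> (f x) (g j x)) \<partial>M) < e"
    if f: "pos_density M f" and g: "\<And>n. g n \<in> closed_feasible M f eps"
      and small: "\<And>e. 0 < e \<Longrightarrow> \<exists>N. \<forall>i\<ge>N. \<forall>j\<ge>N. defect f (g i) (g j) < e" and e: "0 < e"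
    for f eps e and g :: "nat \<Rightarrow> 'a \<Rightarrow> real"
  proof -
    \<comment> \<open>The bound \<open>d + defect / d\<close> is below \<open>2 * d = e\<close> as
      soon as the defect is below \<open>d * d\<close>.\<close>
    define d where "d = e / 2"
    have d: "d > 0" using e by (simp add: d_def)
    obtain N where N: "\<forall>i\<ge>N. \<forall>j\<ge>N. defect f (g i) (g j) < d * d"
      using small[of "d * d"] d by auto
    have "(\<integral>x. norm (\<phi> (f x) (g i x) - \<phi> (f x) (g j x)) \<partial>M) < e" if "N \<le> i" "N \<le> j" for i j
    proof -
      have "defect f (g i) (g j) / d < d"
        using N that d by (simp add: pos_divide_less_eq)
      moreover have "(\<integral>x. norm (\<phi> (f x) (g i x) - \<phi> (f x) (g j x)) \<partial>M) \<le> d + defect f (g i) (g j) / d"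
        using defect[OF f g g d] by simp
      ultimately show ?thesis by (simp add: d_def)
    qed
    then show ?thesis by blast
  qed
  have "\<exists>N. \<forall>i\<ge>N. \<forall>j\<ge>N. defect f0 (a i) (a j) < e" if "0 < e" for e using small[OF that] by blast
  note L1a = L1[OF f0 a this]
  obtain r where r: "strict_mono r" "AE x in M. Cauchy (\<lambda>n. \<phi> (f0 x) (a (r n) x))"
    by (rule cauchy_L1_AE_cauchy_subseq[of M "\<lambda>n x. \<phi> (f0 x) (a n x)", OF \<phi>_int[OF f0 a] L1a])
  \<comment> \<open>The second extraction starts from \<open>r\<close>, so that both components
    converge along the same indices.\<close>
  have "\<exists>N. \<forall>i\<ge>N. \<forall>j\<ge>N. defect f1 (b (r i)) (b (r j)) < e" if e: "0 < e" for e
  proof -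
    obtain N where N: "\<forall>i\<ge>N. \<forall>j\<ge>N. defect f1 (b i) (b j) < e" using small[OF e] by blast
    have "N \<le> r i" if "N \<le> i" for i using seq_suble[OF r(1), of i] that by simp
    with N show ?thesis by blast
  qed
  note L1b = L1[OF f1 b this]
  obtain r' where r': "strict_mono r'" "AE x in M. Cauchy (\<lambda>n. \<phi> (f1 x) (b (r (r' n)) x))"
    by (rule cauchy_L1_AE_cauchy_subseq[of M "\<lambda>n x. \<phi> (f1 x) (b (r n) x)", OF \<phi>_int[OF f1 b] L1b])
  define k where "k n = r (r' n)" for n
  have k: "strict_mono k" using r r' by (simp add: k_def strict_mono_def)
  have "AE x in M. Cauchy (\<lambda>n. \<phi> (f0 x) (a (k n) x))"
    using r(2)
  proof eventually_elim
    case (elim x)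
    from Cauchy_subseq_Cauchy[OF this r'(1)] show ?case by (simp add: o_def k_def)
  qed
  then obtain g0 where [measurable]: "g0 \<in> borel_measurable M" and g0: "AE x in M. (\<lambda>n. a (k n) x) \<longlonglongrightarrow> g0 x"
    using AE_limit_if_reciprocal_Cauchy[OF f0 a, of k] unfolding \<phi>_def by blast
  have "AE x in M. Cauchy (\<lambda>n. \<phi> (f1 x) (b (k n) x))" using r'(2) by (simp add: k_def)
  then obtain g1 where [measurable]: "g1 \<in> borel_measurable M" and g1: "AE x in M. (\<lambda>n. b (k n) x) \<longlonglongrightarrow> g1 x"
    using AE_limit_if_reciprocal_Cauchy[OF f1 b, of k] unfolding \<phi>_def by blast
  have g0c: "g0 \<in> closed_feasible M f0 eps0"
    by (rule closed_feasible_AE_limit[OF f0 a g0]) measurable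
  have g1c: "g1 \<in> closed_feasible M f1 eps1"
    by (rule closed_feasible_AE_limit[OF f1 b g1]) measurable
  note a' = closed_feasibleD[OF a] and b' = closed_feasibleD[OF b]
    and g0' = closed_feasibleD[OF g0c] and g1' = closed_feasibleD[OF g1c]
  show ?thesis
  proof (rule that[OF g0c g1c])
    fix h0 h1 assume "h0 \<in> closed_feasible M f0 eps0" "h1 \<in> closed_feasible M f1 eps1"
    then have h: "(h0, h1) \<in> C" by (simp add: C_def)
    \<comment> \<open>The gap in Young's inequality is nonnegative with integral
      \<open>1 - affinity M u p0 p1\<close>. Fatou's lemma for this gap gives upper semicontinuity
      of the affinity, the direction needed for a maximum.\<close>
    define H where "H p0 p1 x = u * p1 x + (1 - u) * p0 x - p1 x powr u * p0 x powr (1 - u)"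
      for p0 p1 :: "'a \<Rightarrow> real" and x
    have H_int: "integrable M (H p0 p1)" "(\<integral>x. H p0 p1 x \<partial>M) = 1 - affinity M u p0 p1"
      "AE x in M. 0 \<le> H p0 p1 x"
      if "p0 \<in> closed_feasible M f0 eps0" "p1 \<in> closed_feasible M f1 eps1" for p0 p1
    proof -
      note p0 = closed_feasibleD[OF that(1)] and p1 = closed_feasibleD[OF that(2)]
      have i: "integrable M (\<lambda>x. p1 x powr u * p0 x powr (1 - u))"
        using p0 p1 u by (intro integrable_affinity) auto
      show "integrable M (H p0 p1)" unfolding H_def[abs_def] using i p0 p1 by auto
      show "(\<integral>x. H p0 p1 x \<partial>M) = 1 - affinity M u p0 p1"
        unfolding H_def affinity_def using i p0 p1 by simp
      show "AE x in M. 0 \<le> H p0 p1 x"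
        using p0(2) p1(2)
      proof eventually_elim
        case (elim x)
        then show ?case using young_le[of "p1 x" "p0 x" u] u by (simp add: H_def)
      qed
    qed
    have ab_nn: "AE x in M. \<forall>n. 0 \<le> a n x \<and> 0 \<le> b n x"
      using a'(2) b'(2) by (simp add: AE_all_countable)
    have lim: "AE x in M. (\<lambda>n. H (a (k n)) (b (k n)) x) \<longlonglongrightarrow> H g0 g1 x"
      using g0 g1 ab_nn
    proof eventually_elim
      case (elim x)
      have "(\<lambda>n. b (k n) x powr u) \<longlonglongrightarrow> g1 x powr u"
        using elim u by (intro tendsto_powr') (auto intro!: always_eventually)
      moreover have "(\<lambda>n. a (k n) x powr (1 - u)) \<longlonglongrightarrow> g0 x powr (1 - u)"
        using elim u by (intro tendsto_powr') (auto intro!: always_eventually)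
      ultimately show ?case unfolding H_def using elim
        by (intro tendsto_diff tendsto_add tendsto_mult tendsto_const)
    qed
    have bound: "(\<integral>x. H (a (k n)) (b (k n)) x \<partial>M) \<le> 1 - (affinity M u h0 h1 - 1 / real (Suc n))" for n
    proof -
      have "D (h0, h1) - 1 / real (Suc (k n)) \<le> D (X (k n))" by (rule X(2)[OF h])
      moreover have "1 / real (Suc (k n)) \<le> 1 / real (Suc n)"
        using seq_suble[OF k, of n] by (simp add: frac_le)
      ultimately have "affinity M u h0 h1 - 1 / real (Suc n) \<le> affinity M u (a (k n)) (b (k n))"
        by (simp add: D_def a_def b_def)
      then show ?thesis using H_int(2)[OF a b] by simp
    qed
    have c: "(\<lambda>n. 1 - (affinity M u h0 h1 - 1 / real (Suc n))) \<longlonglongrightarrow> 1 - (affinity M u h0 h1 - 0)"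
      by (intro tendsto_intros LIMSEQ_Suc[OF lim_1_over_n])
    have "(\<integral>x. H g0 g1 x \<partial>M) \<le> 1 - (affinity M u h0 h1 - 0)"
      by (rule integral_fatou(2)[OF H_int(1)[OF a b] H_int(3)[OF a b] lim _ bound c])
        (use H_int(1)[OF g0c g1c] in auto)
    then show "affinity M u h0 h1 \<le> affinity M u g0 g1"
      using H_int(2)[OF g0c g1c] by simp
  qed
qed

end

section \<open>Existence and the minimization over the exponent\<close>

lemma zero_set_mass_pos:
  fixes g p w :: "'a \<Rightarrow> real"
  assumes p: "pos_density M p" and [measurable]: "g \<in> borel_measurable M"
    and nn: "AE x in M. 0 \<le> g x" and zero: "\<not> (AE x in M. 0 < g x)"
    and w_def: "w = (\<lambda>x. if g x = 0 then p x else 0)"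
  shows "w \<in> borel_measurable M" "AE x in M. 0 \<le> w x" "integrable M w" "0 < (\<integral>x. w x \<partial>M)"
    "\<not> (AE x in M. w x = 0)"
proof -
  note p' = pos_densityD[OF p]
  note [measurable] = p'(1)
  show [measurable]: "w \<in> borel_measurable M" unfolding w_def by measurable
  show w_nn: "AE x in M. 0 \<le> w x" using p'(2) by eventually_elim (simp add: w_def)
  show i: "integrable M w"
  proof (rule Bochner_Integration.integrable_bound[OF p'(3)])
    show "AE x in M. norm (w x) \<le> norm (p x)" by (simp add: w_def)
  qed measurable
  show nz: "\<not> (AE x in M. w x = 0)"
  proof
    assume "AE x in M. w x = 0"
    then have "AE x in M. 0 < g x"
      using p'(2) nn by eventually_elim (auto simp: w_def split: if_splits)
    with zero show False by blast
  qed
  show "0 < (\<integral>x. w x \<partial>M)"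
    using nz integral_nonneg_AE[OF w_nn] integral_nonneg_eq_0_iff_AE[OF i w_nn] by linarith
qed

text \<open>Where \<open>g\<close> vanishes, the divergence has slope \<open>-\<infinity>\<close> in the direction of \<open>p\<close>: it contributes
  \<open>t * ln t\<close> times the \<open>p\<close>-mass of the zero set.\<close>

lemma eventually_feasible_toward:
  assumes f: "pos_density M f" and g: "g \<in> closed_feasible M f eps" and p: "pos_density M p"
    and kl: "integrable M (\<lambda>x. kl_term (p x) (f x))" and zero: "\<not> (AE x in M. 0 < g x)"
  shows "\<forall>\<^sub>F t in at_right 0. (\<lambda>x. (1 - t) * g x + t * p x) \<in> feasible M f eps"
proof -
  note f' = pos_densityD[OF f] and g' = closed_feasibleD[OF g] and p' = pos_densityD[OF p]
  note [measurable] = f'(1) g'(1) p'(1)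
  define w where "w = (\<lambda>x. if g x = 0 then p x else 0)"
  note w = zero_set_mass_pos[OF p g'(1,2) zero w_def]
  define c where "c = (\<integral>x. w x \<partial>M)"
  have c: "c > 0" using w by (simp add: c_def)
  define k where "k = (\<integral>x. kl_term (p x) (f x) \<partial>M) - (\<integral>x. kl_term (g x) (f x) \<partial>M)"
  \<comment> \<open>The divergence changes by at most \<open>t * (k + c * ln t)\<close>, where
    \<open>k\<close> is the difference of the divergences of \<open>p\<close> and \<open>g\<close>.
    The threshold \<open>exp (- k / c)\<close> is where the bracket changes sign.\<close>
  have "(\<lambda>x. (1 - t) * g x + t * p x) \<in> feasible M f eps"
    if t: "0 < t" "t < min 1 (exp (- k / c))" for t
  proof -
    let ?m = "\<lambda>x. (1 - t) * g x + t * p x"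
    let ?U = "\<lambda>x. (1 - t) * kl_term (g x) (f x) + t * kl_term (p x) (f x) + t * ln t * w x"
    have pos: "AE x in M. 0 < ?m x"
      using g'(2) p'(2) by eventually_elim (use t in \<open>simp add: add_nonneg_pos\<close>)
    then have nn: "AE x in M. 0 \<le> ?m x" by (auto elim: eventually_mono)
    have le: "AE x in M. kl_term (?m x) (f x) \<le> ?U x"
      using g'(2) p'(2) f'(2)
    proof eventually_elim
      case (elim x)
      show ?case
      proof (cases "g x = 0")
        case True
        then have "kl_term (?m x) (f x) = ?U x"
          using elim t by (simp add: w_def ln_mult ln_div algebra_simps)
        then show ?thesis by simp
      next
        case False
        then show ?thesis
          using kl_convex[of "g x" "p x" "f x" "1 - t" t] elim t by (simp add: w_def)
      qed
    qed
    have iU: "integrable M ?U"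
      using g' kl w by (intro Bochner_Integration.integrable_add integrable_mult_right) auto
    note K = integrable_kl_term[OF _ f'(1) _ f'(3) nn f'(2) iU le]
    have int: "integrable M (\<lambda>x. kl_term (?m x) (f x))" by (rule K(1)) (use g' p' in auto)
    have "(\<integral>x. kl_term (?m x) (f x) \<partial>M) \<le> (\<integral>x. ?U x \<partial>M)" by (rule K(2)) (use g' p' in auto)
    also have "\<dots> = (1 - t) * (\<integral>x. kl_term (g x) (f x) \<partial>M) + t * (\<integral>x. kl_term (p x) (f x) \<partial>M)
        + t * ln t * c"
      using g'(5) kl w(3) unfolding c_def
      by (subst Bochner_Integration.integral_add; (subst Bochner_Integration.integral_add)?)
        (auto simp only: integral_mult_right_zero intro!: Bochner_Integration.integrable_add integrable_mult_right)
    also have "\<dots> = (\<integral>x. kl_term (g x) (f x) \<partial>M) + t * (k + c * ln t)"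
      by (simp add: k_def algebra_simps)
    also have "\<dots> \<le> eps"
    proof -
      have "ln t < - k / c" using t by (metis exp_ln exp_less_cancel_iff min_less_iff_conj)
      then have "k + c * ln t \<le> 0" using c by (simp add: field_simps)
      then have "t * (k + c * ln t) \<le> 0" using t by (intro mult_nonneg_nonpos) auto
      then show ?thesis using g'(6) by simp
    qed
    finally show ?thesis
      using int pos nn g' p' by (simp add: feasible_iff closed_feasible_def)
  qed
  then show ?thesis
    using eventually_at_right_less[of 0]
    by (intro eventually_at_rightI[of 0 "min 1 (exp (- k / c))"]) auto
qed

text \<open>Moving weight \<open>t\<close> to \<open>p\<close> costs at most \<open>t * D\<close>,
  while the zero set of \<open>g\<close> contributes \<open>t powr (1 - u) * c\<close>, which is of
  larger order as \<open>t\<close> tends to 0. Positivity of \<open>q\<close> ensures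
  \<open>c > 0\<close>.\<close>

lemma affinity_improves_if_zero:
  assumes f: "pos_density M f" and g: "g \<in> closed_feasible M f eps" and p: "pos_density M p"
    and kl: "integrable M (\<lambda>x. kl_term (p x) (f x))" and zero: "\<not> (AE x in M. 0 < g x)"
    and q: "integrable M q" "AE x in M. 0 < q x" and u: "0 < u" "u < 1"
  shows "\<exists>h\<in>feasible M f eps. affinity M u g q < affinity M u h q"
proof -
  note g' = closed_feasibleD[OF g] and p' = pos_densityD[OF p]
  have [measurable]: "q \<in> borel_measurable M" using q by auto
  note [measurable] = g'(1) p'(1)
  have q_nn: "AE x in M. 0 \<le> q x" using q(2) by eventually_elim simp
  define w where "w = (\<lambda>x. if g x = 0 then p x else 0)"
  note w = zero_set_mass_pos[OF p g'(1,2) zero w_def]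
  define D where "D = affinity M u g q"
  define c where "c = affinity M u w q"
  have ig: "integrable M (\<lambda>x. q x powr u * g x powr (1 - u))"
    using g' q q_nn u by (intro integrable_affinity) auto
  have iw: "integrable M (\<lambda>x. q x powr u * w x powr (1 - u))"
    using w q q_nn u by (intro integrable_affinity) auto
  have "c \<noteq> 0"
  proof
    assume "c = 0"
    then have "AE x in M. q x powr u * w x powr (1 - u) = 0"
      unfolding c_def affinity_def using integral_nonneg_eq_0_iff_AE[OF iw] by simp
    then have "AE x in M. w x = 0" using q(2) by eventually_elim simp
    with w(5) show False by blast
  qed
  then have c: "c > 0" using affinity_nonneg[of M u w q] by (simp add: c_def)
  have "((\<lambda>t. t powr u * D) \<longlongrightarrow> 0 powr u * D) (at_right 0)"
    using u by (intro tendsto_intros tendsto_powr') (auto simp: eventually_at_right_less less_imp_le eventually_at_right_field intro!: exI[of _ 1])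
  then have ev1: "\<forall>\<^sub>F t in at_right 0. t powr u * D < c"
    using c by (intro order_tendstoD(2)) auto
  have ev2: "\<forall>\<^sub>F t in at_right (0::real). 0 < t \<and> t < 1"
    by (intro eventually_at_rightI[of 0 1]) auto
  from eventually_happens'[OF trivial_limit_at_right_real
      eventually_conj[OF ev1 eventually_conj[OF ev2 eventually_feasible_toward[OF f g p kl zero]]]]
  obtain t where t: "t powr u * D < c" "0 < t" "t < 1"
    and m: "(\<lambda>x. (1 - t) * g x + t * p x) \<in> feasible M f eps" by blast
  let ?m = "\<lambda>x. (1 - t) * g x + t * p x"
  note m' = feasibleD[OF m]
  have "t * D = t powr (1 - u) * (t powr u * D)"
    using t by (simp add: powr_add[symmetric] mult.assoc[symmetric])
  also have "\<dots> < t powr (1 - u) * c" using t by (intro mult_strict_left_mono) auto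
  finally have "D < (1 - t) * D + t powr (1 - u) * c" by (simp add: algebra_simps)
  also have "\<dots> = (\<integral>x. (1 - t) * (q x powr u * g x powr (1 - u))
      + t powr (1 - u) * (q x powr u * w x powr (1 - u)) \<partial>M)"
    using ig iw by (simp add: D_def c_def affinity_def)
  also have "\<dots> \<le> affinity M u ?m q"
    unfolding affinity_def
  proof (rule integral_mono_AE)
    show "integrable M (\<lambda>x. q x powr u * ?m x powr (1 - u))"
      using m' q q_nn u by (intro integrable_affinity) auto
    show "AE x in M. (1 - t) * (q x powr u * g x powr (1 - u))
      + t powr (1 - u) * (q x powr u * w x powr (1 - u)) \<le> q x powr u * ?m x powr (1 - u)"
      using g'(2) p'(2)
    proof eventually_elim
      case (elim x)
      have "(1 - t) * g x powr (1 - u) + t powr (1 - u) * w x powr (1 - u) \<le> ?m x powr (1 - u)"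
      proof (cases "g x = 0")
        case True
        then show ?thesis using elim t u by (simp add: w_def powr_mult)
      next
        case False
        have "(1 - t) powr 1 \<le> (1 - t) powr (1 - u)" using t u by (intro powr_mono') auto
        then have "(1 - t) * g x powr (1 - u) \<le> (1 - t) powr (1 - u) * g x powr (1 - u)"
          using t by (intro mult_right_mono) auto
        also have "\<dots> = ((1 - t) * g x) powr (1 - u)" using elim t by (simp add: powr_mult)
        also have "\<dots> \<le> ?m x powr (1 - u)" using elim t u by (intro powr_mono2) auto
        finally show ?thesis using False by (simp add: w_def)
      qed
      then have "q x powr u * ((1 - t) * g x powr (1 - u) + t powr (1 - u) * w x powr (1 - u))
          \<le> q x powr u * ?m x powr (1 - u)" by (intro mult_left_mono) auto
      then show ?case by (simp add: algebra_simps)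
    qed
  qed (use ig iw in auto)
  finally show ?thesis using m by (auto simp: D_def)
qed

context disjoint_pair
begin

lemma not_AE_eq:
  assumes g0: "g0 \<in> feasible M f0 eps0" and g1: "g1 \<in> feasible M f1 eps1"
  shows "\<not> (AE x in M. g1 x = g0 x)"
proof
  assume "AE x in M. g1 x = g0 x"
  then have "AE x in M. g1 x / g0 x = 1"
    using feasibleD(2)[OF g0] by eventually_elim simp
  with ratio_not_const(1)[OF g0 g1] show False by blast
qed

lemma affinity_less_1:
  assumes g0: "g0 \<in> feasible M f0 eps0" and g1: "g1 \<in> feasible M f1 eps1" and u: "0 < u" "u < 1"
  shows "affinity M u g0 g1 < 1"
proof (rule ccontr)
  assume ge: "\<not> affinity M u g0 g1 < 1"
  note g0' = feasibleD[OF g0] and g1' = feasibleD[OF g1]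
  define H where "H x = u * g1 x + (1 - u) * g0 x - g1 x powr u * g0 x powr (1 - u)" for x
  have i: "integrable M (\<lambda>x. g1 x powr u * g0 x powr (1 - u))"
    using g0' g1' u by (intro integrable_affinity) auto
  have iH: "integrable M H" unfolding H_def[abs_def] using i g0' g1' by auto
  have nn: "AE x in M. 0 \<le> H x"
    using g0'(3) g1'(3)
  proof eventually_elim
    case (elim x)
    then show ?case using young_le[of "g1 x" "g0 x" u] u by (simp add: H_def)
  qed
  have "(\<integral>x. H x \<partial>M) = 1 - affinity M u g0 g1"
    unfolding H_def affinity_def using i g0' g1' by simp
  then have "(\<integral>x. H x \<partial>M) = 0" using ge integral_nonneg_AE[OF nn] by simp
  then have "AE x in M. H x = 0" using integral_nonneg_eq_0_iff_AE[OF iH nn] by simp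
  then have "AE x in M. g1 x = g0 x"
    using g0'(2) g1'(2)
  proof eventually_elim
    case (elim x)
    then show ?case using young_eq[of "g1 x" "g0 x" u] u by (simp add: H_def)
  qed
  with not_AE_eq[OF g0 g1] show False by blast
qed

lemma least_favorable_exists:
  assumes u: "u \<in> {0<..<1}"
  shows "\<exists>g0 g1. least_favorable M f0 f1 eps0 eps1 u g0 g1"
proof -
  have u': "0 < u" "u < 1" using u by auto
  obtain g0 g1 where g0: "g0 \<in> closed_feasible M f0 eps0" and g1: "g1 \<in> closed_feasible M f1 eps1"
    and max: "\<And>h0 h1. h0 \<in> closed_feasible M f0 eps0 \<Longrightarrow> h1 \<in> closed_feasible M f1 eps1 \<Longrightarrow>
      affinity M u h0 h1 \<le> affinity M u g0 g1"
    using closed_maximizer_exists[OF u'] by blast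
  obtain p where p: "pos_density M p" "integrable M (\<lambda>x. kl_term (p x) (f0 x))"
    "integrable M (\<lambda>x. kl_term (p x) (f1 x))"
    using common_density[OF f0 f1] .
  note g0' = closed_feasibleD[OF g0] and g1' = closed_feasibleD[OF g1] and p' = pos_densityD[OF p(1)]
  \<comment> \<open>\<open>affinity_improves_if_zero\<close> requires a positive partner, so
    simultaneous zeros are treated separately. Both components move toward the same
    \<open>p\<close>, whose affinity with itself is 1; by concavity and maximality the new feasible
    pair would have affinity at least 1.\<close>
  have "(AE x in M. 0 < g0 x) \<or> (AE x in M. 0 < g1 x)"
  proof (rule ccontr)
    assume "\<not> ?thesis"
    then have zero: "\<not> (AE x in M. 0 < g0 x)" "\<not> (AE x in M. 0 < g1 x)" by auto
    have "\<forall>\<^sub>F t in at_right (0::real). 0 < t \<and> t < 1"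
      by (intro eventually_at_rightI[of 0 1]) auto
    from eventually_happens'[OF trivial_limit_at_right_real eventually_conj[OF this eventually_conj[OF
        eventually_feasible_toward[OF f0 g0 p(1,2) zero(1)]
        eventually_feasible_toward[OF f1 g1 p(1,3) zero(2)]]]]
    obtain t where t: "0 < t" "t < 1"
      and m: "(\<lambda>x. (1 - t) * g0 x + t * p x) \<in> feasible M f0 eps0"
        "(\<lambda>x. (1 - t) * g1 x + t * p x) \<in> feasible M f1 eps1" by blast
    let ?D = "affinity M u (\<lambda>x. (1 - t) * g0 x + t * p x) (\<lambda>x. (1 - t) * g1 x + t * p x)"
    have "affinity M u p p = (\<integral>x. p x \<partial>M)"
      unfolding affinity_def
    proof (rule integral_cong_AE)
      show "AE x in M. p x powr u * p x powr (1 - u) = p x"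
        using p'(2) by eventually_elim (simp add: powr_add[symmetric])
    qed (use p' in measurable)
    then have "(1 - t) * affinity M u g0 g1 + t * 1 = (1 - t) * affinity M u g0 g1 + t * affinity M u p p"
      using p' by simp
    also have "\<dots> \<le> ?D"
    proof -
      have "AE x in M. 0 \<le> p x" using p'(2) by eventually_elim simp
      then show ?thesis using g0' g1' p' u' t by (intro integral_affinity_concave) auto
    qed
    finally have 1: "(1 - t) * affinity M u g0 g1 + t \<le> ?D" by simp
    have "?D \<le> affinity M u g0 g1" using m by (intro max) (auto simp: feasible_iff)
    then have "(1 - t) * ?D \<le> (1 - t) * affinity M u g0 g1" using t by (intro mult_left_mono) auto
    with 1 have "t * 1 \<le> t * ?D" by (simp add: algebra_simps)
    then have "1 \<le> ?D" using t by simp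
    with affinity_less_1[OF m u'] show False by simp
  qed
  moreover have "AE x in M. 0 < g0 x" if pos: "AE x in M. 0 < g1 x"
  proof (rule ccontr)
    assume "\<not> (AE x in M. 0 < g0 x)"
    from affinity_improves_if_zero[OF f0 g0 p(1,2) this g1'(3) pos u']
    obtain h where "h \<in> feasible M f0 eps0" "affinity M u g0 g1 < affinity M u h g1" by blast
    with max[of h g1] g1 show False by (simp add: feasible_iff)
  qed
  moreover have "AE x in M. 0 < g1 x" if pos: "AE x in M. 0 < g0 x"
  proof (rule ccontr)
    assume "\<not> (AE x in M. 0 < g1 x)"
    from affinity_improves_if_zero[OF f1 g1 p(1,3) this g0'(3) pos, of "1 - u"] u'
    obtain h where "h \<in> feasible M f1 eps1" "affinity M (1 - u) g1 g0 < affinity M (1 - u) h g0"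
      by auto
    with max[of g0 h] g0 show False by (simp add: feasible_iff affinity_swap[of M u g0])
  qed
  ultimately have "AE x in M. 0 < g0 x" "AE x in M. 0 < g1 x" by blast+
  with g0 g1 have "g0 \<in> feasible M f0 eps0" "g1 \<in> feasible M f1 eps1"
    by (simp_all add: feasible_iff)
  then have "least_favorable M f0 f1 eps0 eps1 u g0 g1"
    by (rule least_favorableI) (auto intro!: max simp: feasible_iff)
  then show ?thesis by blast
qed

end

section \<open>Dependence of the affinity on the exponent\<close>

lemma powr_interpolate:
  fixes x y v w s :: real
  assumes "0 < x" "0 < y"
  shows "(x powr v * y powr (1 - v)) powr s * (x powr w * y powr (1 - w)) powr (1 - s)
    = x powr (s * v + (1 - s) * w) * y powr (1 - (s * v + (1 - s) * w))"
proof -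
  have "(x powr v * y powr (1 - v)) powr s * (x powr w * y powr (1 - w)) powr (1 - s)
    = x powr (v * s + w * (1 - s)) * y powr ((1 - v) * s + (1 - w) * (1 - s))"
    using assms by (simp add: powr_mult powr_powr powr_add)
  moreover have "v * s + w * (1 - s) = s * v + (1 - s) * w"
    "(1 - v) * s + (1 - w) * (1 - s) = 1 - (s * v + (1 - s) * w)"
    by (simp_all add: algebra_simps)
  ultimately show ?thesis by simp
qed

text \<open>Pointwise the integrand is log-linear in the exponent, so Young's inequality with
  weights \<open>s\<close> and \<open>1 - s\<close> gives convexity. Equality makes
  \<open>(g1 / g0) powr v\<close> and \<open>(g1 / g0) powr w\<close> agree, which for
  \<open>v \<noteq> w\<close> forces ratio 1.\<close>

lemma affinity_convex_in_exponent:
  assumes g0: "integrable M g0" "AE x in M. 0 < g0 x" and g1: "integrable M g1" "AE x in M. 0 < g1 x"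
    and v: "v \<in> {0<..<1}" and w: "w \<in> {0<..<1}" and s: "0 < s" "s < 1"
  shows "affinity M (s * v + (1 - s) * w) g0 g1 \<le> s * affinity M v g0 g1 + (1 - s) * affinity M w g0 g1"
    and "affinity M (s * v + (1 - s) * w) g0 g1 = s * affinity M v g0 g1 + (1 - s) * affinity M w g0 g1
      \<Longrightarrow> v \<noteq> w \<Longrightarrow> AE x in M. g1 x = g0 x"
proof -
  have nn: "AE x in M. 0 \<le> g0 x" "AE x in M. 0 \<le> g1 x"
    using g0(2) g1(2) by (eventually_elim, simp)+
  define A where "A v x = g1 x powr v * g0 x powr (1 - v)" for v x
  have A_aff: "(\<integral>x. A v x \<partial>M) = affinity M v g0 g1" for v by (simp add: A_def affinity_def)
  have A_int: "integrable M (A v)" if "v \<in> {0<..<1}" for v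
    unfolding A_def[abs_def] using g0 g1 nn that by (intro integrable_affinity) auto
  define z where "z = s * v + (1 - s) * w"
  have z: "z \<in> {0<..<1}"
  proof -
    have "0 < z" unfolding z_def using v w s by (intro add_pos_pos) auto
    moreover have "s * v < s * 1" "(1 - s) * w < (1 - s) * 1"
      using v w s by (auto simp del: mult_1_right intro!: mult_strict_left_mono)
    then have "z < 1" by (simp add: z_def)
    ultimately show ?thesis by simp
  qed
  define H where "H x = s * A v x + (1 - s) * A w x - A z x" for x
  have interp: "A v x powr s * A w x powr (1 - s) = A z x" if "0 < g0 x" "0 < g1 x" for x
    using that by (simp add: A_def z_def powr_interpolate)
  have iH: "integrable M H" unfolding H_def[abs_def] using A_int v w z by auto
  have H: "(\<integral>x. H x \<partial>M) = s * affinity M v g0 g1 + (1 - s) * affinity M w g0 g1 - affinity M z g0 g1"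
    unfolding H_def using A_int[OF v] A_int[OF w] A_int[OF z] by (simp add: A_aff)
  have H_nn: "AE x in M. 0 \<le> H x"
    using g0(2) g1(2)
  proof eventually_elim
    case (elim x)
    have "0 \<le> A v x" "0 \<le> A w x" by (simp_all add: A_def)
    from young_le[OF this s] interp elim show ?case by (simp add: H_def)
  qed
  show "affinity M (s * v + (1 - s) * w) g0 g1 \<le> s * affinity M v g0 g1 + (1 - s) * affinity M w g0 g1"
    using integral_nonneg_AE[OF H_nn] unfolding H z_def by simp
  assume "affinity M (s * v + (1 - s) * w) g0 g1 = s * affinity M v g0 g1 + (1 - s) * affinity M w g0 g1"
    and "v \<noteq> w"
  then have "(\<integral>x. H x \<partial>M) = 0" unfolding H z_def by simp
  then have "AE x in M. H x = 0" using integral_nonneg_eq_0_iff_AE[OF iH H_nn] by simp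
  then show "AE x in M. g1 x = g0 x"
    using g0(2) g1(2)
  proof eventually_elim
    case (elim x)
    have "0 < A v x" "0 < A w x" using elim by (simp_all add: A_def)
    from young_eq[OF this s] interp elim have "A v x = A w x" by (simp add: H_def)
    moreover have "A e x = g0 x * (g1 x / g0 x) powr e" for e
      using elim by (simp add: A_def powr_divide powr_diff)
    ultimately have "(g1 x / g0 x) powr v = (g1 x / g0 x) powr w" using elim by simp
    then have "g1 x / g0 x = 1" using powr_inj[of "g1 x / g0 x" v w] elim \<open>v \<noteq> w\<close> by auto
    then show ?case using elim by simp
  qed
qed

text \<open>The exponents \<open>1 / (n + 2)\<close> stay strictly inside the unit interval from
  \<open>n = 0\<close> on. The end 1 is reached by exchanging the two densities.\<close>

lemma affinity_tendsto_1:
  assumes f0: "pos_density M f0" and f1: "pos_density M f1"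
  shows "(\<lambda>n. affinity M (1 / real (Suc (Suc n))) f0 f1) \<longlonglongrightarrow> 1"
proof -
  note f0' = pos_densityD[OF f0] and f1' = pos_densityD[OF f1]
  note [measurable] = f0'(1) f1'(1)
  define v where "v n = 1 / real (Suc (Suc n))" for n
  have v: "0 < v n" "v n < 1" for n by (simp_all add: v_def)
  have v_lim: "v \<longlonglongrightarrow> 0"
    unfolding v_def by (intro LIMSEQ_Suc[OF LIMSEQ_Suc[OF lim_1_over_n]])
  have "(\<lambda>n. \<integral>x. f1 x powr v n * f0 x powr (1 - v n) \<partial>M) \<longlonglongrightarrow> (\<integral>x. f0 x \<partial>M)"
  proof (rule integral_dominated_convergence[where w = "\<lambda>x. f1 x + f0 x"])
    show "AE x in M. (\<lambda>n. f1 x powr v n * f0 x powr (1 - v n)) \<longlonglongrightarrow> f0 x"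
      using f0'(2) f1'(2)
    proof eventually_elim
      case (elim x)
      have "(\<lambda>n. f1 x powr v n * f0 x powr (1 - v n)) \<longlonglongrightarrow> f1 x powr 0 * f0 x powr (1 - 0)"
        using elim by (intro tendsto_intros v_lim) auto
      then show ?case using elim by simp
    qed
    show "AE x in M. norm (f1 x powr v n * f0 x powr (1 - v n)) \<le> f1 x + f0 x" for n
      using f0'(2) f1'(2)
    proof eventually_elim
      case (elim x)
      have "f1 x powr v n * f0 x powr (1 - v n) \<le> v n * f1 x + (1 - v n) * f0 x"
        using elim v[of n] by (intro young_le) auto
      also have "\<dots> \<le> 1 * f1 x + 1 * f0 x"
        using elim v[of n] by (intro add_mono mult_right_mono) auto
      finally show ?case by simp
    qed
  qed (use f0' f1' in auto)
  then show ?thesis using f0' by (simp add: affinity_def v_def)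
qed

text \<open>A convex function that is larger at \<open>v1\<close> and at \<open>v2\<close> than at
  \<open>c\<close> between them cannot drop below these values further out. So the minimum over the
  compact interval \<open>{v1..v2}\<close>, where continuity is available, is a minimum over the
  open one.\<close>

lemma convex_on_min_exists:
  fixes W :: "real \<Rightarrow> real"
  assumes conv: "convex_on {0<..<1} W" and vs: "0 < v1" "v1 < c" "c < v2" "v2 < 1"
    and above: "W c < W v1" "W c < W v2"
  obtains m where "m \<in> {0<..<1}" "\<And>v. v \<in> {0<..<1} \<Longrightarrow> W m \<le> W v"
proof -
  have three: "W z \<le> W v" if "v \<in> {0<..<1}" "0 < t" "t < 1" "z = v + t * (c - v)" "W c < W z" for v t z
  proof -
    have z: "z = (1 - t) * v + t * c" using that(4) by (simp add: algebra_simps)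
    have "W z \<le> (1 - t) * W v + t * W c"
      using convex_onD[OF conv, of t v c] that(1-3) vs unfolding z by simp
    also have "\<dots> \<le> (1 - t) * W v + t * W z" using that by (intro add_left_mono mult_left_mono) auto
    finally have "(1 - t) * W z \<le> (1 - t) * W v" by (simp add: algebra_simps)
    then show ?thesis using that by simp
  qed
  have "continuous_on {v1..v2} W"
    using convex_on_continuous[OF _ conv] vs by (rule_tac continuous_on_subset) auto
  moreover have "compact {v1..v2}" "{v1..v2} \<noteq> {}" using vs by auto
  ultimately obtain m where m: "m \<in> {v1..v2}" "\<forall>y\<in>{v1..v2}. W m \<le> W y"
    using continuous_attains_inf by metis
  show ?thesis
  proof (rule that)
    show "m \<in> {0<..<1}" using m vs by auto
    fix v :: real assume v: "v \<in> {0<..<1}"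
    consider "v < v1" | "v \<in> {v1..v2}" | "v2 < v" by fastforce
    then show "W m \<le> W v"
    proof cases
      case 1
      have "W v1 \<le> W v"
        by (rule three[OF v, of "(v1 - v) / (c - v)"]) (use 1 vs above in \<open>simp_all add: field_simps\<close>)
      moreover have "W m \<le> W v1" using m vs by auto
      ultimately show ?thesis by simp
    next
      case 2
      then show ?thesis using m by blast
    next
      case 3
      have "W v2 \<le> W v"
        by (rule three[OF v, of "(v2 - v) / (c - v)"]) (use 3 vs above in \<open>simp_all add: field_simps\<close>)
      moreover have "W m \<le> W v2" using m vs by auto
      ultimately show ?thesis by simp
    qed
  qed
qed

context disjoint_pair
begin

lemma maxmin_unique_solution:
  "\<exists>g0 g1 u. solves_maxmin M f0 f1 eps0 eps1 g0 g1 u \<and>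
      (\<forall>g0' g1' u'. solves_maxmin M f0 f1 eps0 eps1 g0' g1' u' \<longrightarrow>
         u' = u \<and> (\<forall>v\<in>{0<..<1}. (AE x in M. g0' v x = g0 v x) \<and> (AE x in M. g1' v x = g1 v x)))"
proof -
  obtain g0 g1 where lf: "\<And>v. v \<in> {0<..<1} \<Longrightarrow> least_favorable M f0 f1 eps0 eps1 v (g0 v) (g1 v)"
    using least_favorable_exists by metis
  define W where "W v = affinity M v (g0 v) (g1 v)" for v
  have feas: "g0 v \<in> feasible M f0 eps0" "g1 v \<in> feasible M f1 eps1" if "v \<in> {0<..<1}" for v
    using least_favorable_feasible[OF lf[OF that]] by auto
  have W_ge: "affinity M v h0 h1 \<le> W v"
    if "v \<in> {0<..<1}" "h0 \<in> feasible M f0 eps0" "h1 \<in> feasible M f1 eps1" for v h0 h1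
    unfolding W_def using least_favorable_joint_maximum[OF that(1) lf[OF that(1)] that(2,3)] .
  have W_less: "W v < 1" if "v \<in> {0<..<1}" for v
    unfolding W_def using affinity_less_1[OF feas[OF that]] that by simp
  have comb: "s * v + (1 - s) * w \<in> {0<..<1}" if "v \<in> {0<..<1}" "w \<in> {0<..<1}" "0 < s" "s < 1" for v w s :: real
  proof -
    have "0 < s * v" "0 < (1 - s) * w" "s * v < s * 1" "(1 - s) * w < (1 - s) * 1"
      using that by (auto simp del: mult_1_right intro!: mult_strict_left_mono)
    then show ?thesis by simp
  qed
  \<comment> \<open>\<open>W\<close> is the pointwise maximum, over feasible pairs, of functions
    that are convex in the exponent. The second claim is stated for one fixed pair, since strict
    convexity of a maximum requires a pair attaining it at the intermediate exponent.\<close>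
  have aff_conv: "affinity M (s * v + (1 - s) * w) h0 h1 \<le> s * W v + (1 - s) * W w"
    "affinity M (s * v + (1 - s) * w) h0 h1 = s * W v + (1 - s) * W w \<Longrightarrow> v = w"
    if v: "v \<in> {0<..<1}" and w: "w \<in> {0<..<1}" and s: "0 < s" "s < 1"
      and h: "h0 \<in> feasible M f0 eps0" "h1 \<in> feasible M f1 eps1" for v w s h0 h1
  proof -
    note c = affinity_convex_in_exponent[OF feasibleD(4,2)[OF h(1)] feasibleD(4,2)[OF h(2)] v w s]
    have le: "s * affinity M v h0 h1 + (1 - s) * affinity M w h0 h1 \<le> s * W v + (1 - s) * W w"
      using W_ge[OF v h] W_ge[OF w h] s by (intro add_mono mult_left_mono) auto
    with c(1) show "affinity M (s * v + (1 - s) * w) h0 h1 \<le> s * W v + (1 - s) * W w" by simp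
    assume "affinity M (s * v + (1 - s) * w) h0 h1 = s * W v + (1 - s) * W w"
    with c(1) le have
      "affinity M (s * v + (1 - s) * w) h0 h1 = s * affinity M v h0 h1 + (1 - s) * affinity M w h0 h1"
      by simp
    from c(2)[OF this] not_AE_eq[OF h] show "v = w" by blast
  qed
  have W_conv: "convex_on {0<..<1} W"
  proof (rule convex_onI)
    fix t v w :: real assume t: "0 < t" "t < 1" and v: "v \<in> {0<..<1}" and w: "w \<in> {0<..<1}"
    have "W (t * w + (1 - t) * v) \<le> t * W w + (1 - t) * W v"
      unfolding W_def[of "t * w + (1 - t) * v"]
      by (rule aff_conv(1)[OF w v t feas[OF comb[OF w v t]]])
    then show "W ((1 - t) *\<^sub>R v + t *\<^sub>R w) \<le> (1 - t) * W v + t * W w"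
      by (simp add: add.commute)
  qed simp
  note n0 = nominal_feasible[OF f0 eps0] and n1 = nominal_feasible[OF f1 eps1]
  have half: "(1 / 2 :: real) \<in> {0<..<1}" by simp
  \<comment> \<open>The nominal pair is feasible, so \<open>W\<close> is bounded below by its
    affinity, which tends to 1 at either end while \<open>W (1 / 2) < 1\<close>.\<close>
  have ev: "\<forall>\<^sub>F n in sequentially. W (1 / 2) < affinity M (1 / real (Suc (Suc n))) f0 f1"
    "\<forall>\<^sub>F n in sequentially. W (1 / 2) < affinity M (1 / real (Suc (Suc n))) f1 f0"
    using affinity_tendsto_1[OF f0 f1] affinity_tendsto_1[OF f1 f0] W_less[OF half]
    by (auto intro: order_tendstoD(1))
  obtain n where n: "W (1 / 2) < affinity M (1 / real (Suc (Suc n))) f0 f1"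
    "W (1 / 2) < affinity M (1 / real (Suc (Suc n))) f1 f0"
    using eventually_happens'[OF sequentially_bot eventually_conj[OF ev]] by blast
  define v where "v = 1 / real (Suc (Suc n))"
  have v: "v \<in> {0<..<1}" "1 - v \<in> {0<..<1}" "v \<le> 1 / 2" by (auto simp: v_def field_simps)
  have Wv: "W (1 / 2) < W v" using n(1) W_ge[OF v(1) n0 n1] by (simp add: v_def)
  have Wv': "W (1 / 2) < W (1 - v)"
    using n(2) W_ge[OF v(2) n0 n1] affinity_swap[of M "1 - v" f0 f1] by (simp add: v_def)
  have "v \<noteq> 1 / 2" using Wv by (metis less_irrefl)
  then have "v < 1 / 2" using v by simp
  with v obtain u where u: "u \<in> {0<..<1}" "\<And>w. w \<in> {0<..<1} \<Longrightarrow> W u \<le> W w"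
    using convex_on_min_exists[OF W_conv, of v "1 / 2" "1 - v"] Wv Wv' by auto
  have "solves_maxmin M f0 f1 eps0 eps1 g0 g1 u"
    using lf u unfolding solves_maxmin_def is_arg_min_def W_def[symmetric] by (meson not_less)
  moreover have "u' = u \<and> (\<forall>v\<in>{0<..<1}. (AE x in M. g0' v x = g0 v x) \<and> (AE x in M. g1' v x = g1 v x))"
    if sol: "solves_maxmin M f0 f1 eps0 eps1 g0' g1' u'" for g0' g1' u'
  proof -
    have lf': "least_favorable M f0 f1 eps0 eps1 v (g0' v) (g1' v)" if "v \<in> {0<..<1}" for v
      using sol that by (simp add: solves_maxmin_def)
    \<comment> \<open>Least favorable pairs are joint maxima, so every solution has the same value
      function \<open>W\<close>.\<close>
    have W': "affinity M v (g0' v) (g1' v) = W v" if "v \<in> {0<..<1}" for v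
      using least_favorable_joint_maximum[OF that lf'[OF that] feas[OF that]]
        W_ge[OF that least_favorable_feasible[OF lf'[OF that]]] by (simp add: W_def)
    have u': "u' \<in> {0<..<1}" "\<not> (\<exists>w\<in>{0<..<1}. affinity M w (g0' w) (g1' w) < affinity M u' (g0' u') (g1' u'))"
      using sol by (auto simp: solves_maxmin_def is_arg_min_def)
    have "\<not> affinity M u (g0' u) (g1' u) < affinity M u' (g0' u') (g1' u')"
      using u'(2) u(1) by blast
    then have "\<not> W u < W u'" unfolding W'[OF u(1)] W'[OF u'(1)] .
    with u(2)[OF u'(1)] have eq: "W u' = W u" by simp
    \<comment> \<open>At the midpoint of two minimizers convexity holds with equality, attained by
      the pair that is least favorable there; strict convexity along this pair gives
      \<open>u' = u\<close>.\<close>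
    define w where "w = 1 / 2 * u' + (1 - 1 / 2) * u"
    have w: "w \<in> {0<..<1}" unfolding w_def by (rule comb[OF u'(1) u(1)]) auto
    have "affinity M (1 / 2 * u' + (1 - 1 / 2) * u) (g0 w) (g1 w) \<le> 1 / 2 * W u' + (1 - 1 / 2) * W u"
      by (rule aff_conv(1)[OF u'(1) u(1) _ _ feas[OF w]]) auto
    then have "W w \<le> 1 / 2 * W u' + (1 - 1 / 2) * W u"
      unfolding w_def[symmetric] W_def[of w] .
    with eq u(2)[OF w] have "W w = 1 / 2 * W u' + (1 - 1 / 2) * W u" by simp
    then have "affinity M (1 / 2 * u' + (1 - 1 / 2) * u) (g0 w) (g1 w) = 1 / 2 * W u' + (1 - 1 / 2) * W u"
      by (simp only: W_def w_def)
    then have "u' = u" by (rule aff_conv(2)[OF u'(1) u(1) _ _ feas[OF w], rotated 2]) auto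
    then show ?thesis using least_favorable_unique[OF _ lf' lf] by blast
  qed
  ultimately show ?thesis by blast
qed

end

theorem mainTheorem2:
  fixes M :: "'a measure" and f0 f1 :: "'a \<Rightarrow> real" and eps0 eps1 :: real
  assumes "pos_density M f0" and "pos_density M f1"
    and "0 < eps0" and "0 < eps1"
    and "feasible M f0 eps0 \<inter> feasible M f1 eps1 = {}"
  shows
    "(\<exists>g0 g1 u. solves_maxmin M f0 f1 eps0 eps1 g0 g1 u \<and>
        (\<forall>g0' g1' u'. solves_maxmin M f0 f1 eps0 eps1 g0' g1' u' \<longrightarrow>
           u' = u \<and> (\<forall>v\<in>{0<..<1}. (AE x in M. g0' v x = g0 v x) \<and> (AE x in M. g1' v x = g1 v x))))
   \<and> (\<forall>u\<in>{0<..<1}. \<forall>g0 g1.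
        least_favorable M f0 f1 eps0 eps1 u g0 g1 \<longrightarrow>
        (\<exists>!(p :: (real \<times> real) \<times> real \<times> real). case p of ((lam0, lam1), mu0, mu1) \<Rightarrow>
           least_favorable_KKT M f0 f1 eps0 eps1 u g0 g1 lam0 lam1 mu0 mu1))
   \<and> (\<forall>u\<in>{0<..<1}. \<forall>g0 g1 lam0 lam1 mu0 mu1.
        least_favorable_KKT M f0 f1 eps0 eps1 u g0 g1 lam0 lam1 mu0 mu1 \<longleftrightarrow>
        0 < lam0 \<and> 0 < lam1 \<and> pos_density M g0 \<and> pos_density M g1 \<and>
        KL_div M g0 f0 = ereal eps0 \<and> KL_div M g1 f1 = ereal eps1 \<and>
        (AE x in M. g0 x = exp ((- lam0 - mu0) / lam0)
           * exp ((1 - u) * (g1 x / g0 x) powr u / lam0) * f0 x) \<and>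
        (AE x in M. g1 x = exp ((- lam1 - mu1) / lam1)
           * exp (u * (g1 x / g0 x) powr (-1 + u) / lam1) * f1 x) \<and>
        (AE x in M. g1 x / g0 x = exp (- mu1 / lam1 + mu0 / lam0)
           * exp (u * (g1 x / g0 x) powr (-1 + u) / lam1 + (-1 + u) * (g1 x / g0 x) powr u / lam0)
           * (f1 x / f0 x)))
   \<and> (\<forall>u\<in>{0<..<1}. \<forall>g0 g1 lam0 lam1 mu0 mu1.
        least_favorable_KKT M f0 f1 eps0 eps1 u g0 g1 lam0 lam1 mu0 mu1 \<longrightarrow>
        parameter_system M f0 f1 eps0 eps1 u lam0 lam1 (\<lambda>x. g1 x / g0 x) \<and>
        s0 M f0 u lam0 (\<lambda>x. g1 x / g0 x) = exp ((lam0 + mu0) / lam0) \<and>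
        s1 M f1 u lam1 (\<lambda>x. g1 x / g0 x) = exp ((lam1 + mu1) / lam1))
   \<and> (\<forall>u\<in>{0<..<1}. \<forall>lam0>0. \<forall>lam1>0. \<forall>L\<in>borel_measurable M.
        (AE x in M. 0 < L x) \<and> parameter_system M f0 f1 eps0 eps1 u lam0 lam1 L \<longrightarrow>
        (\<exists>mu0 mu1.
           s0 M f0 u lam0 L = exp ((lam0 + mu0) / lam0) \<and>
           s1 M f1 u lam1 L = exp ((lam1 + mu1) / lam1) \<and>
           least_favorable_KKT M f0 f1 eps0 eps1 u
             (\<lambda>x. r0 u lam0 (L x) * f0 x / s0 M f0 u lam0 L)
             (\<lambda>x. r1 u lam1 (L x) * f1 x / s1 M f1 u lam1 L) lam0 lam1 mu0 mu1))"
proof -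
  interpret disjoint_pair M f0 f1 eps0 eps1
    using assms by unfold_locales
  \<comment> \<open>The equation for the likelihood ratio is the quotient of the two exponential
    forms; the terms \<open>- lam / lam = - 1\<close> cancel in it.\<close>
  have ratio: "AE x in M. g1 x / g0 x = exp (- mu1 / lam1 + mu0 / lam0)
           * exp (u * (g1 x / g0 x) powr (-1 + u) / lam1 + (-1 + u) * (g1 x / g0 x) powr u / lam0)
           * (f1 x / f0 x)"
    if lam: "0 < lam0" "0 < lam1"
      and e0: "AE x in M. g0 x = exp ((- lam0 - mu0) / lam0)
           * exp ((1 - u) * (g1 x / g0 x) powr u / lam0) * f0 x"
      and e1: "AE x in M. g1 x = exp ((- lam1 - mu1) / lam1)
           * exp (u * (g1 x / g0 x) powr (-1 + u) / lam1) * f1 x"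
    for u g0 g1 lam0 lam1 mu0 mu1
    using e0 e1
  proof eventually_elim
    case (elim x)
    define L where "L = g1 x / g0 x"
    define P Q where "P = (1 - u) * L powr u / lam0" and "Q = u * L powr (-1 + u) / lam1"
    have "(- lam0 - mu0) / lam0 = - 1 - mu0 / lam0" "(- lam1 - mu1) / lam1 = - 1 - mu1 / lam1"
      using lam by (simp_all add: field_simps)
    moreover have "g0 x = exp ((- lam0 - mu0) / lam0) * exp P * f0 x"
      "g1 x = exp ((- lam1 - mu1) / lam1) * exp Q * f1 x"
      using elim by (simp_all only: P_def Q_def L_def)
    ultimately have "L = (exp (- 1 - mu1 / lam1) * exp Q * f1 x) / (exp (- 1 - mu0 / lam0) * exp P * f0 x)"
      by (simp only: L_def)
    also have "\<dots> = exp ((- 1 - mu1 / lam1) + Q - ((- 1 - mu0 / lam0) + P)) * (f1 x / f0 x)"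
      by (simp add: exp_add exp_diff ac_simps)
    also have "(- 1 - mu1 / lam1) + Q - ((- 1 - mu0 / lam0) + P)
        = (- mu1 / lam1 + mu0 / lam0) + (Q + - P)" by simp
    also have "- P = (-1 + u) * L powr u / lam0"
      using lam by (simp add: P_def field_simps)
    finally show ?case unfolding L_def[symmetric] Q_def exp_add .
  qed
  show ?thesis
  proof (intro conjI ballI allI impI)
    fix u :: real and g0 g1 lam0 lam1 mu0 mu1 assume u: "u \<in> {0<..<1}"
    show "least_favorable_KKT M f0 f1 eps0 eps1 u g0 g1 lam0 lam1 mu0 mu1 \<longleftrightarrow>
        0 < lam0 \<and> 0 < lam1 \<and> pos_density M g0 \<and> pos_density M g1 \<and>
        KL_div M g0 f0 = ereal eps0 \<and> KL_div M g1 f1 = ereal eps1 \<and>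
        (AE x in M. g0 x = exp ((- lam0 - mu0) / lam0)
           * exp ((1 - u) * (g1 x / g0 x) powr u / lam0) * f0 x) \<and>
        (AE x in M. g1 x = exp ((- lam1 - mu1) / lam1)
           * exp (u * (g1 x / g0 x) powr (-1 + u) / lam1) * f1 x) \<and>
        (AE x in M. g1 x / g0 x = exp (- mu1 / lam1 + mu0 / lam0)
           * exp (u * (g1 x / g0 x) powr (-1 + u) / lam1 + (-1 + u) * (g1 x / g0 x) powr u / lam0)
           * (f1 x / f0 x))"
      unfolding KKT_iff_exp_forms[OF u] using ratio by blast
  qed (assumption | rule maxmin_unique_solution multipliers_unique_exist KKT_imp_parameter_system
      parameter_system_imp_KKT | erule conjunct2)+
qed

end
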